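(* Let $M>0$ and $\tau\in(0,1/2)$. There exist constants $C,C_1,C_2>0$ depending only on $M$ and $\tau$ such that the following holds for all positive integers $n,p,s,r$ with $2s\le p$ and $r\le C_2$, every $\lambda\in(0,M]$, all $\alpha_0,\kappa>0$ and every $\epsilon\in[0,1]$. Let $\hat\Gamma$ be any maximizer of $\mathcal{D}_{\mathcal{U}_s}(\Gamma,\{X_i\}_{i=1}^n)$ over $\Gamma\in\mathcal{F}_s$, and let $\hat V\in O(p,r)$ be the matrix whose $l$th column is the $l$th eigenvector of $\hat\Gamma$ (eigenvalues in decreasing order), $l=1,\dots,r$. Then for any $\delta\in(0,1/2)$ satisfying $$C_1\kappa\left(\left(\frac{s\log\frac{ep}{s}}{n\lambda^2}\vee\frac{\epsilon^2}{\lambda^2}\right)+\frac{\log(1/\delta)}{n\lambda^2}\right)\le1,$$ we have $$\|\hat V\hat V^T-VV^T\|_{\rm F}^2\le C\kappa\left(\left(\frac{s\log\frac{ep}{s}}{n\lambda^2}\vee\frac{\epsilon^2}{\lambda^2}\right)+\frac{\log(1/\delta)}{n\lambda^2}\right)$$ with $\mathbb{P}_{(\epsilon,\Gamma,Q)}$-probability at least $1-2\delta$, uniformly over all probability distributions $Q$ on $\mathbb{R}^p$ and all $\Gamma=V\Lambda V^T+I_p\in\mathcal{F}_{s,\lambda}(M,r)$, where $P_\Gamma=EC(0,\Gamma,\eta)$ is an elliptical distribution in canonical representation satisfying the marginal condition with parameters $(\tau,\alpha_0,\kappa)$.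
   Context: Elliptical distributions: $X\sim EC(0,\Sigma,\xi)$ on $\mathbb{R}^p$ means $X=\xi AU$ in distribution, where $A\in\mathbb{R}^{p\times d}$ is deterministic, $\Sigma=AA^T$, $U$ is uniform on the unit sphere of $\mathbb{R}^d$, and $\xi\ge0$ is a real random variable independent of $U$. If $s_{\min}(\Sigma)>0$ (non-degenerate; $s_{\min}$ = smallest singular value), the law of $u^TX/\sqrt{u^T\Sigma u}$ does not depend on $u\in S^{p-1}=\{u\in\mathbb{R}^p:\|u\|=1\}$. $EC(0,\Gamma,\eta)$ is the canonical representation of $EC(0,\Sigma,\xi)$ if $\Gamma=a^{-2}\Sigma$, $\eta=a\xi$ for some $a>0$, and $P_\Gamma\left(\frac{|u^TX|^2}{u^T\Gamma u}\le1\right)=\frac12$, where $P_\Gamma=EC(0,\Gamma,\eta)$; $\Gamma$ is the scatter matrix. $P_\Gamma$ always denotes a canonical representation. Marginal condition with parameters $(\tau,\alpha_0,\kappa)$, $\tau\in(0,1/2)$, $\alpha_0,\kappa>0$: with $G(t)=P_\Gamma\left(\frac{|u^TX|^2}{u^T\Gamma u}\le t\right)$ (independent of $u$), $G$ is continuous at $t=1$, $\inf_{|t|\ge\alpha_0}|G(1)-G(1+t)|\ge\tau$, and $\inf_{0<|t|<\alpha_0}\frac{|G(1)-G(1+t)|}{|t|}\ge\kappa^{-1/2}$. Contamination model: $\mathbb{P}_{(\epsilon,\Gamma,Q)}=(1-\epsilon)P_\Gamma+\epsilon Q$ with $Q$ an arbitrary probability distribution; $X_1,\dots,X_n$ are i.i.d.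 from it, and the same symbol denotes their joint law. $O(p,r)$ is the set of $p\times r$ matrices with orthonormal columns; $\mathrm{supp}(V)$ is the set of indices of nonzero rows of $V$; $$\mathcal{F}_{s,\lambda}(M,r)=\left\{V\Lambda V^T+I_p:\ \Lambda=\mathrm{diag}(\lambda_1,\dots,\lambda_r),\ \lambda\le\lambda_r\le\cdots\le\lambda_1\le M,\ V\in O(p,r),\ |\mathrm{supp}(V)|\le s\right\}.$$ For $S\subset[p]=\{1,\dots,p\}$, $\mathcal{G}(S)=\{G=(g_{ij})\in\mathbb{R}^{p\times p}:g_{ij}=0\text{ if }i\notin S\text{ or }j\notin S\}$; $\mathcal{G}(s)=\bigcup_{|S|\le s}\mathcal{G}(S)$; $\mathcal{F}_s=\{\Gamma\succeq0:\Gamma-\mathrm{diag}(\Gamma)\in\mathcal{G}(s)\}$ with $\mathrm{diag}(\Gamma)$ the diagonal part of $\Gamma$. Directions: $\mathcal{V}_S=\{u\in S^{p-1}:u_i=0\text{ if }i\notin S\}$ and $\mathcal{U}_s=\bigcup_{S\subset[p]:|S|=2s}\mathcal{V}_S$. Empirical matrix depth relative to $\mathcal{U}$: $$\mathcal{D}_{\mathcal{U}}(\Gamma,\{X_i\}_{i=1}^n)=\min_{u\in\mathcal{U}}\min\left\{\frac1n\sum_{i=1}^n\mathbb{I}\{|u^TX_i|^2\le u^T\Gamma u\},\ \frac1n\sum_{i=1}^n\mathbb{I}\{|u^TX_i|^2\ge u^T\Gamma u\}\right\};$$ it takes finitely many values, so maximizers exist. $\|\cdot\|_{\rm F}$ is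 the Frobenius norm; $a\vee b=\max(a,b)$. *)

theory Defs
  imports
    "HOL-Probability.Probability"
    "Jordan_Normal_Form.Char_Poly"
begin

no_notation inner (infix "\<bullet>" 70)

text \<open>
  The dimensions p, d, r are natural numbers that the constants of the theorem must not depend
  on, so matrices and vectors are those of Jordan-Normal-Form, indexed from 0. Probability laws on
  Euclidean p-space are measures on the product sigma-algebra over the index set {..<p}; a point
  x of that space is read as the vector Matrix.vec p x.
\<close>

abbreviation Rn :: "nat \<Rightarrow> (nat \<Rightarrow> real) measure" where
  "Rn p \<equiv> \<Pi>\<^sub>M i\<in>{..<p}. borel"

definition unit_sphere :: "nat \<Rightarrow> real vec set" where
  "unit_sphere p = {u \<in> carrier_vec p. sqrt (u \<bullet> u) = 1}"

section \<open>Elliptical distributions\<close>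

text \<open>
  Normalized surface measure on the unit sphere: the surface measure of a set is proportional to
  the Lebesgue measure of the cone over it, so this is the law of x / |x| for x uniform on the
  unit ball (the origin is a null set). Meaningful for d > 0.
\<close>

definition uniform_sphere :: "nat \<Rightarrow> (nat \<Rightarrow> real) measure" where
  "uniform_sphere d =
     distr (uniform_measure (\<Pi>\<^sub>M i\<in>{..<d}. lborel)
              {x \<in> space (\<Pi>\<^sub>M i\<in>{..<d}. lborel). (\<Sum>i<d. (x i)\<^sup>2) \<le> 1})
       (Rn d) (\<lambda>x. \<lambda>i\<in>{..<d}. x i / sqrt (\<Sum>j<d. (x j)\<^sup>2))"

text \<open>P is the law EC(0, Sigma, xi), where the scalar xi has law \<open>\<nu>\<close>.\<close>

definition elliptical ::
  "nat \<Rightarrow> real mat \<Rightarrow> real measure \<Rightarrow> (nat \<Rightarrow> real) measure \<Rightarrow> bool" where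
  "elliptical p \<Sigma> \<nu> P \<longleftrightarrow>
     prob_space \<nu> \<and> sets \<nu> = sets borel \<and> (AE \<xi> in \<nu>. 0 \<le> \<xi>) \<and>
     (\<exists>d>0. \<exists>A \<in> carrier_mat p d. \<Sigma> = A * transpose_mat A \<and>
        P = distr (\<nu> \<Otimes>\<^sub>M uniform_sphere d) (Rn p)
              (\<lambda>(\<xi>, w). \<lambda>i\<in>{..<p}. \<xi> * (A *\<^sub>v Matrix.vec d w) $ i))"

definition marginal_cdf ::
  "nat \<Rightarrow> real mat \<Rightarrow> (nat \<Rightarrow> real) measure \<Rightarrow> real vec \<Rightarrow> real \<Rightarrow> real" where
  "marginal_cdf p \<Gamma> P u t =
     measure P {x \<in> space P. \<bar>u \<bullet> Matrix.vec p x\<bar>\<^sup>2 / (u \<bullet> (\<Gamma> *\<^sub>v u)) \<le> t}"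

text \<open>
  For a non-degenerate elliptical law the function \<open>marginal_cdf p \<Gamma> P u\<close> is the same for all unit
  vectors u. Conditions on it are therefore imposed at every unit vector.
\<close>

definition canonical_elliptical ::
  "nat \<Rightarrow> real mat \<Rightarrow> real measure \<Rightarrow> (nat \<Rightarrow> real) measure \<Rightarrow> bool" where
  "canonical_elliptical p \<Gamma> \<nu> P \<longleftrightarrow>
     elliptical p \<Gamma> \<nu> P \<and> (\<forall>u\<in>unit_sphere p. marginal_cdf p \<Gamma> P u 1 = 1 / 2)"

definition marginal_condition ::
  "nat \<Rightarrow> real mat \<Rightarrow> (nat \<Rightarrow> real) measure \<Rightarrow> real \<Rightarrow> real \<Rightarrow> real \<Rightarrow> bool" where
  "marginal_condition p \<Gamma> P \<tau> \<alpha>\<^sub>0 \<kappa> \<longleftrightarrow>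
     (\<forall>u\<in>unit_sphere p. let G = marginal_cdf p \<Gamma> P u in
        isCont G 1 \<and>
        (INF t\<in>{t. \<alpha>\<^sub>0 \<le> \<bar>t\<bar>}. \<bar>G 1 - G (1 + t)\<bar>) \<ge> \<tau> \<and>
        (INF t\<in>{t. 0 < \<bar>t\<bar> \<and> \<bar>t\<bar> < \<alpha>\<^sub>0}. \<bar>G 1 - G (1 + t)\<bar> / \<bar>t\<bar>) \<ge> \<kappa> powr (- 1 / 2))"

definition contamination ::
  "real \<Rightarrow> (nat \<Rightarrow> real) measure \<Rightarrow> (nat \<Rightarrow> real) measure \<Rightarrow> (nat \<Rightarrow> real) measure" where
  "contamination \<epsilon> P Q = measure_of (space P) (sets P)
     (\<lambda>B. ennreal (1 - \<epsilon>) * emeasure P B + ennreal \<epsilon> * emeasure Q B)"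

section \<open>Matrix classes\<close>

definition orthonormal_cols :: "nat \<Rightarrow> nat \<Rightarrow> real mat set" where
  "orthonormal_cols p r = {V \<in> carrier_mat p r. transpose_mat V * V = 1\<^sub>m r}"

definition row_support :: "real mat \<Rightarrow> nat set" where
  "row_support V = {i. i < dim_row V \<and> row V i \<noteq> 0\<^sub>v (dim_col V)}"

text \<open>
  \<open>\<Gamma>\<close> lies in the class F_{s,lam}(M,r), with the representation V diag(l 0, ..., l (r-1)) V^T + I
  witnessing this. (V V^T is determined by \<open>\<Gamma>\<close> when lam > 0.)
\<close>

definition spiked_cov ::
  "nat \<Rightarrow> nat \<Rightarrow> real \<Rightarrow> real \<Rightarrow> nat \<Rightarrow> real mat \<Rightarrow> (nat \<Rightarrow> real) \<Rightarrow> real mat \<Rightarrow> bool" where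
  "spiked_cov p s lam M r V l \<Gamma> \<longleftrightarrow>
     V \<in> orthonormal_cols p r \<and> card (row_support V) \<le> s \<and>
     (\<forall>i<r. lam \<le> l i \<and> l i \<le> M) \<and> (\<forall>i j. i \<le> j \<and> j < r \<longrightarrow> l j \<le> l i) \<and>
     \<Gamma> = V * mat_diag r l * transpose_mat V + 1\<^sub>m p"

definition psd :: "nat \<Rightarrow> real mat \<Rightarrow> bool" where
  "psd p \<Gamma> \<longleftrightarrow> \<Gamma> \<in> carrier_mat p p \<and> transpose_mat \<Gamma> = \<Gamma> \<and>
     (\<forall>v \<in> carrier_vec p. 0 \<le> v \<bullet> (\<Gamma> *\<^sub>v v))"

definition supported_on :: "nat \<Rightarrow> nat set \<Rightarrow> real mat set" where
  "supported_on p S = {G \<in> carrier_mat p p.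
     \<forall>i<p. \<forall>j<p. i \<notin> S \<or> j \<notin> S \<longrightarrow> G $$ (i, j) = 0}"

definition sparse_mats :: "nat \<Rightarrow> nat \<Rightarrow> real mat set" where
  "sparse_mats p s = (\<Union>S\<in>{S. S \<subseteq> {..<p} \<and> card S \<le> s}. supported_on p S)"

definition sparse_cov :: "nat \<Rightarrow> nat \<Rightarrow> real mat set" where
  "sparse_cov p s = {\<Gamma>. psd p \<Gamma> \<and> \<Gamma> - mat_diag p (\<lambda>i. \<Gamma> $$ (i, i)) \<in> sparse_mats p s}"

definition frobenius_norm :: "real mat \<Rightarrow> real" where
  "frobenius_norm A = sqrt (\<Sum>i<dim_row A. \<Sum>j<dim_col A. (A $$ (i, j))\<^sup>2)"

text \<open>
  The columns of V are eigenvectors for the r largest eigenvalues of \<open>\<Gamma>\<close>: they are the first r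
  members of some orthonormal eigenbasis (the columns of W) listed by decreasing eigenvalue. When
  eigenvalues coincide V is not unique, and any choice is admitted.
\<close>

definition leading_eigenvectors :: "nat \<Rightarrow> nat \<Rightarrow> real mat \<Rightarrow> real mat \<Rightarrow> bool" where
  "leading_eigenvectors p r \<Gamma> V \<longleftrightarrow>
     r \<le> p \<and> V \<in> orthonormal_cols p r \<and>
     (\<exists>W \<in> orthonormal_cols p p. \<exists>\<mu>.
        (\<forall>i<p. eigenvector \<Gamma> (col W i) (\<mu> i)) \<and>
        (\<forall>i j. i \<le> j \<and> j < p \<longrightarrow> \<mu> j \<le> \<mu> i) \<and>
        (\<forall>k<r. col V k = col W k))"

section \<open>Matrix depth\<close>

definition dirs_on :: "nat \<Rightarrow> nat set \<Rightarrow> real vec set" where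
  "dirs_on p S = {u \<in> unit_sphere p. \<forall>i<p. i \<notin> S \<longrightarrow> u $ i = 0}"

definition sparse_dirs :: "nat \<Rightarrow> nat \<Rightarrow> real vec set" where
  "sparse_dirs p s = (\<Union>S\<in>{S. S \<subseteq> {..<p} \<and> card S = 2 * s}. dirs_on p S)"

definition matrix_depth :: "real vec set \<Rightarrow> nat \<Rightarrow> (nat \<Rightarrow> real vec) \<Rightarrow> real mat \<Rightarrow> real" where
  "matrix_depth U n X \<Gamma> = (INF u\<in>U. min
     (1 / real n * real (card {i. i < n \<and> \<bar>u \<bullet> X i\<bar>\<^sup>2 \<le> u \<bullet> (\<Gamma> *\<^sub>v u)}))
     (1 / real n * real (card {i. i < n \<and> \<bar>u \<bullet> X i\<bar>\<^sup>2 \<ge> u \<bullet> (\<Gamma> *\<^sub>v u)})))"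

definition error_bound ::
  "nat \<Rightarrow> nat \<Rightarrow> nat \<Rightarrow> real \<Rightarrow> real \<Rightarrow> real \<Rightarrow> real \<Rightarrow> real" where
  "error_bound n p s lam \<kappa> \<epsilon> \<delta> =
     \<kappa> * (max (real s * ln (exp 1 * real p / real s) / (real n * lam\<^sup>2)) (\<epsilon>\<^sup>2 / lam\<^sup>2)
          + ln (1 / \<delta>) / (real n * lam\<^sup>2))"

end

theory Submission
  imports Defs
begin

text \<open>
  Write R for the contaminated law, and call {x. (u x)^2 <= a * u G u} the slab of u at level a, where
  G is the true scatter matrix. At level 1 every slab has mass 1/2 under the elliptical law, hence
  R-mass between (1 - eps)/2 and (1 + eps)/2. Suppose that the empirical frequencies of the slabs in
  2s-sparse directions differ from their R-masses by at most \<eta>. Then G has depth at least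
  (1 - eps)/2 - \<eta>, and the maximizer H is at least as deep. If u H u were smaller than (1 - t) * u G u
  for some sparse u, the slab of u at level 1 - t would contain almost half of the sample, and the
  marginal condition, which says that lowering the level to 1 - t costs mass at least t / sqrt \<kappa>,
  would bound t by sqrt \<kappa> * (2 eps + 3 \<eta>). The other side is symmetric. So H and G agree up to this
  relative error in all 2s-sparse directions (\<open>depth_maximizer_quadratic_bound\<close>); both matrices
  are diagonal off a set of 2s coordinates, so they agree to the same order in operator norm
  (\<open>sparse_quadratic_bound_extends\<close>), and the eigenvector equations of H turn this into a
  bound for the projections, the spectral gap of G being at least lam (\<open>eigenspace_perturbation\<close>).

  Two points carry the weight. The first is the size of \<eta>, namely
  sqrt ((s log (ep/s) + log (1/\<delta>)) / n) without a further factor log n. For each support of size 2s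
  the slabs form a class of Vapnik-Chervonenkis type, and an inequality with the sharp rate is proved
  for every such class (\<open>vc_inequality\<close>): a ghost sample and random swaps reduce it to
  Rademacher sums over finitely many index sets, and those are controlled by chaining
  (\<open>rademacher_chaining\<close>), where Dudley's probabilistic argument bounds the packing numbers
  at every scale (\<open>packing_bound\<close>). A union bound over the supports adds log (p choose 2s),
  which is of order s log (ep/s).

  The second is that the marginal condition yields t / sqrt \<kappa> only for t below alpha0, and \<tau> beyond. The
  error 2 eps + 3 \<eta> must therefore be smaller than \<tau>, whereas the smallness hypothesis of the theorem
  bounds \<kappa> * (eps^2 + \<eta>^2) only. What is needed is a positive lower bound for \<kappa> in terms of \<tau> alone
  (\<open>marginal_slope_lower_bound\<close>). It holds because the marginal condition is imposed in all
  directions of a space of dimension at least two: if alpha0 were tiny, the projections of the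
  sample point onto N fixed unit directions of a plane would each fall just above 1 with probability
  \<tau>, but at most two tangents of the unit circle pass near a given point.
\<close>

section \<open>Shattering and the traces of slabs\<close>

text \<open>
  Used twice: to find the affine dependence that prevents halfspaces from shattering large sets, and to
  find a vector in the leading eigenspace that is orthogonal to given vectors.
\<close>

lemma underdetermined_homogeneous_system:
  fixes a :: "'i \<Rightarrow> 'j \<Rightarrow> real"
  assumes "finite I" "finite J" "card I < card J"
  shows "\<exists>c. (\<exists>j\<in>J. c j \<noteq> 0) \<and> (\<forall>i\<in>I. (\<Sum>j\<in>J. a i j * c j) = 0)"
  using assms
proof (induction I arbitrary: a J rule: finite_induct)
  case empty
  then obtain j where "j \<in> J" by fastforce
  then show ?case by (intro exI[of _ "\<lambda>_. 1"]) auto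
next
  case (insert i0 I)
  show ?case
  proof (cases "\<forall>j\<in>J. a i0 j = 0")
    case True
    have "card I < card J" using insert by auto
    from insert.IH[OF insert.prems(1) this, of a] obtain c where
      "\<exists>j\<in>J. c j \<noteq> 0" "\<forall>i\<in>I. (\<Sum>j\<in>J. a i j * c j) = 0" by blast
    with True show ?thesis by (intro exI[of _ c]) auto
  next
    case False
    then obtain j0 where j0: "j0 \<in> J" "a i0 j0 \<noteq> 0" by blast
    define J' where "J' = J - {j0}"
    have J: "J = insert j0 J'" "j0 \<notin> J'" "finite J'"
      using j0 insert.prems by (auto simp: J'_def)
    have "card I < card J'" using insert J by (auto simp: card_insert_disjoint)
    define a' where "a' = (\<lambda>i j. a i j - a i j0 * a i0 j / a i0 j0)"
    from insert.IH[OF J(3) \<open>card I < card J'\<close>, of a'] obtain c where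
      c: "\<exists>j\<in>J'. c j \<noteq> 0" "\<And>i. i \<in> I \<Longrightarrow> (\<Sum>j\<in>J'. a' i j * c j) = 0" by blast
    define c0 where "c0 = - (\<Sum>j\<in>J'. a i0 j * c j) / a i0 j0"
    define d where "d = c(j0 := c0)"
    have sum_d: "(\<Sum>j\<in>J. a i j * d j) = a i j0 * c0 + (\<Sum>j\<in>J'. a i j * c j)" for i
    proof -
      have "(\<Sum>j\<in>J'. a i j * d j) = (\<Sum>j\<in>J'. a i j * c j)"
        using J by (intro sum.cong) (auto simp: d_def)
      then show ?thesis using J by (simp add: d_def)
    qed
    have "(\<Sum>j\<in>J. a i j * d j) = 0" if "i \<in> insert i0 I" for i
    proof (cases "i = i0")
      case True
      then show ?thesis using j0 by (simp add: sum_d c0_def)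
    next
      case False
      then have "i \<in> I" using that by auto
      have "0 = (\<Sum>j\<in>J'. a i j * c j) - (\<Sum>j\<in>J'. (a i j0 / a i0 j0) * (a i0 j * c j))"
        using c(2)[OF \<open>i \<in> I\<close>] by (simp add: a'_def algebra_simps sum_subtractf)
      also have "(\<Sum>j\<in>J'. (a i j0 / a i0 j0) * (a i0 j * c j)) = - a i j0 * c0"
        unfolding sum_distrib_left[symmetric] by (simp add: c0_def)
      finally show ?thesis by (simp add: sum_d)
    qed
    moreover have "\<exists>j\<in>J. d j \<noteq> 0" using c(1) J by (auto simp: d_def)
    ultimately show ?thesis by blast
  qed
qed

definition shatters :: "'a set set \<Rightarrow> 'a set \<Rightarrow> bool" where
  "shatters F B \<longleftrightarrow> (\<lambda>A. A \<inter> B) ` F = Pow B"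

lemma shattersD: "shatters F B \<Longrightarrow> S \<subseteq> B \<Longrightarrow> \<exists>A\<in>F. A \<inter> B = S"
  unfolding shatters_def by (metis PowI imageE)

lemma shattersI: "(\<And>S. S \<subseteq> B \<Longrightarrow> \<exists>A\<in>F. A \<inter> B = S) \<Longrightarrow> shatters F B"
  unfolding shatters_def by (auto simp: image_def) 

lemma inj_on_insert_notin: "inj_on (insert x) {A. x \<notin> A}"
  by (intro inj_onI) (simp add: insert_ident)

text \<open>
  Pajor's form of the Sauer-Shelah lemma. Split the family according to membership of the point x. What
  the two parts shatter together is shattered by F, and what they shatter simultaneously remains
  shattered by F after x is added; inclusion and exclusion for the two parts closes the induction.
\<close>

lemma card_le_card_shattered:
  assumes "finite X" "F \<subseteq> Pow X"
  shows "card F \<le> card {B. B \<subseteq> X \<and> shatters F B}"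
  using assms
proof (induction X arbitrary: F rule: finite_induct)
  case empty
  have "F = {} \<or> F = {{}}" using empty by auto
  moreover have "{B. B \<subseteq> {} \<and> shatters {{}} B} = {{}::'a set}"
    by (auto simp: shatters_def)
  ultimately show ?case by (elim disjE) simp_all
next
  case (insert x X)
  define F1 where "F1 = {A \<in> Pow X. insert x A \<in> F}"
  define F0 where "F0 = {A \<in> Pow X. A \<in> F}"
  have fin: "finite F1" "finite F0" using insert.hyps(1) by (auto simp: F1_def F0_def)
  have eq: "F = F0 \<union> insert x ` F1"
  proof (intro equalityI subsetI)
    fix A assume A: "A \<in> F"
    show "A \<in> F0 \<union> insert x ` F1"
    proof (cases "x \<in> A")
      case True
      then have "A = insert x (A - {x})" by auto
      moreover have "A - {x} \<in> F1" using A insert.prems True by (auto simp: F1_def insert_absorb)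
      ultimately show ?thesis by blast
    qed (use A insert.prems in \<open>auto simp: F0_def\<close>)
  qed (auto simp: F0_def F1_def)
  have inj: "inj_on (insert x) F1" 
    using insert.hyps(2) by (intro inj_on_subset[OF inj_on_insert_notin]) (auto simp: F1_def)
  have "card F = card F0 + card (insert x ` F1)"
    unfolding eq using fin insert.hyps(2) by (intro card_Un_disjoint) (auto simp: F0_def)
  also have "card (insert x ` F1) = card F1" by (rule card_image[OF inj])
  also have "card F0 + card F1 = card (F0 \<union> F1) + card (F0 \<inter> F1)"
    by (rule card_Un_Int[OF fin(2,1)])
  also have "\<dots> \<le> card {B. B \<subseteq> X \<and> shatters (F0 \<union> F1) B}
                    + card {B. B \<subseteq> X \<and> shatters (F0 \<inter> F1) B}"
    by (intro add_mono insert.IH) (auto simp: F0_def F1_def)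
  also have "card {B. B \<subseteq> X \<and> shatters (F0 \<inter> F1) B}
      = card (insert x ` {B. B \<subseteq> X \<and> shatters (F0 \<inter> F1) B})"
    using insert.hyps(2)
    by (intro card_image[symmetric] inj_on_subset[OF inj_on_insert_notin[of x]]) auto
  also have "card {B. B \<subseteq> X \<and> shatters (F0 \<union> F1) B} + \<dots>
      = card ({B. B \<subseteq> X \<and> shatters (F0 \<union> F1) B}
             \<union> insert x ` {B. B \<subseteq> X \<and> shatters (F0 \<inter> F1) B})"
    using insert.hyps by (intro card_Un_disjoint[symmetric]) auto
  also have "\<dots> \<le> card {B. B \<subseteq> insert x X \<and> shatters F B}"
  proof (rule card_mono)
    show "finite {B. B \<subseteq> insert x X \<and> shatters F B}" using insert.hyps(1) by simp
    have "shatters F B" if B: "B \<subseteq> X" "shatters (F0 \<union> F1) B" for B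
    proof (rule shattersI)
      fix S assume "S \<subseteq> B"
      then obtain A where "A \<in> F0 \<union> F1" "A \<inter> B = S" using shattersD[OF B(2)] by blast
      moreover have "insert x A \<inter> B = A \<inter> B" using insert.hyps(2) B(1) by auto
      ultimately show "\<exists>A\<in>F. A \<inter> B = S" by (auto simp: eq)
    qed
    moreover have "shatters F (insert x B)" if B: "B \<subseteq> X" "shatters (F0 \<inter> F1) B" for B
    proof (rule shattersI)
      fix S assume S: "S \<subseteq> insert x B"
      then have "S - {x} \<subseteq> B" by auto
      then obtain A where A: "A \<in> F0 \<inter> F1" "A \<inter> B = S - {x}" using shattersD[OF B(2)] by blast
      then have "x \<notin> A" using insert.hyps(2) by (auto simp: F0_def)
      show "\<exists>A\<in>F. A \<inter> insert x B = S"
      proof (cases "x \<in> S")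
        case True
        then have "insert x A \<inter> insert x B = S" using A(2) by auto
        moreover have "insert x A \<in> F" using A(1) by (simp add: F1_def)
        ultimately show ?thesis by blast
      next
        case False
        then have "A \<inter> insert x B = S" using A(2) \<open>x \<notin> A\<close> by auto
        moreover have "A \<in> F" using A(1) by (simp add: F0_def)
        ultimately show ?thesis by blast
      qed
    qed
    ultimately show "{B. B \<subseteq> X \<and> shatters (F0 \<union> F1) B} \<union> insert x ` {B. B \<subseteq> X \<and> shatters (F0 \<inter> F1) B}
        \<subseteq> {B. B \<subseteq> insert x X \<and> shatters F B}" by auto
  qed
  finally show ?case .
qed

text \<open>
  The weight x discounts each element, so that the sum over all subsets factorizes. Unlike the usual
  bound (em/D)^D this form is valid without a relation between D and the size of X, and the free
  parameter x can be tuned later.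
\<close>

lemma weighted_card_subsets_le:
  fixes x :: real
  assumes "finite X" "0 < x" "x \<le> 1"
  shows "real (card {B. B \<subseteq> X \<and> card B \<le> D}) * x ^ D \<le> exp (x * real (card X))"
proof -
  have "real (card {B. B \<subseteq> X \<and> card B \<le> D}) * x ^ D = (\<Sum>B | B \<subseteq> X \<and> card B \<le> D. x ^ D)" by simp
  also have "\<dots> \<le> (\<Sum>B | B \<subseteq> X \<and> card B \<le> D. x ^ card B)"
    using assms by (intro sum_mono power_decreasing) auto
  also have "\<dots> \<le> (\<Sum>B\<in>Pow X. x ^ card B)"
    using assms by (intro sum_mono2) auto
  also have "\<dots> = (\<Sum>B\<in>Pow X. (\<Prod>i\<in>B. x) * (\<Prod>i\<in>X-B. 1))" by simp
  also have "\<dots> = (\<Prod>i\<in>X. x + 1)" using assms by (subst prod_add) auto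
  also have "\<dots> \<le> (\<Prod>i\<in>X. exp x)" using assms exp_ge_add_one_self[of x] by (intro prod_mono) (auto simp: add.commute)
  also have "\<dots> = exp (x * real (card X))" by (simp add: mult.commute flip: exp_of_nat_mult)
  finally show ?thesis .
qed

lemma sauer_shelah:
  fixes x :: real
  assumes "finite X" "F \<subseteq> Pow X" "0 < x" "x \<le> 1"
    and vc: "\<And>B. B \<subseteq> X \<Longrightarrow> shatters F B \<Longrightarrow> card B \<le> D"
  shows "real (card F) * x ^ D \<le> exp (x * real (card X))"
proof -
  have "card F \<le> card {B. B \<subseteq> X \<and> shatters F B}" by (rule card_le_card_shattered[OF assms(1,2)])
  also have "\<dots> \<le> card {B. B \<subseteq> X \<and> card B \<le> D}"
    using assms(1) vc by (intro card_mono) auto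
  finally have "real (card F) * x ^ D \<le> real (card {B. B \<subseteq> X \<and> card B \<le> D}) * x ^ D"
    using assms(3) by (intro mult_right_mono) auto
  also have "\<dots> \<le> exp (x * real (card X))" by (rule weighted_card_subsets_le[OF assms(1,3,4)])
  finally show ?thesis .
qed

text \<open>
  The Sauer bound for the traces of C on finite sets, with a free parameter x; the choice x = D/|Y|
  recovers the polynomial bound of order (|Y|/D)^D. The factor 2 in the exponent is there because a slab
  is an intersection of two halfspaces.
\<close>

definition vc_growth :: "nat \<Rightarrow> 'a set set \<Rightarrow> bool" where
  "vc_growth D C \<longleftrightarrow> (\<forall>Y x. finite Y \<and> 0 < x \<and> x \<le> 1 \<longrightarrow>
     real (card ((\<lambda>A. A \<inter> Y) ` C)) * x ^ D \<le> exp (2 * x * real (card Y)))"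

definition slab :: "'i set \<Rightarrow> ('i \<Rightarrow> real) \<Rightarrow> real \<Rightarrow> ('i \<Rightarrow> real) set" where
  "slab T q c = {y. \<bar>\<Sum>i\<in>T. q i * y i\<bar> \<le> c}"

text \<open>
  Radon's argument. Among |T| + 2 points there is an affine dependence; a halfspace that contained
  exactly the points with positive coefficient would make the dependence strictly negative on its
  defining affine function.
\<close>

lemma halfspace_traces_shatter:
  fixes z :: "'a \<Rightarrow> 'i \<Rightarrow> real"
  assumes "finite T" "finite B"
    and sh: "shatters {{j \<in> X. (\<Sum>i\<in>T. q i * z j i) \<le> c} | q c. True} B" and "B \<subseteq> X"
  shows "card B \<le> card T + 1"
proof (rule ccontr)
  assume large: "\<not> card B \<le> card T + 1"
  define I where "I = insert None (Some ` T)"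
  have "card I = card T + 1"
    using assms(1) unfolding I_def by (subst card_insert_disjoint) (auto simp: card_image)
  then have "card I < card B" using large by simp
  moreover have "finite I" using assms(1) by (simp add: I_def)
  ultimately have "\<exists>c. (\<exists>j\<in>B. c j \<noteq> 0) \<and>
      (\<forall>i\<in>I. (\<Sum>j\<in>B. (case i of None \<Rightarrow> 1 | Some i \<Rightarrow> z j i) * c j) = 0)"
    using assms(2) by (intro underdetermined_homogeneous_system)
  then obtain c where c: "\<exists>j\<in>B. c j \<noteq> 0"
    "\<forall>i\<in>I. (\<Sum>j\<in>B. (case i of None \<Rightarrow> 1 | Some i \<Rightarrow> z j i) * c j) = 0"
    by (elim exE conjE)
  have c0: "(\<Sum>j\<in>B. c j) = 0" using c(2)[rule_format, of None] by (simp add: I_def)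
  have ci: "(\<Sum>j\<in>B. z j i * c j) = 0" if "i \<in> T" for i
    using c(2)[rule_format, of "Some i"] that by (simp add: I_def)
  have "\<exists>j\<in>B. c j < 0"
  proof (rule ccontr)
    assume "\<not> ?thesis"
    then have "\<forall>j\<in>B. 0 \<le> c j" by force
    with c0 c(1) assms(2) show False by (simp add: sum_nonneg_eq_0_iff)
  qed
  then obtain j0 where j0: "j0 \<in> B" "c j0 < 0" by blast
  have "{j\<in>B. 0 < c j} \<subseteq> B" by auto
  from shattersD[OF sh this] obtain q b where
    qb: "{j \<in> X. (\<Sum>i\<in>T. q i * z j i) \<le> b} \<inter> B = {j\<in>B. 0 < c j}" by blast
  define f where "f = (\<lambda>j. (\<Sum>i\<in>T. q i * z j i) - b)"
  have f: "f j \<le> 0 \<longleftrightarrow> 0 < c j" if "j \<in> B" for j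
    using qb that assms(4) by (auto simp: f_def set_eq_iff)
  have "(\<Sum>j\<in>B. c j * f j) = (\<Sum>j\<in>B. \<Sum>i\<in>T. c j * (q i * z j i)) - (\<Sum>j\<in>B. c j * b)"
    by (simp add: f_def right_diff_distrib sum_subtractf sum_distrib_left)
  also have "(\<Sum>j\<in>B. c j * b) = 0" using c0 by (simp flip: sum_distrib_right)
  also have "(\<Sum>j\<in>B. \<Sum>i\<in>T. c j * (q i * z j i)) = (\<Sum>i\<in>T. q i * (\<Sum>j\<in>B. z j i * c j))"
    by (subst sum.swap) (simp add: sum_distrib_left mult_ac)
  also have "\<dots> = 0" using ci by simp
  finally have s0: "(\<Sum>j\<in>B. c j * f j) = 0" by simp
  have le: "c j * f j \<le> 0" if "j \<in> B" for j
    using f[OF that] by (cases "0 < c j") (auto simp: mult_le_0_iff not_less not_le)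
  have "c j0 * f j0 < 0" using f[OF j0(1)] j0(2) by (auto simp: mult_less_0_iff not_le)
  with sum_strict_mono_ex1[of B "\<lambda>j. c j * f j" "\<lambda>_. 0"] le j0(1) assms(2) have "(\<Sum>j\<in>B. c j * f j) < 0"
    by auto
  with s0 show False by simp
qed

text \<open>
  A slab contains y exactly when a halfspace contains both y and -y, so its trace on Y is determined by
  the trace of one halfspace on the doubled set. Intersecting with a fixed Z allows the slabs to be cut
  down to the underlying space of a measure.
\<close>

lemma vc_growth_slabs:
  fixes T :: "'i set"
  assumes "finite T" "C \<subseteq> {slab T q c \<inter> Z | q c. True}"
  shows "vc_growth (card T + 1) C"
  unfolding vc_growth_def
proof (intro allI impI, elim conjE)
  fix Y :: "('i \<Rightarrow> real) set" and x :: real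
  assume Y: "finite Y" and x: "0 < x" "x \<le> 1"
  define X where "X = Y \<times> (UNIV :: bool set)"
  define z where "z = (\<lambda>(y :: 'i \<Rightarrow> real, b) i. if b then y i else - y i)"
  define H where "H = {{j \<in> X. (\<Sum>i\<in>T. q i * z j i) \<le> c} | q c. True}"
  have X: "finite X" "card X = 2 * card Y"
    using Y by (auto simp: X_def card_cartesian_product)
  have H: "H \<subseteq> Pow X" "finite H"
    using X(1) by (auto simp: H_def intro: finite_subset[of _ "Pow X"])
  have "(\<lambda>A. A \<inter> Y) ` C \<subseteq> (\<lambda>h. {y\<in>Y \<inter> Z. (y, True) \<in> h \<and> (y, False) \<in> h}) ` H"
  proof
    fix S assume "S \<in> (\<lambda>A. A \<inter> Y) ` C"
    then obtain q c where S: "S = slab T q c \<inter> Z \<inter> Y" using assms(2) by blast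
    define h where "h = {j \<in> X. (\<Sum>i\<in>T. q i * z j i) \<le> c}"
    have "S = {y\<in>Y \<inter> Z. (y, True) \<in> h \<and> (y, False) \<in> h}"
      by (auto simp: S slab_def h_def X_def z_def sum_negf abs_le_iff)
    moreover have "h \<in> H" by (auto simp: H_def h_def)
    ultimately show "S \<in> (\<lambda>h. {y\<in>Y \<inter> Z. (y, True) \<in> h \<and> (y, False) \<in> h}) ` H" by blast
  qed
  then have "card ((\<lambda>A. A \<inter> Y) ` C) \<le> card H"
    using H(2) by (rule surj_card_le[rotated])
  then have "real (card ((\<lambda>A. A \<inter> Y) ` C)) * x ^ (card T + 1) \<le> real (card H) * x ^ (card T + 1)"
    using x by (intro mult_right_mono) auto
  also have "\<dots> \<le> exp (x * real (card X))"
  proof (rule sauer_shelah[OF X(1) H(1) x])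
    fix B assume "B \<subseteq> X" "shatters H B"
    then show "card B \<le> card T + 1"
      using halfspace_traces_shatter[OF assms(1) _ _ \<open>B \<subseteq> X\<close>, of z] X(1) finite_subset
      unfolding H_def by blast
  qed
  finally show "real (card ((\<lambda>A. A \<inter> Y) ` C)) * x ^ (card T + 1) \<le> exp (2 * x * real (card Y))"
    by (simp add: X(2) mult_ac)
qed

section \<open>Packing numbers\<close>

lemma vc_growth_subset:
  assumes "vc_growth D F" "G \<subseteq> F"
  shows "vc_growth D G"
  unfolding vc_growth_def
proof (intro allI impI, elim conjE)
  fix Y :: "'a set" and x :: real assume Y: "finite Y" and x: "0 < x" "x \<le> 1"
  have "finite ((\<lambda>A. A \<inter> Y) ` F)"
    by (rule finite_subset[of _ "Pow Y"]) (use Y in auto)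
  then have "card ((\<lambda>A. A \<inter> Y) ` G) \<le> card ((\<lambda>A. A \<inter> Y) ` F)"
    using assms(2) by (intro card_mono image_mono)
  then have "real (card ((\<lambda>A. A \<inter> Y) ` G)) * x ^ D \<le> real (card ((\<lambda>A. A \<inter> Y) ` F)) * x ^ D"
    using x by (intro mult_right_mono) auto
  also have "\<dots> \<le> exp (2 * x * real (card Y))"
    using assms(1) Y x unfolding vc_growth_def by blast
  finally show "real (card ((\<lambda>A. A \<inter> Y) ` G)) * x ^ D \<le> exp (2 * x * real (card Y))" .
qed

lemma card_PiE_const:
  "card (PiE {..<m::nat} (\<lambda>_. B)) = card B ^ m"
  by (simp add: card_PiE)

text \<open>
  A uniformly random sample of m indices misses the symmetric difference of two given members with
  probability at most (1 - e)^m <= exp (- e m); the hypothesis on m makes the union bound over all pairs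
  smaller than 1. The probability is expressed by counting functions.
\<close>

lemma separating_sample_exists:
  fixes e :: real
  assumes F: "F \<subseteq> Pow {..<n}" and n: "0 < n" and e: "0 < e" "e \<le> 1"
    and sep: "\<And>A B. A \<in> F \<Longrightarrow> B \<in> F \<Longrightarrow> A \<noteq> B \<Longrightarrow> e * real n < real (card (sym_diff A B))"
    and m: "2 * ln (real (card F)) < e * real m" and N: "0 < card F"
  shows "\<exists>f \<in> {..<m} \<rightarrow>\<^sub>E {..<n}. inj_on (\<lambda>A. A \<inter> f ` {..<m}) F"
proof (rule ccontr)
  assume neg: "\<not> ?thesis"
  define P where "P = {(A, B). A \<in> F \<and> B \<in> F \<and> A \<noteq> B}"
  have finF: "finite F" using F by (rule finite_subset) auto
  then have finP: "finite P" "card P \<le> card F ^ 2"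
  proof -
    have "P \<subseteq> F \<times> F" by (auto simp: P_def)
    moreover have fin2: "finite (F \<times> F)" using finF by simp
    ultimately show "finite P" by (rule finite_subset)
    have "card P \<le> card (F \<times> F)" by (rule card_mono[OF fin2 \<open>P \<subseteq> F \<times> F\<close>])
    then show "card P \<le> card F ^ 2" by (simp add: card_cartesian_product power2_eq_square)
  qed
  define miss where "miss = (\<lambda>(A, B). {..<m} \<rightarrow>\<^sub>E ({..<n} - sym_diff A B))"
  have "{..<m} \<rightarrow>\<^sub>E {..<n} \<subseteq> (\<Union>z\<in>P. miss z)"
  proof
    fix f assume f: "f \<in> {..<m} \<rightarrow>\<^sub>E {..<n}"
    with neg have "\<not> inj_on (\<lambda>A. A \<inter> f ` {..<m}) F" by blast
    then obtain A B where AB: "A \<in> F" "B \<in> F" "A \<noteq> B" "A \<inter> f ` {..<m} = B \<inter> f ` {..<m}"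
      by (auto simp: inj_on_def)
    have "f i \<notin> sym_diff A B" if "i < m" for i
      using AB(4) that by blast
    then have "f \<in> miss (A, B)" using f unfolding miss_def prod.case by (simp add: PiE_iff)
    then show "f \<in> (\<Union>z\<in>P. miss z)" using AB by (auto simp: P_def)
  qed
  then have "card ({..<m} \<rightarrow>\<^sub>E {..<n}) \<le> card (\<Union>z\<in>P. miss z)"
    by (intro card_mono) (auto simp: finP miss_def finite_PiE split: prod.splits)
  also have "\<dots> \<le> (\<Sum>z\<in>P. card (miss z))" by (rule card_UN_le[OF finP(1)])
  finally have "real n ^ m \<le> (\<Sum>z\<in>P. real (card (miss z)))"
    unfolding card_PiE_const by (metis card_lessThan of_nat_le_iff of_nat_power of_nat_sum)
  also have "\<dots> \<le> (\<Sum>z\<in>P. (real n * (1 - e)) ^ m)"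
  proof (rule sum_mono)
    fix z assume "z \<in> P"
    then obtain A B where z: "z = (A, B)" "A \<in> F" "B \<in> F" "A \<noteq> B" by (auto simp: P_def)
    then have sub: "sym_diff A B \<subseteq> {..<n}" using F by blast
    then have "card ({..<n} - sym_diff A B) = n - card (sym_diff A B)"
      using finite_subset[OF sub] by (simp add: card_Diff_subset)
    moreover have "card (sym_diff A B) \<le> n" using card_mono[OF _ sub] by simp
    ultimately have "real (card ({..<n} - sym_diff A B)) \<le> real n * (1 - e)"
      using sep[OF z(2-4)] by (simp add: algebra_simps of_nat_diff)
    then show "real (card (miss z)) \<le> (real n * (1 - e)) ^ m"
      unfolding miss_def z(1) prod.case card_PiE_const of_nat_power by (intro power_mono) auto
  qed
  also have "\<dots> = real (card P) * (real n ^ m * (1 - e) ^ m)" by (simp add: power_mult_distrib)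
  finally have "real n ^ m * 1 \<le> real n ^ m * (real (card P) * (1 - e) ^ m)" by (simp add: mult_ac)
  then have "1 \<le> real (card P) * (1 - e) ^ m" using n by (simp only: mult_le_cancel_left_pos zero_less_power of_nat_0_less_iff)
  also have "\<dots> \<le> real (card F ^ 2) * (exp (- e)) ^ m"
    using finP(2) e exp_ge_add_one_self[of "- e"]
    by (intro mult_mono power_mono) (auto simp: of_nat_mono simp del: of_nat_power)
  also have "\<dots> = exp (2 * ln (real (card F)) - e * real m)"
    using N by (simp add: exp_diff exp_minus power2_eq_square exp_of_nat_mult[symmetric] mult_ac field_simps exp_double)
  also have "\<dots> < 1" using m by simp
  finally show False by simp
qed

text \<open>
  Dudley's argument: about 2 ln N / e sample points separate all N members of the family, so that N is
  bounded by the growth function at that many points. The parameter of the growth bound is set to e/8,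
  for which the exponential factor is at most N^(1/2) up to a constant and can be absorbed.
\<close>

lemma packing_bound:
  fixes e :: real
  assumes growth: "vc_growth D F" and F: "F \<subseteq> Pow {..<n}" and n: "0 < n" and e: "0 < e" "e \<le> 1"
    and sep: "\<And>A B. A \<in> F \<Longrightarrow> B \<in> F \<Longrightarrow> A \<noteq> B \<Longrightarrow> e * real n < real (card (sym_diff A B))"
  shows "real (card F) \<le> 2 * (8 / e) ^ (2 * D)"
proof (cases "card F = 0")
  case False
  define N where "N = real (card F)"
  have N: "1 \<le> N" using False by (simp add: N_def)
  \<comment> \<open>the least sample size for which a separating sample is guaranteed\<close>
  define m where "m = nat \<lfloor>2 * ln N / e\<rfloor> + 1"
  have nn: "0 \<le> 2 * ln N / e" using N e by simp
  have m: "2 * ln N / e < real m" "real m \<le> 2 * ln N / e + 1"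
    unfolding m_def using nn by linarith+
  have "2 * ln N < e * real m" using m(1) e by (simp add: field_simps)
  then obtain f where f: "f \<in> {..<m} \<rightarrow>\<^sub>E {..<n}" "inj_on (\<lambda>A. A \<inter> f ` {..<m}) F"
    using separating_sample_exists[OF F n e sep, of m] False unfolding N_def by auto
  have "N = real (card ((\<lambda>A. A \<inter> f ` {..<m}) ` F))"
    unfolding N_def by (simp add: card_image[OF f(2)])
  then have "N * (e / 8) ^ D \<le> exp (2 * (e / 8) * real (card (f ` {..<m})))"
    using growth[unfolded vc_growth_def, rule_format, of "f ` {..<m}" "e / 8"] e by simp
  also have "\<dots> \<le> exp (ln N / 2 + 1 / 4)"
  proof -
    have "real (card (f ` {..<m})) \<le> real m" using card_image_le[of "{..<m}" f] by simp
    also note m(2)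
    finally have "2 * (e / 8) * real (card (f ` {..<m})) \<le> 2 * (e / 8) * (2 * ln N / e + 1)"
      using e by (intro mult_left_mono) auto
    also have "\<dots> = ln N / 2 + e / 4" using e by (simp add: field_simps)
    also have "\<dots> \<le> ln N / 2 + 1 / 4" using e by simp
    finally show ?thesis by simp
  qed
  finally have "(N * (e / 8) ^ D)\<^sup>2 \<le> (exp (ln N / 2 + 1 / 4))\<^sup>2"
    using N e by (intro power_mono) auto
  also have "\<dots> = N * exp (1 / 2)"
    using N by (simp add: exp_add power2_eq_square exp_add[symmetric] del: exp_add) (simp add: exp_add)
  finally have "N * (N * (e / 8) ^ (2 * D)) \<le> N * exp (1 / 2)"
    by (simp add: power2_eq_square power_mult_distrib mult_2_right[symmetric] power_add[symmetric] mult_ac)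
  then have "N * (e / 8) ^ (2 * D) \<le> exp (1 / 2)" using N by simp
  also have "exp (1 / 2 :: real) \<le> 2"
    using exp_bound_half[of "1 / 2 :: real"] by simp
  finally have "N \<le> 2 / (e / 8) ^ (2 * D)" using e by (simp add: pos_le_divide_eq)
  also have "\<dots> = 2 * (8 / e) ^ (2 * D)" by (simp add: power_divide)
  finally show ?thesis by (simp add: N_def)
qed (use e in auto)

text \<open>
  A maximal separated subfamily is automatically a net at the same scale.
\<close>

lemma maximal_separated_subfamily:
  fixes r :: real
  assumes "finite F" "0 \<le> r"
  obtains G where "G \<subseteq> F"
    "\<And>A B. A \<in> G \<Longrightarrow> B \<in> G \<Longrightarrow> A \<noteq> B \<Longrightarrow> r < real (card (sym_diff A B))"
    "\<And>A. A \<in> F \<Longrightarrow> \<exists>B\<in>G. real (card (sym_diff A B)) \<le> r"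
proof -
  define S where "S = {G. G \<subseteq> F \<and> (\<forall>A\<in>G. \<forall>B\<in>G. A \<noteq> B \<longrightarrow> r < real (card (sym_diff A B)))}"
  have "finite S" using assms(1) by (auto simp: S_def intro: finite_subset[of _ "Pow F"])
  moreover have "{} \<in> S" by (auto simp: S_def)
  ultimately obtain G where G: "G \<in> S" "\<And>G'. G' \<in> S \<Longrightarrow> G \<subseteq> G' \<Longrightarrow> G = G'"
    using finite_has_maximal[of S] by (metis empty_iff)
  have near: "\<exists>B\<in>G. real (card (sym_diff A B)) \<le> r" if "A \<in> F" for A
  proof (rule ccontr)
    assume far: "\<not> ?thesis"
    then have far': "r < real (card (sym_diff A B))" if "B \<in> G" for B
      using that by (meson not_le)
    then have far'': "r < real (card (sym_diff B A))" if "B \<in> G" for B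
      using that by (subst Un_commute)
    have "insert A G \<in> S" using far' far'' G(1) that unfolding S_def by (simp add: Ball_def)
    then have "A \<in> G" using G(2) by blast
    then show False using far'(1)[of A] assms(2) by simp
  qed
  show thesis
    by (rule that[of G]) (use G(1) near in \<open>auto simp: S_def\<close>)
qed

section \<open>Chaining for Rademacher sums\<close>

definition signs :: "nat \<Rightarrow> (nat \<Rightarrow> real) set" where
  "signs n = {..<n} \<rightarrow>\<^sub>E {-1, 1}"

lemma finite_signs [simp]: "finite (signs n)"
  by (simp add: signs_def finite_PiE)

lemma card_signs: "card (signs n) = 2 ^ n"
  by (simp add: signs_def card_PiE numeral_2_eq_2)

text \<open>
  The case of a fair coin of Hoeffding's lemma, in the form of the inequality for cosh.
\<close>

lemma exp_average_le: "exp x + exp (- x) \<le> 2 * exp (x\<^sup>2 / 2)" for x :: real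
proof -
  have pos: "exp x + exp (- x) \<le> 2 * exp (x\<^sup>2 / 2)" if "0 \<le> x" for x :: real
  proof -
    have "- (2 * x) * (1 / 2) + ln (1 + (1 / 2) * (exp (2 * x) - 1)) \<le> (2 * x)\<^sup>2 / 8"
      using Hoeffdings_lemma_aux[of "2 * x" "1 / 2"] that by simp
    then have "ln ((1 + exp (2 * x)) / 2) \<le> x + x\<^sup>2 / 2"
      by (simp add: power2_eq_square field_simps)
    then have "exp (ln ((1 + exp (2 * x)) / 2)) \<le> exp (x + x\<^sup>2 / 2)" by simp
    then have "(1 + exp (2 * x)) \<le> 2 * exp x * exp (x\<^sup>2 / 2)"
      by (subst (asm) exp_ln) (auto simp: exp_add add_pos_pos)
    then have "exp (- x) * (1 + exp (2 * x)) \<le> exp (- x) * (2 * exp x * exp (x\<^sup>2 / 2))"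
      by (intro mult_left_mono) auto
    also have "exp (- x) * (1 + exp (2 * x)) = exp x + exp (- x)"
      by (simp add: distrib_left flip: exp_add)
    also have "exp (- x) * (2 * exp x * exp (x\<^sup>2 / 2)) = 2 * exp (x\<^sup>2 / 2)"
      by (simp add: exp_minus field_simps)
    finally show ?thesis .
  qed
  show ?thesis using pos[of x] pos[of "- x"] by (cases "0 \<le> x") (auto simp: add.commute)
qed

lemma rademacher_mgf:
  "(\<Sum>\<sigma>\<in>signs n. exp (\<Sum>i<n. b i * \<sigma> i)) \<le> 2 ^ n * exp ((\<Sum>i<n. (b i)\<^sup>2) / 2)"
proof -
  have "(\<Sum>\<sigma>\<in>signs n. exp (\<Sum>i<n. b i * \<sigma> i)) = (\<Sum>\<sigma>\<in>signs n. \<Prod>i<n. exp (b i * \<sigma> i))"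
    by (simp add: exp_sum)
  also have "\<dots> = (\<Prod>i<n. \<Sum>y\<in>{-1, 1}. exp (b i * y))"
    unfolding signs_def by (subst prod_sum_PiE) auto
  also have "\<dots> \<le> (\<Prod>i<n. 2 * exp ((b i)\<^sup>2 / 2))"
    using exp_average_le by (intro prod_mono) (auto simp: add.commute)
  also have "\<dots> = 2 ^ n * exp ((\<Sum>i<n. (b i)\<^sup>2) / 2)"
    by (simp add: prod.distrib exp_sum sum_divide_distrib)
  finally show ?thesis .
qed

text \<open>
  The exponential moment method with the optimal parameter t/v.
\<close>

lemma rademacher_tail:
  fixes b :: "nat \<Rightarrow> real"
  assumes v: "(\<Sum>i<n. (b i)\<^sup>2) \<le> v" "0 < v" and t: "0 \<le> t"
  shows "real (card {\<sigma> \<in> signs n. t < \<bar>\<Sum>i<n. b i * \<sigma> i\<bar>}) \<le> 2 ^ n * (2 * exp (- t\<^sup>2 / (2 * v)))"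
proof -
  define l where "l = t / v"
  have l: "0 \<le> l" using v t by (simp add: l_def)
  have ind: "1 \<le> (exp (\<Sum>i<n. (l * b i) * \<sigma> i) + exp (\<Sum>i<n. (- l * b i) * \<sigma> i)) * exp (- l * t)"
    if "t < \<bar>\<Sum>i<n. b i * \<sigma> i\<bar>" for \<sigma>
  proof -
    define s where "s = (\<Sum>i<n. b i * \<sigma> i)"
    have s: "(\<Sum>i<n. (l * b i) * \<sigma> i) = l * s" "(\<Sum>i<n. (- l * b i) * \<sigma> i) = - (l * s)"
      by (simp_all add: s_def sum_distrib_left mult.assoc flip: sum_negf)
    have "exp (l * t) \<le> exp (l * \<bar>s\<bar>)" using that l by (auto simp: s_def intro: mult_left_mono)
    also have "\<dots> \<le> exp (l * s) + exp (- (l * s))" by (cases "0 \<le> s") auto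
    finally show ?thesis unfolding s by (simp add: exp_minus field_simps)
  qed
  have "real (card {\<sigma> \<in> signs n. t < \<bar>\<Sum>i<n. b i * \<sigma> i\<bar>})
      = (\<Sum>\<sigma> | \<sigma> \<in> signs n \<and> t < \<bar>\<Sum>i<n. b i * \<sigma> i\<bar>. 1)" by simp
  also have "\<dots> \<le> (\<Sum>\<sigma> | \<sigma> \<in> signs n \<and> t < \<bar>\<Sum>i<n. b i * \<sigma> i\<bar>.
      (exp (\<Sum>i<n. (l * b i) * \<sigma> i) + exp (\<Sum>i<n. (- l * b i) * \<sigma> i)) * exp (- l * t))"
    by (intro sum_mono ind) auto
  also have "\<dots> \<le> (\<Sum>\<sigma> \<in> signs n.
      (exp (\<Sum>i<n. (l * b i) * \<sigma> i) + exp (\<Sum>i<n. (- l * b i) * \<sigma> i)) * exp (- l * t))"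
    by (intro sum_mono2) auto
  also have "\<dots> = ((\<Sum>\<sigma>\<in>signs n. exp (\<Sum>i<n. (l * b i) * \<sigma> i))
      + (\<Sum>\<sigma>\<in>signs n. exp (\<Sum>i<n. (- l * b i) * \<sigma> i))) * exp (- l * t)"
    by (simp only: sum.distrib flip: sum_distrib_right)
  also have "\<dots> \<le> (2 ^ n * exp ((\<Sum>i<n. (l * b i)\<^sup>2) / 2) + 2 ^ n * exp ((\<Sum>i<n. (- l * b i)\<^sup>2) / 2)) * exp (- l * t)"
    by (intro mult_right_mono add_mono rademacher_mgf) auto
  also have "\<dots> = 2 ^ n * 2 * (exp (l\<^sup>2 * (\<Sum>i<n. (b i)\<^sup>2) / 2) * exp (- l * t))"
    by (simp add: power_mult_distrib sum_distrib_left)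
  also have "\<dots> \<le> 2 ^ n * 2 * (exp (l\<^sup>2 * v / 2) * exp (- l * t))"
    using v by (intro mult_left_mono mult_right_mono) (auto intro: mult_left_mono)
  also have "exp (l\<^sup>2 * v / 2) * exp (- l * t) = exp (- t\<^sup>2 / (2 * v))"
  proof -
    have "l\<^sup>2 * v / 2 + - l * t = - t\<^sup>2 / (2 * v)"
      using v by (simp add: l_def power2_eq_square field_simps)
    then show ?thesis by (simp flip: exp_add)
  qed
  finally show ?thesis by (simp add: mult.assoc)
qed

lemma rademacher_link_tail:
  assumes AB: "A \<subseteq> {..<n}" "B \<subseteq> {..<n}" and v: "real (card (sym_diff A B)) \<le> v" "0 < v" and t: "0 \<le> t"
  shows "real (card {\<sigma> \<in> signs n. t < \<bar>(\<Sum>i\<in>A. \<sigma> i) - (\<Sum>i\<in>B. \<sigma> i)\<bar>}) \<le> 2 ^ n * (2 * exp (- t\<^sup>2 / (2 * v)))"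
proof -
  define b where "b = (\<lambda>i. indicat_real A i - indicat_real B i)"
  have "(\<Sum>i\<in>A. \<sigma> i) - (\<Sum>i\<in>B. \<sigma> i) = (\<Sum>i<n. b i * \<sigma> i)" for \<sigma>
  proof -
    have "(\<Sum>i<n. indicat_real S i * \<sigma> i) = (\<Sum>i\<in>S. \<sigma> i)" if "S \<subseteq> {..<n}" for S
    proof -
      have "(\<Sum>i<n. indicat_real S i * \<sigma> i) = (\<Sum>i\<in>S. indicat_real S i * \<sigma> i)"
        using that by (intro sum.mono_neutral_right) auto
      then show ?thesis by simp
    qed
    then show ?thesis using AB by (simp add: b_def left_diff_distrib sum_subtractf)
  qed
  moreover have "(\<Sum>i<n. (b i)\<^sup>2) = real (card (sym_diff A B))"
  proof -
    have "(\<Sum>i<n. (b i)\<^sup>2) = (\<Sum>i<n. indicat_real (sym_diff A B) i)"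
      by (intro sum.cong) (auto simp: b_def indicator_def)
    also have "\<dots> = (\<Sum>i\<in>sym_diff A B. indicat_real (sym_diff A B) i)"
      using AB by (intro sum.mono_neutral_right) auto
    finally show ?thesis by (simp del: Un_iff Diff_iff)
  qed
  ultimately show ?thesis using rademacher_tail[of b n v t] v t by simp
qed

lemma sum_Suc_over_two_powers_le: "(\<Sum>j<J. real (Suc j) / 2 ^ Suc j) \<le> 2"
proof -
  have "(\<Sum>j<J. real (Suc j) / 2 ^ Suc j) = 2 - (real J + 2) / 2 ^ J"
    by (induction J) (auto simp: field_simps)
  also have "\<dots> \<le> 2" by simp
  finally show ?thesis .
qed

lemma sum_inverse_two_powers_le: "(\<Sum>j<J. 1 / 2 ^ Suc j) \<le> (1 :: real)"
proof -
  have "(\<Sum>j<J. 1 / 2 ^ Suc j) = 1 - 1 / (2::real) ^ J"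
    by (induction J) (auto simp: field_simps)
  then show ?thesis by simp
qed

lemma real_card_UN_le:
  "finite I \<Longrightarrow> real (card (\<Union>i\<in>I. A i)) \<le> (\<Sum>i\<in>I. real (card (A i)))"
  using of_nat_mono[OF card_UN_le, of I A] by simp

text \<open>
  Chaining over the scales 4^(-j). At scale j each member of F is replaced by a nearest element of a
  net; consecutive approximations differ in at most v j = 5n/4^(j+1) indices, and there are at most
  exp (O(D j)) pairs of them, so that the deviation t j of order 2^(-j) sqrt (n (D j + ln (1/\<delta>))) is
  exceeded with probability at most \<delta>/2^(j+1). The deviations sum to a multiple of
  sqrt (n (D + ln (1/\<delta>))): the geometric decay of the scales absorbs the growing number of pairs, which
  is why no factor ln n appears. The net at scale 0 consists of the empty set alone.
\<close>

theorem rademacher_chaining: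
  fixes \<delta> :: real
  assumes F: "F \<subseteq> Pow {..<n}" and growth: "vc_growth D F" and D: "1 \<le> D" and n: "1 \<le> n"
    and \<delta>: "0 < \<delta>" "\<delta> < 1"
  shows "real (card {\<sigma> \<in> signs n. \<exists>A\<in>F. 29 * sqrt (real n * (real D + ln (1 / \<delta>))) < \<bar>\<Sum>i\<in>A. \<sigma> i\<bar>})
    \<le> \<delta> * 2 ^ n"
proof -
  define L where "L = ln (1 / \<delta>)"
  have L: "0 < L" using \<delta> by (simp add: L_def)
  have expL: "exp (- L) = \<delta>" using \<delta> by (simp add: L_def ln_div)
  have finF: "finite F" using F by (rule finite_subset) auto
  have "\<exists>G. (\<forall>A\<in>G. A \<subseteq> {..<n}) \<and> real (card G) \<le> 2 * (8 * 4 ^ j) ^ (2 * D) \<and>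
      (\<forall>A\<in>F. \<exists>B\<in>G. real (card (sym_diff A B)) \<le> real n / 4 ^ j) \<and> finite G" for j :: nat
  proof -
    have r: "0 \<le> 1 / 4 ^ j * real n" by simp
    obtain G where G: "G \<subseteq> F"
      "\<And>A B. A \<in> G \<Longrightarrow> B \<in> G \<Longrightarrow> A \<noteq> B \<Longrightarrow> 1 / 4 ^ j * real n < real (card (sym_diff A B))"
      "\<And>A. A \<in> F \<Longrightarrow> \<exists>B\<in>G. real (card (sym_diff A B)) \<le> 1 / 4 ^ j * real n"
      using maximal_separated_subfamily[OF finF r] by metis
    have "real (card G) \<le> 2 * (8 / (1 / 4 ^ j)) ^ (2 * D)"
      by (rule packing_bound[OF vc_growth_subset[OF growth G(1)] _ _ _ _ G(2)])
         (use G(1) F n in auto)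
    then show ?thesis using G F finF finite_subset[OF G(1) finF] by (intro exI[of _ G]) auto
  qed
  then obtain G0 where G0: "\<And>j A. A \<in> G0 j \<Longrightarrow> A \<subseteq> {..<n}"
    "\<And>j. real (card (G0 j)) \<le> 2 * (8 * 4 ^ j) ^ (2 * D)"
    "\<And>j A. A \<in> F \<Longrightarrow> \<exists>B\<in>G0 j. real (card (sym_diff A B)) \<le> real n / 4 ^ j"
    "\<And>j. finite (G0 j)"
    by metis
  define G where "G = (\<lambda>j. if j = 0 then {{}} else G0 j)"
  have G1: "A \<in> G j \<Longrightarrow> A \<subseteq> {..<n}" and finG: "finite (G j)" for A j
    using G0(1,4) by (auto simp: G_def split: if_splits)
  have G2: "real (card (G j)) \<le> 2 * (8 * 4 ^ j) ^ (2 * D)" for j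
  proof (cases "j = 0")
    case True
    have "1 \<le> (8 * 4 ^ j :: real) ^ (2 * D)" by (intro one_le_power) (auto simp: True)
    then have "1 \<le> 2 * (8 * 4 ^ j :: real) ^ (2 * D)" by linarith
    then show ?thesis using True by (simp add: G_def)
  qed (use G0(2) in \<open>simp add: G_def\<close>)
  have G3: "\<exists>B\<in>G j. real (card (sym_diff A B)) \<le> real n / 4 ^ j" if "A \<in> F" for A j
  proof (cases "j = 0")
    case True
    have "card A \<le> n" using card_mono[of "{..<n}" A] F that by auto
    then show ?thesis using True by (simp add: G_def)
  qed (use G0(3)[OF that] in \<open>simp add: G_def\<close>)
  define nearest where "nearest = (\<lambda>j A. SOME B. B \<in> G j \<and> real (card (sym_diff A B)) \<le> real n / 4 ^ j)"
  have nearest: "nearest j A \<in> G j" "real (card (sym_diff A (nearest j A))) \<le> real n / 4 ^ j"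
    if "A \<in> F" for A j
    using someI_ex[OF G3[OF that, of j, unfolded Bex_def]] unfolding nearest_def by auto
  define v where "v = (\<lambda>j. 5 * real n / 4 ^ Suc j)"
  define t where "t = (\<lambda>j. sqrt (2 * v j * (20 * real D * real (Suc j) + L)))"
  have v: "0 < v j" for j using n by (simp add: v_def)
  have t: "0 \<le> t j" for j using v[of j] L by (simp add: t_def)
  have t2: "(t j)\<^sup>2 = 2 * v j * (20 * real D * real (Suc j) + L)" for j
    using v[of j] L unfolding t_def by (intro real_sqrt_pow2) auto
  define pairs where "pairs = (\<lambda>j. {(A, B). A \<in> G (Suc j) \<and> B \<in> G j \<and> real (card (sym_diff A B)) \<le> v j})"
  define dev where "dev = (\<lambda>j (A, B). {\<sigma> \<in> signs n. t j < \<bar>(\<Sum>i\<in>A. \<sigma> i) - (\<Sum>i\<in>B. \<sigma> i)\<bar>})"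
  define bad where "bad = (\<lambda>j. \<Union>z\<in>pairs j. dev j z)"
  have pairs: "finite (pairs j)" "card (pairs j) \<le> card (G (Suc j)) * card (G j)" for j
  proof -
    have sub: "pairs j \<subseteq> G (Suc j) \<times> G j" by (auto simp: pairs_def)
    have fin: "finite (G (Suc j) \<times> G j)" using finG by simp
    show "finite (pairs j)" by (rule finite_subset[OF sub fin])
    show "card (pairs j) \<le> card (G (Suc j)) * card (G j)"
      using card_mono[OF fin sub] by (simp add: card_cartesian_product)
  qed
  have bad: "real (card (bad j)) \<le> 2 ^ n * \<delta> * (1 / 2 ^ Suc j)" for j
  proof -
    have "real (card (bad j)) \<le> (\<Sum>z\<in>pairs j. real (card (dev j z)))"
      unfolding bad_def by (rule real_card_UN_le[OF pairs(1)])
    also have "\<dots> \<le> (\<Sum>z\<in>pairs j. 2 ^ n * (2 * exp (- (20 * real D * real (Suc j) + L))))"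
    proof (rule sum_mono)
      fix z assume "z \<in> pairs j"
      then obtain A B where z: "z = (A, B)" "A \<in> G (Suc j)" "B \<in> G j" "real (card (sym_diff A B)) \<le> v j"
        by (auto simp: pairs_def)
      have "real (card (dev j z)) \<le> 2 ^ n * (2 * exp (- (t j)\<^sup>2 / (2 * v j)))"
        unfolding dev_def z(1) prod.case
        by (rule rademacher_link_tail[OF G1[OF z(2)] G1[OF z(3)] z(4) v t])
      also have "- (t j)\<^sup>2 / (2 * v j) = - (20 * real D * real (Suc j) + L)"
        unfolding t2 using v[of j] by (simp add: field_simps)
      finally show "real (card (dev j z)) \<le> 2 ^ n * (2 * exp (- (20 * real D * real (Suc j) + L)))" .
    qed
    also have "\<dots> = real (card (pairs j)) * (2 ^ n * 2 * (exp (- (20 * real D * real (Suc j))) * \<delta>))"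
      by (simp add: expL[symmetric] exp_add[symmetric])
    also have "\<dots> = 2 ^ n * \<delta> * (2 * real (card (pairs j)) * exp (- (20 * real D * real (Suc j))))"
      by simp
    also have "\<dots> \<le> 2 ^ n * \<delta> * (1 / 2 ^ Suc j)"
    proof (intro mult_left_mono)
      have "real (card (pairs j)) \<le> real (card (G (Suc j))) * real (card (G j))"
        using of_nat_mono[OF pairs(2)[of j], where ?'a = real] by simp
      also have "\<dots> \<le> (2 * (8 * 4 ^ Suc j) ^ (2 * D)) * (2 * (8 * 4 ^ j) ^ (2 * D))"
        by (intro mult_mono G2) auto
      also have "\<dots> = 2 * 2 * ((8 * 4 ^ Suc j) * (8 * 4 ^ j)) ^ (2 * D)"
        by (simp only: power_mult_distrib mult.assoc mult.left_commute)
      also have "(8 * 4 ^ Suc j) * (8 * 4 ^ j) = (2 :: real) ^ (4 * Suc j + 4)"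
      proof -
        have four: "(4 :: real) ^ k = 2 ^ (2 * k)" for k by (simp add: power_mult)
        show ?thesis by (simp add: four power_add[symmetric] mult_2_right[symmetric] del: power_Suc) (simp add: power_add mult_2_right)
      qed
      also have "((2 :: real) ^ (4 * Suc j + 4)) ^ (2 * D) \<le> (2 ^ (8 * Suc j)) ^ (2 * D)"
        by (intro power_mono power_increasing) auto
      also have "(2 ^ (8 * Suc j)) ^ (2 * D) = (2 :: real) ^ (16 * Suc j * D)"
        by (simp add: power_mult[symmetric] mult_ac)
      finally have card: "real (card (pairs j)) \<le> 4 * 2 ^ (16 * Suc j * D)" by simp
      have "2 ^ Suc j * (2 * real (card (pairs j))) \<le> 2 ^ Suc j * (2 * (4 * 2 ^ (16 * Suc j * D)))"
        using card by (intro mult_left_mono) auto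
      also have "\<dots> = (2 :: real) ^ (Suc j + 3 + 16 * Suc j * D)" by (simp add: power_add)
      also have "\<dots> \<le> 2 ^ (20 * Suc j * D)"
      proof (rule power_increasing)
        have "a + 3 + 16 * b \<le> 20 * b" if "1 \<le> a" "a \<le> b" for a b :: nat using that by linarith
        from this[of "Suc j" "Suc j * D"] show "Suc j + 3 + 16 * Suc j * D \<le> 20 * Suc j * D"
          using mult_le_mono2[OF D, of "Suc j"] unfolding mult.assoc by (simp del: mult_Suc)
      qed simp
      also have "\<dots> \<le> exp 1 ^ (20 * Suc j * D)"
        using exp_ge_add_one_self[of 1] by (intro power_mono) auto
      also have "\<dots> = exp (20 * real D * real (Suc j))"
        by (simp add: exp_of_nat_mult[symmetric] mult_ac)
      finally show "2 * real (card (pairs j)) * exp (- (20 * real D * real (Suc j))) \<le> 1 / 2 ^ Suc j"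
        by (simp add: exp_minus field_simps del: power_Suc of_nat_Suc)
    qed (use \<delta> in auto)
    finally show ?thesis .
  qed
  \<comment> \<open>at this scale the nets are exact, since n < 4 ^ n\<close>
  define J where "J = n"
  have "{\<sigma> \<in> signs n. \<exists>A\<in>F. 29 * sqrt (real n * (real D + L)) < \<bar>\<Sum>i\<in>A. \<sigma> i\<bar>} \<subseteq> (\<Union>j<J. bad j)"
  proof (rule subsetI, rule ccontr)
    fix \<sigma> assume *: "\<sigma> \<in> {\<sigma> \<in> signs n. \<exists>A\<in>F. 29 * sqrt (real n * (real D + L)) < \<bar>\<Sum>i\<in>A. \<sigma> i\<bar>}"
      and good: "\<sigma> \<notin> (\<Union>j<J. bad j)"
    then obtain A where A: "A \<in> F" "29 * sqrt (real n * (real D + L)) < \<bar>\<Sum>i\<in>A. \<sigma> i\<bar>"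
      and \<sigma>: "\<sigma> \<in> signs n" by auto
    have fin_diff: "finite (sym_diff A (nearest j A))" for j
      using finite_subset[OF G1[OF nearest(1)[OF A(1)]]] finite_subset[of A "{..<n}"] F A(1) by auto
    define S where "S = (\<lambda>j. \<Sum>i\<in>nearest j A. \<sigma> i)"
    have step: "\<bar>S (Suc j) - S j\<bar> \<le> t j" if "j < J" for j
    proof (rule ccontr)
      assume "\<not> ?thesis"
      then have dev: "\<sigma> \<in> dev j (nearest (Suc j) A, nearest j A)"
        using \<sigma> by (simp add: dev_def S_def)
      have "real (card (sym_diff (nearest (Suc j) A) (nearest j A)))
          \<le> real (card (sym_diff A (nearest (Suc j) A) \<union> sym_diff A (nearest j A)))"
      proof (intro of_nat_mono card_mono)
        show "finite (sym_diff A (nearest (Suc j) A) \<union> sym_diff A (nearest j A))"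
          using fin_diff by blast
      qed auto
      also have "\<dots> \<le> real (card (sym_diff A (nearest (Suc j) A))) + real (card (sym_diff A (nearest j A)))"
        by (metis card_Un_le of_nat_add of_nat_le_iff)
      also have "\<dots> \<le> real n / 4 ^ Suc j + real n / 4 ^ j"
        by (intro add_mono nearest(2)[OF A(1)])
      also have "\<dots> = v j" by (simp add: v_def field_simps)
      finally have "(nearest (Suc j) A, nearest j A) \<in> pairs j"
        using nearest(1)[OF A(1)] by (simp add: pairs_def)
      with dev have "\<sigma> \<in> bad j" unfolding bad_def by blast
      with good that show False by blast
    qed
    have "nearest 0 A = {}" using nearest(1)[OF A(1), of 0] by (simp add: G_def)
    then have S0: "S 0 = 0" by (simp add: S_def)
    have "real n / 4 ^ J < 1"
    proof -
      have "n < 4 ^ n" by (rule less_le_trans[OF less_exp power_mono]) auto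
      then have "real n < 4 ^ n" by (metis of_nat_less_iff of_nat_numeral of_nat_power)
      then show ?thesis by (simp add: J_def)
    qed
    then have "card (sym_diff A (nearest J A)) = 0"
      using nearest(2)[OF A(1), of J] by linarith
    then have "nearest J A = A" using fin_diff[of J] by auto
    then have "(\<Sum>i\<in>A. \<sigma> i) = S J - S 0" by (simp add: S_def S0[unfolded S_def])
    also have "\<dots> = (\<Sum>j<J. S (Suc j) - S j)" by (simp add: sum_lessThan_telescope)
    finally have "\<bar>\<Sum>i\<in>A. \<sigma> i\<bar> \<le> (\<Sum>j<J. \<bar>S (Suc j) - S j\<bar>)" by simp
    also have "\<dots> \<le> (\<Sum>j<J. t j)" by (intro sum_mono step) auto
    also have "\<dots> \<le> (\<Sum>j<J. sqrt (200 * (real n * (real D + L))) * (real (Suc j) / 2 ^ Suc j))"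
    proof (rule sum_mono)
      fix j
      have "20 * real D * real (Suc j) + L \<le> 20 * real (Suc j) * (real D + L)"
      proof -
        have "1 * L \<le> 20 * real (Suc j) * L" using L by (intro mult_right_mono) auto
        then show ?thesis by (simp add: algebra_simps)
      qed
      also have "\<dots> \<le> 20 * (real (Suc j) * real (Suc j)) * (real D + L)"
        using L by (intro mult_right_mono mult_left_mono) (auto simp: mult_le_cancel_left1)
      finally have "2 * v j * (20 * real D * real (Suc j) + L)
          \<le> 2 * v j * (20 * (real (Suc j) * real (Suc j)) * (real D + L))"
        using v[of j] by (intro mult_left_mono) auto
      also have "\<dots> = 200 * (real n * (real D + L)) * (real (Suc j) / 2 ^ Suc j)\<^sup>2"
      proof -
        have "(2 :: real) ^ Suc j * 2 ^ Suc j = 4 ^ Suc j" by (simp flip: power_mult_distrib)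
        then have "(real (Suc j) / 2 ^ Suc j)\<^sup>2 = real (Suc j) * real (Suc j) / 4 ^ Suc j"
          unfolding power2_eq_square by simp
        then show ?thesis by (simp add: v_def del: of_nat_Suc power_Suc)
      qed
      finally have "t j \<le> sqrt (200 * (real n * (real D + L)) * (real (Suc j) / 2 ^ Suc j)\<^sup>2)"
        unfolding t_def by (rule real_sqrt_le_mono)
      also have "\<dots> = sqrt (200 * (real n * (real D + L))) * (real (Suc j) / 2 ^ Suc j)"
        by (simp add: real_sqrt_mult)
      finally show "t j \<le> sqrt (200 * (real n * (real D + L))) * (real (Suc j) / 2 ^ Suc j)" .
    qed
    also have "\<dots> = sqrt 200 * sqrt (real n * (real D + L)) * (\<Sum>j<J. real (Suc j) / 2 ^ Suc j)"
      by (simp only: sum_distrib_left real_sqrt_mult)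
    also have "\<dots> \<le> sqrt 200 * sqrt (real n * (real D + L)) * 2"
      using L by (intro mult_left_mono sum_Suc_over_two_powers_le) auto
    also have "\<dots> \<le> (29 / 2) * sqrt (real n * (real D + L)) * 2"
      using L by (intro mult_right_mono real_le_lsqrt) (auto simp: power2_eq_square)
    finally show False using A(2) by simp
  qed
  then have "real (card {\<sigma> \<in> signs n. \<exists>A\<in>F. 29 * sqrt (real n * (real D + L)) < \<bar>\<Sum>i\<in>A. \<sigma> i\<bar>}) \<le> real (card (\<Union>j<J. bad j))"
    by (intro of_nat_mono card_mono) (auto simp: bad_def dev_def pairs(1) split: prod.splits)
  also have "\<dots> \<le> (\<Sum>j<J. real (card (bad j)))" by (rule real_card_UN_le) auto
  also have "\<dots> \<le> (\<Sum>j<J. 2 ^ n * \<delta> * (1 / 2 ^ Suc j))" by (intro sum_mono bad)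
  also have "\<dots> = 2 ^ n * \<delta> * (\<Sum>j<J. 1 / 2 ^ Suc j)" by (simp only: sum_distrib_left)
  also have "\<dots> \<le> 2 ^ n * \<delta> * 1" using \<delta> by (intro mult_left_mono sum_inverse_two_powers_le) auto
  finally show ?thesis by (simp add: L_def mult.commute)
qed

section \<open>Uniform deviations of empirical frequencies\<close>

text \<open>
  Traces are recorded on indices instead of points because sample points may coincide.
\<close>

lemma vc_growth_index_traces:
  fixes K :: "'i set"
  assumes "vc_growth D C"
  shows "vc_growth D ((\<lambda>A. {i \<in> K. z i \<in> A}) ` C)"
  unfolding vc_growth_def
proof (intro allI impI, elim conjE)
  fix I :: "'i set" and x :: real assume I: "finite I" and x: "0 < x" "x \<le> 1"
  have fin: "finite ((\<lambda>A. A \<inter> z ` (I \<inter> K)) ` C)"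
    by (rule finite_subset[of _ "Pow (z ` (I \<inter> K))"]) (use I in auto)
  have "(\<lambda>A. A \<inter> I) ` (\<lambda>A. {i \<in> K. z i \<in> A}) ` C
      \<subseteq> (\<lambda>S. {i \<in> I \<inter> K. z i \<in> S}) ` (\<lambda>A. A \<inter> z ` (I \<inter> K)) ` C"
  proof
    fix S assume "S \<in> (\<lambda>A. A \<inter> I) ` (\<lambda>A. {i \<in> K. z i \<in> A}) ` C"
    then obtain A where A: "A \<in> C" "S = {i \<in> K. z i \<in> A} \<inter> I" by blast
    then have "S = {i \<in> I \<inter> K. z i \<in> A \<inter> z ` (I \<inter> K)}" by auto
    then show "S \<in> (\<lambda>S. {i \<in> I \<inter> K. z i \<in> S}) ` (\<lambda>A. A \<inter> z ` (I \<inter> K)) ` C" using A(1) by blast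
  qed
  then have "card ((\<lambda>A. A \<inter> I) ` (\<lambda>A. {i \<in> K. z i \<in> A}) ` C) \<le> card ((\<lambda>A. A \<inter> z ` (I \<inter> K)) ` C)"
    by (rule surj_card_le[OF fin])
  then have "real (card ((\<lambda>A. A \<inter> I) ` (\<lambda>A. {i \<in> K. z i \<in> A}) ` C)) * x ^ D
      \<le> real (card ((\<lambda>A. A \<inter> z ` (I \<inter> K)) ` C)) * x ^ D"
    using x by (intro mult_right_mono) auto
  also have "\<dots> \<le> exp (2 * x * real (card (z ` (I \<inter> K))))"
    using assms[unfolded vc_growth_def, rule_format, of "z ` (I \<inter> K)" x] I x by simp
  also have "\<dots> \<le> exp (2 * x * real (card I))"
  proof -
    have "card (z ` (I \<inter> K)) \<le> card I"
      using card_image_le[of "I \<inter> K" z] card_mono[of I "I \<inter> K"] I by simp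
    then show ?thesis using x by (auto intro!: mult_left_mono)
  qed
  finally show "real (card ((\<lambda>A. A \<inter> I) ` (\<lambda>A. {i \<in> K. z i \<in> A}) ` C)) * x ^ D \<le> exp (2 * x * real (card I))" .
qed

lemma empirical_frequency_concentration:
  fixes R :: "'a measure" and I :: "nat set"
  assumes R: "prob_space R" and A: "A \<in> sets R" and I: "finite I" "I \<noteq> {}" and e: "0 \<le> e"
  shows "measure (PiM I (\<lambda>_. R)) {x \<in> space (PiM I (\<lambda>_. R)).
      e \<le> \<bar>(\<Sum>i\<in>I. indicat_real A (x i)) - real (card I) * measure R A\<bar>}
    \<le> 2 * exp (- 2 * e\<^sup>2 / real (card I))"
proof -
  interpret R: prob_space R by (rule R)
  define P where "P = PiM I (\<lambda>_. R)"
  interpret P: prob_space P unfolding P_def by (intro prob_space_PiM R)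
  have comp: "distr P R (\<lambda>x. x i) = R" if "i \<in> I" for i
    unfolding P_def using that R by (intro distr_PiM_component)
  have meas [measurable]: "(\<lambda>x. x i) \<in> measurable P R" if "i \<in> I" for i
    unfolding P_def using that by simp
  note A [measurable]
  have "P.indep_vars (\<lambda>_. R) (\<lambda>i x. x i) I"
  proof (rule P.indep_vars_iff_distr_eq_PiM'[THEN iffD2])
    have "distr P (PiM I (\<lambda>_. R)) (\<lambda>x. \<lambda>i\<in>I. x i) = distr P P (\<lambda>x. x)"
      unfolding P_def by (intro distr_cong) (auto simp: space_PiM PiE_iff extensional_restrict)
    also have "\<dots> = P" by (rule distr_id)
    also have "\<dots> = PiM I (\<lambda>i. distr P R (\<lambda>x. x i))"
      using PiM_cong[OF refl comp[symmetric], of I] by (simp add: P_def)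
    finally show "distr P (PiM I (\<lambda>_. R)) (\<lambda>x. \<lambda>i\<in>I. x i) = PiM I (\<lambda>i. distr P R (\<lambda>x. x i))" .
  qed (use I in auto)
  then have indep: "P.indep_vars (\<lambda>_. borel) (\<lambda>i x. indicat_real A (x i)) I"
    by (rule P.indep_vars_compose2) auto
  obtain i0 where i0: "i0 \<in> I" using I by blast
  have distr_ind: "distr P borel (\<lambda>x. indicat_real A (x i)) = distr R borel (indicat_real A)" if "i \<in> I" for i
  proof -
    have "distr P borel (\<lambda>x. indicat_real A (x i)) = distr (distr P R (\<lambda>x. x i)) borel (indicat_real A)"
      using that by (subst distr_distr) (auto simp: comp_def)
    then show ?thesis by (simp add: comp[OF that])
  qed
  interpret H: iid_interval_bounded_random_variables P I "\<lambda>i x. indicat_real A (x i)" "\<lambda>x. indicat_real A (x i0)" 0 1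
  proof unfold_locales
    show "finite I" by (rule I(1))
    show "P.indep_vars (\<lambda>_. borel) (\<lambda>i x. indicat_real A (x i)) I" by (rule indep)
    show "P.random_variable borel (\<lambda>x. indicat_real A (x i0))" using i0 by measurable
    show "AE x in P. indicat_real A (x i0) \<in> {0..1}" by (rule AE_I2) (simp split: split_indicator)
    show "distr P borel (\<lambda>x. indicat_real A (x i)) = distr P borel (\<lambda>x. indicat_real A (x i0))" if "i \<in> I" for i
      unfolding distr_ind[OF that] distr_ind[OF i0] ..
  qed
  have E: "P.expectation (\<lambda>x. indicat_real A (x i0)) = measure R A"
  proof -
    have "P.expectation (\<lambda>x. indicat_real A (x i0)) = integral\<^sup>L (distr P R (\<lambda>x. x i0)) (indicat_real A)"
      by (rule integral_distr[symmetric]) (use meas[OF i0] in auto)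
    also have "\<dots> = measure R A" unfolding comp[OF i0] using A by (subst Bochner_Integration.integral_indicator) simp_all
    finally show ?thesis .
  qed
  interpret H2: Hoeffding_ineq_iid P I "\<lambda>i x. indicat_real A (x i)" "\<lambda>x. indicat_real A (x i0)" 0 1 "measure R A"
    by unfold_locales (simp add: E)
  have "P.prob {x \<in> space P. e \<le> \<bar>(\<Sum>i\<in>I. indicat_real A (x i)) - real (card I) * measure R A\<bar>}
      \<le> 2 * exp (- 2 * e\<^sup>2 / (real (card I) * (1 - 0)\<^sup>2))"
    by (rule H2.Hoeffding_ineq_abs_ge[OF e _ I(2)]) simp
  then show ?thesis by (simp add: P_def)
qed

lemma sets_Collect_countable_Bex_in:
  assumes "countable C" "\<And>A. A \<in> C \<Longrightarrow> {x \<in> space M. P A x} \<in> sets M"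
  shows "{x \<in> space M. \<exists>A\<in>C. P A x} \<in> sets M"
proof -
  have "{x \<in> space M. \<exists>A\<in>C. P A x} = (\<Union>A\<in>C. {x \<in> space M. P A x})" by auto
  also have "\<dots> \<in> sets M" using assms by (intro sets.countable_UN'') auto
  finally show ?thesis .
qed

text \<open>
  If some set A deviates on the first half of a sample of size 2n, then with probability at least 1/2
  the frequency of the same A on the second half is accurate, by Hoeffding's inequality; hence the two
  halves disagree on A. Countability of C makes the events measurable.
\<close>

lemma ghost_sample:
  fixes R :: "'a measure" and n :: nat
  assumes R: "prob_space R" and C: "countable C" "C \<subseteq> sets R" and n: "1 \<le> n" and c: "0 \<le> c" "8 * real n \<le> c\<^sup>2"
  shows "measure (PiM {..<n} (\<lambda>_. R)) {x \<in> space (PiM {..<n} (\<lambda>_. R)).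
        \<exists>A\<in>C. c < \<bar>(\<Sum>i<n. indicat_real A (x i)) - real n * measure R A\<bar>}
    \<le> 2 * measure (PiM {..<2 * n} (\<lambda>_. R)) {z \<in> space (PiM {..<2 * n} (\<lambda>_. R)).
        \<exists>A\<in>C. c / 2 < \<bar>(\<Sum>i<n. indicat_real A (z i)) - (\<Sum>i\<in>{n..<2 * n}. indicat_real A (z i))\<bar>}"
proof -
  define M where "M = (\<lambda>I :: nat set. PiM I (\<lambda>_. R))"
  define emp where "emp = (\<lambda>A (I :: nat set) x. \<Sum>i\<in>I. indicat_real A (x i :: 'a))"
  interpret R: prob_space R by (rule R)
  interpret product_sigma_finite "\<lambda>_ :: nat. R" by standard
  define I J where "I = {..<n}" and "J = {n..<2 * n}"
  have IJ: "I \<inter> J = {}" "I \<union> J = {..<2 * n}" "finite I" "finite J" by (auto simp: I_def J_def)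
  interpret MI: prob_space "M I" unfolding M_def by (intro prob_space_PiM R)
  interpret MJ: prob_space "M J" unfolding M_def by (intro prob_space_PiM R)
  interpret MIJ: prob_space "M {..<2 * n}" unfolding M_def by (intro prob_space_PiM R)
  have [measurable]: "A \<in> sets R" if "A \<in> C" for A using C(2) that by blast
  have emp_meas [measurable]: "emp A K \<in> borel_measurable (M L)" if "K \<subseteq> L" "A \<in> C" for K L A
  proof -
    have [measurable]: "(\<lambda>x. x i) \<in> measurable (M L) R" if "i \<in> K" for i
      unfolding M_def using that \<open>K \<subseteq> L\<close> by auto
    show ?thesis unfolding emp_def using \<open>A \<in> C\<close> by measurable
  qed
  define B where "B = {x \<in> space (M I). \<exists>A\<in>C. c < \<bar>emp A I x - real n * measure R A\<bar>}"
  define B2 where "B2 = {z \<in> space (M {..<2 * n}). \<exists>A\<in>C. c / 2 < \<bar>emp A I z - emp A J z\<bar>}"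
  have B [measurable]: "B \<in> sets (M I)"
    unfolding B_def by (intro sets_Collect_countable_Bex_in[OF C(1)]) measurable
  have B2 [measurable]: "B2 \<in> sets (M {..<2 * n})"
  proof -
    have "I \<subseteq> {..<2 * n}" "J \<subseteq> {..<2 * n}" using IJ(2) by auto
    note emp_meas[OF this(1), measurable] emp_meas[OF this(2), measurable]
    show ?thesis unfolding B2_def by (intro sets_Collect_countable_Bex_in[OF C(1)]) measurable
  qed
  have merge_meas [measurable]: "merge I J \<in> measurable (M I \<Otimes>\<^sub>M M J) (M {..<2 * n})"
    unfolding M_def IJ(2)[symmetric] by (rule measurable_merge)
  define T where "T = merge I J -` B2 \<inter> space (M I \<Otimes>\<^sub>M M J)"
  have T: "T \<in> sets (M I \<Otimes>\<^sub>M M J)" unfolding T_def by measurable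
  have half: "ennreal (1 / 2) \<le> emeasure (M J) (Pair x -` T)" if x: "x \<in> B" for x
  proof -
    obtain A where A: "A \<in> C" "c < \<bar>emp A I x - real n * measure R A\<bar>" using x by (auto simp: B_def)
    define near where "near = {y \<in> space (M J). \<not> c / 2 \<le> \<bar>emp A J y - real n * measure R A\<bar>}"
    have far_meas: "{y \<in> space (M J). c / 2 \<le> \<bar>emp A J y - real n * measure R A\<bar>} \<in> sets (M J)"
    proof -
      note emp_meas[OF subset_refl A(1), measurable]
      show ?thesis by measurable
    qed
    have "MJ.prob {y \<in> space (M J). c / 2 \<le> \<bar>emp A J y - real n * measure R A\<bar>} \<le> 2 * exp (- 2 * (c / 2)\<^sup>2 / real n)"
    proof -
      have "A \<in> sets R" "J \<noteq> {}" "card J = n" "0 \<le> c / 2" using A(1) C(2) c n by (auto simp: J_def)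
      then show ?thesis
        using empirical_frequency_concentration[OF R, of A J "c / 2"] IJ(4) unfolding M_def emp_def by metis
    qed
    also have "\<dots> \<le> 2 * exp (- 4)"
    proof -
      have "4 \<le> 2 * (c / 2)\<^sup>2 / real n" using c(2) n by (simp add: field_simps)
      then show ?thesis by simp
    qed
    also have "\<dots> \<le> 1 / 2"
      using exp_ge_add_one_self[of "4 :: real"] by (simp add: exp_minus field_simps)
    finally have near: "1 / 2 \<le> MJ.prob near"
      unfolding near_def using MJ.prob_neg[OF far_meas] by simp
    have "near \<subseteq> Pair x -` T"
    proof
      fix y assume y: "y \<in> near"
      have xs: "x \<in> space (M I)" and ys: "y \<in> space (M J)" using x y by (simp_all add: B_def near_def)
      have m: "merge I J (x, y) \<in> space (M {..<2 * n})"
        by (rule measurable_space[OF merge_meas]) (simp add: space_pair_measure xs ys)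
      have "emp A I (merge I J (x, y)) = emp A I x" "emp A J (merge I J (x, y)) = emp A J y"
        unfolding emp_def using IJ(1) by (auto intro!: sum.cong simp: merge_def)
      moreover have "c / 2 < \<bar>emp A I x - emp A J y\<bar>"
      proof -
        have "\<not> c / 2 \<le> \<bar>emp A J y - real n * measure R A\<bar>" using y by (simp add: near_def)
        then show ?thesis using A(2) by argo
      qed
      ultimately have "c / 2 < \<bar>emp A I (merge I J (x, y)) - emp A J (merge I J (x, y))\<bar>" by simp
      then have "merge I J (x, y) \<in> B2" using m A(1) unfolding B2_def by blast
      then show "y \<in> Pair x -` T" using xs ys by (simp add: T_def space_pair_measure)
    qed
    then have "MJ.prob near \<le> MJ.prob (Pair x -` T)"
      by (rule MJ.finite_measure_mono[OF _ sets_Pair1[OF T]])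
    with near have "1 / 2 \<le> MJ.prob (Pair x -` T)" by linarith
    then show ?thesis unfolding MJ.emeasure_eq_measure by (rule ennreal_leI)
  qed
  have "ennreal (1 / 2) * emeasure (M I) B = (\<integral>\<^sup>+ x. ennreal (1 / 2) * indicator B x \<partial>M I)"
    by (simp add: nn_integral_cmult_indicator)
  also have "\<dots> \<le> (\<integral>\<^sup>+ x. emeasure (M J) (Pair x -` T) \<partial>M I)"
  proof (rule nn_integral_mono)
    fix x show "ennreal (1 / 2) * indicator B x \<le> emeasure (M J) (Pair x -` T)"
      using half[of x] by (cases "x \<in> B") simp_all
  qed
  also have "\<dots> = emeasure (M I \<Otimes>\<^sub>M M J) T" by (rule MJ.emeasure_pair_measure_alt[OF T, symmetric])
  also have "\<dots> = emeasure (distr (M I \<Otimes>\<^sub>M M J) (M {..<2 * n}) (merge I J)) B2"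
    unfolding T_def by (subst emeasure_distr) auto
  also have "distr (M I \<Otimes>\<^sub>M M J) (M {..<2 * n}) (merge I J) = M {..<2 * n}"
    unfolding M_def IJ(2)[symmetric] by (rule distr_merge[OF IJ(1,3,4)])
  finally have le: "ennreal (1 / 2) * emeasure (M I) B \<le> emeasure (M {..<2 * n}) B2" .
  have "ennreal (1 / 2) * emeasure (M I) B = ennreal (1 / 2 * measure (M I) B)"
    unfolding MI.emeasure_eq_measure by (rule ennreal_mult[symmetric]) simp_all
  with le have "1 / 2 * measure (M I) B \<le> measure (M {..<2 * n}) B2"
    unfolding MIJ.emeasure_eq_measure by (simp only: ennreal_le_iff measure_nonneg)
  then have "measure (M I) B \<le> 2 * measure (M {..<2 * n}) B2" by linarith
  then show ?thesis unfolding B_def B2_def I_def J_def M_def emp_def .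
qed

text \<open>
  The product measure is invariant under exchanging the points i and n + i for any set of i, so the
  probability is the average over all 2^n exchange patterns, and it suffices to bound the fraction of
  bad patterns for each fixed sample.
\<close>

lemma swap_symmetrization:
  fixes R :: "'a measure" and n :: nat
  defines "M \<equiv> PiM {..<2 * n} (\<lambda>_. R)"
  assumes R: "prob_space R" and C: "countable C" "C \<subseteq> sets R"
    and bound: "\<And>z. z \<in> space M \<Longrightarrow>
      real (card {\<sigma> \<in> signs n. \<exists>A\<in>C. c < \<bar>\<Sum>i<n. \<sigma> i * (indicat_real A (z i) - indicat_real A (z (n + i)))\<bar>}) \<le> b * 2 ^ n"
  shows "measure M {z \<in> space M. \<exists>A\<in>C. c < \<bar>(\<Sum>i<n. indicat_real A (z i)) - (\<Sum>i\<in>{n..<2 * n}. indicat_real A (z i))\<bar>} \<le> b"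
proof -
  interpret M: prob_space M unfolding M_def by (intro prob_space_PiM R)
  have [measurable]: "A \<in> sets R" if "A \<in> C" for A using C(2) that by blast
  define g where "g = (\<lambda>\<sigma> (z :: nat \<Rightarrow> 'a) A. \<bar>\<Sum>i<n. \<sigma> i * (indicat_real A (z i) - indicat_real A (z (n + i)))\<bar>)"
  define E where "E = (\<lambda>\<sigma>. {z \<in> space M. \<exists>A\<in>C. c < g \<sigma> z A})"
  have g_meas [measurable]: "(\<lambda>z. g \<sigma> z A) \<in> borel_measurable M" if "A \<in> C" for \<sigma> A
    unfolding g_def M_def using that by measurable
  have E [measurable]: "E \<sigma> \<in> sets M" for \<sigma>
    unfolding E_def by (intro sets_Collect_countable_Bex_in[OF C(1)]) measurable
  \<comment> \<open>an involution of the indices that realizes the signs as exchanges of i and n + i\<close>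
  define flip where "flip = (\<lambda>\<sigma> i. if i < n then (if \<sigma> i = (1 :: real) then i else n + i)
                           else (if \<sigma> (i - n) = 1 then i else i - n))"
  have inv: "measure M (E \<sigma>) = measure M (E (\<lambda>_. 1))" if \<sigma>: "\<sigma> \<in> signs n" for \<sigma>
  proof -
    have fl: "flip \<sigma> (flip \<sigma> i) = i" "flip \<sigma> i < 2 * n" if "i < 2 * n" for i
      using that by (auto simp: flip_def)
    have D: "distr M M (\<lambda>z. \<lambda>i\<in>{..<2 * n}. z (flip \<sigma> i)) = M"
      unfolding M_def
      by (rule distr_PiM_reindex[where M = "\<lambda>_. R" and f = "flip \<sigma>"])
         (use R fl in \<open>auto intro!: inj_on_inverseI[of _ "flip \<sigma>"]\<close>)
    have tr: "(\<lambda>z. \<lambda>i\<in>{..<2 * n}. z (flip \<sigma> i)) \<in> measurable M M"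
      unfolding M_def using fl by (intro measurable_restrict) auto
    have geq: "g (\<lambda>_. 1) (\<lambda>i\<in>{..<2 * n}. z (flip \<sigma> i)) A = g \<sigma> z A" for z A
    proof -
      have "indicat_real A ((\<lambda>i\<in>{..<2 * n}. z (flip \<sigma> i)) i) - indicat_real A ((\<lambda>i\<in>{..<2 * n}. z (flip \<sigma> i)) (n + i))
          = \<sigma> i * (indicat_real A (z i) - indicat_real A (z (n + i)))" if "i < n" for i
      proof -
        have "\<sigma> i = 1 \<or> \<sigma> i = - 1" using \<sigma> that by (auto simp: signs_def PiE_iff)
        then show ?thesis using that by (auto simp: flip_def)
      qed
      then show ?thesis unfolding g_def by simp
    qed
    have "measure M (E (\<lambda>_. 1)) = measure (distr M M (\<lambda>z. \<lambda>i\<in>{..<2 * n}. z (flip \<sigma> i))) (E (\<lambda>_. 1))"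
      by (simp add: D)
    also have "\<dots> = measure M ((\<lambda>z. \<lambda>i\<in>{..<2 * n}. z (flip \<sigma> i)) -` E (\<lambda>_. 1) \<inter> space M)"
      by (rule measure_distr[OF tr E])
    also have "(\<lambda>z. \<lambda>i\<in>{..<2 * n}. z (flip \<sigma> i)) -` E (\<lambda>_. 1) \<inter> space M = E \<sigma>"
      using measurable_space[OF tr] by (auto simp: E_def geq)
    finally show ?thesis ..
  qed
  have "2 ^ n * measure M (E (\<lambda>_. 1)) = (\<Sum>\<sigma>\<in>signs n. measure M (E \<sigma>))"
    by (simp add: inv card_signs)
  also have "\<dots> = (\<Sum>\<sigma>\<in>signs n. integral\<^sup>L M (indicat_real (E \<sigma>)))" by simp
  also have "\<dots> = (\<integral>z. (\<Sum>\<sigma>\<in>signs n. indicat_real (E \<sigma>) z) \<partial>M)"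
    by (rule Bochner_Integration.integral_sum[symmetric]) (auto simp: M.emeasure_eq_measure)
  also have "\<dots> \<le> (\<integral>z. b * 2 ^ n \<partial>M)"
  proof (rule integral_mono)
    fix z assume z: "z \<in> space M"
    have "(\<Sum>\<sigma>\<in>signs n. indicat_real (E \<sigma>) z) = real (card {\<sigma> \<in> signs n. z \<in> E \<sigma>})"
      by (simp add: indicator_def sum.If_cases Int_def)
    also have "{\<sigma> \<in> signs n. z \<in> E \<sigma>} = {\<sigma> \<in> signs n. \<exists>A\<in>C. c < g \<sigma> z A}" using z by (auto simp: E_def)
    finally show "(\<Sum>\<sigma>\<in>signs n. indicat_real (E \<sigma>) z) \<le> b * 2 ^ n" using bound[OF z] by (simp add: g_def)
  qed (auto simp: M.emeasure_eq_measure)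
  also have "\<dots> = b * 2 ^ n" by (simp add: M.prob_space)
  finally have "measure M (E (\<lambda>_. 1)) \<le> b" by (simp add: mult.commute)
  moreover have "g (\<lambda>_. 1) z A = \<bar>(\<Sum>i<n. indicat_real A (z i)) - (\<Sum>i\<in>{n..<2 * n}. indicat_real A (z i))\<bar>" for z A
  proof -
    have "(\<Sum>i\<in>{n..<2 * n}. indicat_real A (z i)) = (\<Sum>i<n. indicat_real A (z (n + i)))"
      using sum.shift_bounds_nat_ivl[of "\<lambda>i. indicat_real A (z i)" 0 n n]
      by (simp add: mult_2 atLeast0LessThan add.commute)
    then show ?thesis by (simp add: g_def sum_subtractf)
  qed
  ultimately show ?thesis by (simp add: E_def)
qed

text \<open>
  The difference of the two halves of the sample is split into two Rademacher sums, one for each half;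
  chaining bounds each with confidence \<delta>/4, and the ghost sample costs another factor 2. The constant
  200 satisfies 29 * sqrt (5/2) <= 200/4, where 5/2 accounts for the passage from \<delta> to \<delta>/4.
\<close>

theorem vc_inequality:
  fixes R :: "'a measure" and \<delta> :: real
  defines "M \<equiv> \<lambda>n :: nat. PiM {..<n} (\<lambda>_. R)"
  assumes R: "prob_space R" and C: "countable C" "C \<subseteq> sets R" and growth: "vc_growth D C"
    and D: "1 \<le> D" and n: "1 \<le> n" and \<delta>: "0 < \<delta>" "\<delta> < 1"
  shows "measure (M n) {x \<in> space (M n). \<exists>A\<in>C.
      200 * sqrt (real n * (real D + ln (1 / \<delta>))) < \<bar>(\<Sum>i<n. indicat_real A (x i)) - real n * measure R A\<bar>} \<le> \<delta>"
proof -
  define L where "L = ln (1 / \<delta>)"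
  have L: "0 < L" using \<delta> by (simp add: L_def)
  define c where "c = 200 * sqrt (real n * (real D + L))"
  have c0: "0 \<le> c" using L by (simp add: c_def)
  have c2: "c\<^sup>2 = 40000 * (real n * (real D + L))" using L by (simp add: c_def power_mult_distrib)
  have "8 * real n \<le> c\<^sup>2"
  proof -
    have "real n * 1 \<le> real n * (real D + L)" using L D by (intro mult_left_mono) auto
    then show ?thesis unfolding c2 by simp
  qed
  then have "measure (M n) {x \<in> space (M n). \<exists>A\<in>C. c < \<bar>(\<Sum>i<n. indicat_real A (x i)) - real n * measure R A\<bar>}
    \<le> 2 * measure (M (2 * n)) {z \<in> space (M (2 * n)). \<exists>A\<in>C. c / 2 < \<bar>(\<Sum>i<n. indicat_real A (z i)) - (\<Sum>i\<in>{n..<2 * n}. indicat_real A (z i))\<bar>}"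
    unfolding M_def by (rule ghost_sample[OF R C n c0])
  also have "\<dots> \<le> 2 * (\<delta> / 2)"
    unfolding M_def
  proof (intro mult_left_mono swap_symmetrization[OF R C])
    fix z :: "nat \<Rightarrow> 'a"
    have small: "real (card {\<sigma> \<in> signs n. \<exists>A\<in>C. c / 4 < \<bar>\<Sum>i<n. \<sigma> i * indicat_real A (y i)\<bar>}) \<le> \<delta> / 4 * 2 ^ n" for y
    proof -
      define F where "F = (\<lambda>A. {i \<in> {..<n}. y i \<in> A}) ` C"
      have "29 * sqrt (real n * (real D + ln (1 / (\<delta> / 4)))) \<le> c / 4"
      proof -
        have "ln (1 / (\<delta> / 4)) = ln 4 + L" using \<delta> by (simp add: L_def ln_div)
        also have "ln (4 :: real) \<le> 3 / 2"
        proof -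
          have "ln 4 = 2 * ln (2 :: real)" using ln_realpow[of 2 2] by simp
          then show ?thesis using ln2_le_25_over_36 by simp
        qed
        finally have "real D + ln (1 / (\<delta> / 4)) \<le> 5 / 2 * (real D + L)" using D L by simp
        then have "real n * (real D + ln (1 / (\<delta> / 4))) \<le> real n * (5 / 2 * (real D + L))" by (intro mult_left_mono) auto
        then have "sqrt (real n * (real D + ln (1 / (\<delta> / 4)))) \<le> sqrt (5 / 2 * (real n * (real D + L)))"
          by (simp add: mult.left_commute)
        also have "\<dots> = sqrt (5 / 2) * sqrt (real n * (real D + L))" by (rule real_sqrt_mult)
        also have "\<dots> \<le> (50 / 29) * sqrt (real n * (real D + L))"
          using L by (intro mult_right_mono real_le_lsqrt) (auto simp: power2_eq_square)
        finally show ?thesis by (simp add: c_def)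
      qed
      then have "{\<sigma> \<in> signs n. \<exists>A\<in>C. c / 4 < \<bar>\<Sum>i<n. \<sigma> i * indicat_real A (y i)\<bar>}
        \<subseteq> {\<sigma> \<in> signs n. \<exists>A\<in>F. 29 * sqrt (real n * (real D + ln (1 / (\<delta> / 4)))) < \<bar>\<Sum>i\<in>A. \<sigma> i\<bar>}"
      proof (intro subsetI)
        fix \<sigma> assume s: "29 * sqrt (real n * (real D + ln (1 / (\<delta> / 4)))) \<le> c / 4"
          "\<sigma> \<in> {\<sigma> \<in> signs n. \<exists>A\<in>C. c / 4 < \<bar>\<Sum>i<n. \<sigma> i * indicat_real A (y i)\<bar>}"
        then obtain A where A: "A \<in> C" "c / 4 < \<bar>\<Sum>i<n. \<sigma> i * indicat_real A (y i)\<bar>" by blast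
        have *: "(\<Sum>i<n. \<sigma> i * indicat_real A (y i)) = (\<Sum>i\<in>{i \<in> {..<n}. y i \<in> A}. \<sigma> i)"
          by (rule sum.mono_neutral_cong_right) auto
        show "\<sigma> \<in> {\<sigma> \<in> signs n. \<exists>A\<in>F. 29 * sqrt (real n * (real D + ln (1 / (\<delta> / 4)))) < \<bar>\<Sum>i\<in>A. \<sigma> i\<bar>}"
        proof -
          have "29 * sqrt (real n * (real D + ln (1 / (\<delta> / 4)))) < \<bar>\<Sum>i\<in>{i \<in> {..<n}. y i \<in> A}. \<sigma> i\<bar>"
            using s(1) A(2) unfolding * by (rule le_less_trans)
          moreover have "{i \<in> {..<n}. y i \<in> A} \<in> F" unfolding F_def using A(1) by (rule imageI)
          ultimately show ?thesis using s(2) by blast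
        qed
      qed
      then have "card {\<sigma> \<in> signs n. \<exists>A\<in>C. c / 4 < \<bar>\<Sum>i<n. \<sigma> i * indicat_real A (y i)\<bar>}
        \<le> card {\<sigma> \<in> signs n. \<exists>A\<in>F. 29 * sqrt (real n * (real D + ln (1 / (\<delta> / 4)))) < \<bar>\<Sum>i\<in>A. \<sigma> i\<bar>}"
        by (intro card_mono) auto
      then have "real (card {\<sigma> \<in> signs n. \<exists>A\<in>C. c / 4 < \<bar>\<Sum>i<n. \<sigma> i * indicat_real A (y i)\<bar>})
        \<le> real (card {\<sigma> \<in> signs n. \<exists>A\<in>F. 29 * sqrt (real n * (real D + ln (1 / (\<delta> / 4)))) < \<bar>\<Sum>i\<in>A. \<sigma> i\<bar>})"
        by simp
      also have "\<dots> \<le> \<delta> / 4 * 2 ^ n"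
        unfolding F_def by (rule rademacher_chaining[OF _ vc_growth_index_traces[OF growth] D n]) (use \<delta> in auto)
      finally show ?thesis .
    qed
    define S1 where "S1 = {\<sigma> \<in> signs n. \<exists>A\<in>C. c / 4 < \<bar>\<Sum>i<n. \<sigma> i * indicat_real A (z i)\<bar>}"
    define S2 where "S2 = {\<sigma> \<in> signs n. \<exists>A\<in>C. c / 4 < \<bar>\<Sum>i<n. \<sigma> i * indicat_real A (z (n + i))\<bar>}"
    have "{\<sigma> \<in> signs n. \<exists>A\<in>C. c / 2 < \<bar>\<Sum>i<n. \<sigma> i * (indicat_real A (z i) - indicat_real A (z (n + i)))\<bar>} \<subseteq> S1 \<union> S2"
    proof
      fix \<sigma> assume "\<sigma> \<in> {\<sigma> \<in> signs n. \<exists>A\<in>C. c / 2 < \<bar>\<Sum>i<n. \<sigma> i * (indicat_real A (z i) - indicat_real A (z (n + i)))\<bar>}"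
      then obtain A where A: "\<sigma> \<in> signs n" "A \<in> C"
        "c / 2 < \<bar>\<Sum>i<n. \<sigma> i * (indicat_real A (z i) - indicat_real A (z (n + i)))\<bar>" by blast
      have "(\<Sum>i<n. \<sigma> i * (indicat_real A (z i) - indicat_real A (z (n + i))))
          = (\<Sum>i<n. \<sigma> i * indicat_real A (z i)) - (\<Sum>i<n. \<sigma> i * indicat_real A (z (n + i)))"
        by (simp add: right_diff_distrib sum_subtractf)
      with A(3) have "c / 4 < \<bar>\<Sum>i<n. \<sigma> i * indicat_real A (z i)\<bar> \<or> c / 4 < \<bar>\<Sum>i<n. \<sigma> i * indicat_real A (z (n + i))\<bar>"
        by linarith
      then show "\<sigma> \<in> S1 \<union> S2" using A by (auto simp: S1_def S2_def)
    qed
    then have "card {\<sigma> \<in> signs n. \<exists>A\<in>C. c / 2 < \<bar>\<Sum>i<n. \<sigma> i * (indicat_real A (z i) - indicat_real A (z (n + i)))\<bar>} \<le> card (S1 \<union> S2)"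
      by (intro card_mono) (auto simp: S1_def S2_def)
    also have "\<dots> \<le> card S1 + card S2" by (rule card_Un_le)
    finally have "real (card {\<sigma> \<in> signs n. \<exists>A\<in>C. c / 2 < \<bar>\<Sum>i<n. \<sigma> i * (indicat_real A (z i) - indicat_real A (z (n + i)))\<bar>})
      \<le> real (card S1) + real (card S2)" by linarith
    also have "\<dots> \<le> \<delta> / 2 * 2 ^ n"
      using small[of z] small[of "\<lambda>i. z (n + i)"] by (simp add: S1_def S2_def)
    finally show "real (card {\<sigma> \<in> signs n. \<exists>A\<in>C. c / 2 < \<bar>\<Sum>i<n. \<sigma> i * (indicat_real A (z i) - indicat_real A (z (n + i)))\<bar>}) \<le> \<delta> / 2 * 2 ^ n" .
  qed simp
  finally show ?thesis by (simp add: c_def L_def)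
qed

section \<open>Perturbation of leading eigenspaces\<close>

text \<open>
  Linear algebra is done for functions that are read on the indices below p. This keeps the dimension a
  number and avoids carrier conditions.
\<close>

definition ip :: "nat \<Rightarrow> (nat \<Rightarrow> real) \<Rightarrow> (nat \<Rightarrow> real) \<Rightarrow> real" where
  "ip p f g = (\<Sum>i<p. f i * g i)"

definition mv :: "nat \<Rightarrow> (nat \<Rightarrow> nat \<Rightarrow> real) \<Rightarrow> (nat \<Rightarrow> real) \<Rightarrow> nat \<Rightarrow> real" where
  "mv p A x i = (\<Sum>j<p. A i j * x j)"

lemma ip_commute: "ip p f g = ip p g f"
  by (simp add: ip_def mult.commute)

lemma ip_add_left: "ip p (\<lambda>i. f i + g i) h = ip p f h + ip p g h"
  and ip_add_right: "ip p h (\<lambda>i. f i + g i) = ip p h f + ip p h g"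
  and ip_diff_left: "ip p (\<lambda>i. f i - g i) h = ip p f h - ip p g h"
  and ip_diff_right: "ip p h (\<lambda>i. f i - g i) = ip p h f - ip p h g"
  and ip_scale_left: "ip p (\<lambda>i. c * f i) h = c * ip p f h"
  and ip_scale_right: "ip p h (\<lambda>i. c * f i) = c * ip p h f"
  by (simp_all add: ip_def algebra_simps sum.distrib sum_subtractf sum_distrib_left)

lemma ip_sum_left: "ip p (\<lambda>i. \<Sum>k\<in>K. f k i) h = (\<Sum>k\<in>K. ip p (f k) h)"
  unfolding ip_def by (simp add: sum_distrib_right) (rule sum.swap)

lemma ip_sum_right: "ip p h (\<lambda>i. \<Sum>k\<in>K. f k i) = (\<Sum>k\<in>K. ip p h (f k))"
  using ip_sum_left[of p f K h] by (simp add: ip_commute)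

lemma ip_cong: "(\<And>i. i < p \<Longrightarrow> f i = f' i) \<Longrightarrow> (\<And>i. i < p \<Longrightarrow> g i = g' i) \<Longrightarrow> ip p f g = ip p f' g'"
  unfolding ip_def by (intro sum.cong) auto

lemma ip_self_nonneg: "0 \<le> ip p f f"
  unfolding ip_def by (intro sum_nonneg) auto

lemma ip_mv: "ip p x (mv p A y) = (\<Sum>i<p. \<Sum>j<p. x i * A i j * y j)"
  by (simp add: ip_def mv_def sum_distrib_left mult.assoc)

lemma mv_add: "mv p A (\<lambda>i. x i + y i) = (\<lambda>i. mv p A x i + mv p A y i)"
  and mv_diff: "mv p A (\<lambda>i. x i - y i) = (\<lambda>i. mv p A x i - mv p A y i)"
  and mv_scale: "mv p A (\<lambda>i. c * x i) = (\<lambda>i. c * mv p A x i)"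
  by (auto simp: mv_def algebra_simps sum.distrib sum_subtractf sum_distrib_left)

lemma mv_sum: "mv p A (\<lambda>i. \<Sum>k\<in>K. f k i) = (\<lambda>i. \<Sum>k\<in>K. mv p A (f k) i)"
  unfolding mv_def sum_distrib_left by (rule ext) (rule sum.swap)

lemma ip_mv_symmetric:
  assumes "\<And>i j. i < p \<Longrightarrow> j < p \<Longrightarrow> A i j = A j i"
  shows "ip p x (mv p A y) = ip p y (mv p A x)"
proof -
  have "ip p x (mv p A y) = (\<Sum>j<p. \<Sum>i<p. x i * A i j * y j)"
    unfolding ip_mv by (rule sum.swap)
  also have "\<dots> = (\<Sum>j<p. \<Sum>i<p. y j * A j i * x i)"
    by (intro sum.cong refl) (use assms in \<open>simp add: mult_ac\<close>)
  finally show ?thesis by (simp add: ip_mv)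
qed

text \<open>
  Polarization. The arithmetic mean on the right avoids square roots; rescaling y recovers the
  product form.
\<close>

lemma bilinear_bound_from_quadratic:
  assumes sym: "\<And>i j. i < p \<Longrightarrow> j < p \<Longrightarrow> A i j = A j i"
    and bound: "\<And>x. \<bar>ip p x (mv p A x)\<bar> \<le> b * ip p x x"
  shows "ip p y (mv p A x) \<le> b * (ip p x x + ip p y y) / 2"
proof -
  define u v where "u = (\<lambda>i. x i + y i)" and "v = (\<lambda>i. x i - y i)"
  have "4 * ip p y (mv p A x) = ip p u (mv p A u) - ip p v (mv p A v)"
    unfolding u_def v_def mv_add mv_diff ip_add_left ip_add_right ip_diff_left ip_diff_right
    using ip_mv_symmetric[of p A y x, OF sym] by simp
  also have "\<dots> \<le> b * ip p u u + b * ip p v v" using bound[of u] bound[of v] by linarith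
  also have "\<dots> = 2 * b * (ip p x x + ip p y y)"
    unfolding u_def v_def ip_add_left ip_add_right ip_diff_left ip_diff_right
    by (simp add: ip_commute[of p y x] algebra_simps)
  finally show ?thesis by simp
qed

text \<open>
  The trace of the product of two orthogonal projections, each given by spanning vectors.
\<close>

lemma projection_inner_product:
  "(\<Sum>i<p. \<Sum>j<p. (\<Sum>k\<in>K. a k i * a k j) * (\<Sum>l\<in>L. b l i * b l j)) = (\<Sum>k\<in>K. \<Sum>l\<in>L. (ip p (a k) (b l))\<^sup>2)"
proof -
  have "(\<Sum>i<p. \<Sum>j<p. (\<Sum>k\<in>K. a k i * a k j) * (\<Sum>l\<in>L. b l i * b l j))
      = (\<Sum>i<p. \<Sum>j<p. \<Sum>k\<in>K. \<Sum>l\<in>L. (a k i * b l i) * (a k j * b l j))"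
    by (simp add: sum_product mult_ac)
  also have "\<dots> = (\<Sum>i<p. \<Sum>k\<in>K. \<Sum>j<p. \<Sum>l\<in>L. (a k i * b l i) * (a k j * b l j))"
    by (intro sum.cong refl sum.swap)
  also have "\<dots> = (\<Sum>k\<in>K. \<Sum>i<p. \<Sum>j<p. \<Sum>l\<in>L. (a k i * b l i) * (a k j * b l j))"
    by (rule sum.swap)
  also have "\<dots> = (\<Sum>k\<in>K. \<Sum>i<p. \<Sum>l\<in>L. \<Sum>j<p. (a k i * b l i) * (a k j * b l j))"
    by (intro sum.cong refl sum.swap)
  also have "\<dots> = (\<Sum>k\<in>K. \<Sum>l\<in>L. \<Sum>i<p. \<Sum>j<p. (a k i * b l i) * (a k j * b l j))"
    by (intro sum.cong refl sum.swap)
  also have "\<dots> = (\<Sum>k\<in>K. \<Sum>l\<in>L. (ip p (a k) (b l))\<^sup>2)"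
    by (simp add: ip_def power2_eq_square sum_product)
  finally show ?thesis .
qed

lemma sum_of_bool_mult: "finite K \<Longrightarrow> k \<in> K \<Longrightarrow> (\<Sum>l\<in>K. f l * of_bool (k = l)) = (f k :: real)"
  by (simp add: of_bool_def if_distrib[where f = "\<lambda>x. _ * x"] sum.delta' cong: if_cong)

lemma ip_mv_spiked:
  assumes G: "\<And>i j. i < p \<Longrightarrow> j < p \<Longrightarrow> G i j = (\<Sum>l<r. d l * b l i * b l j) + of_bool (i = j)"
  shows "ip p y (mv p G x) = (\<Sum>l<(r::nat). d l * ip p y (b l) * ip p (b l) x) + ip p y x"
proof -
  have "mv p G x i = (\<Sum>l<r. (d l * ip p (b l) x) * b l i) + x i" if "i < p" for i
  proof -
    have "mv p G x i = (\<Sum>j<p. (\<Sum>l<r. d l * b l i * b l j) * x j) + (\<Sum>j<p. x j * of_bool (i = j))"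
      unfolding mv_def sum.distrib[symmetric]
      by (intro sum.cong refl) (simp add: G[OF that] distrib_right)
    also have "(\<Sum>j<p. x j * of_bool (i = j)) = x i" using that by (intro sum_of_bool_mult) auto
    also have "(\<Sum>j<p. (\<Sum>l<r. d l * b l i * b l j) * x j) = (\<Sum>l<r. \<Sum>j<p. d l * b l i * b l j * x j)"
      unfolding sum_distrib_right by (rule sum.swap)
    also have "\<dots> = (\<Sum>l<r. (d l * ip p (b l) x) * b l i)"
      by (simp add: ip_def sum_distrib_left sum_distrib_right mult_ac)
    finally show ?thesis .
  qed
  then have "ip p y (mv p G x) = ip p y (\<lambda>i. (\<Sum>l<r. (d l * ip p (b l) x) * b l i) + x i)"
    by (intro ip_cong) auto
  then show ?thesis by (simp only: ip_add_right ip_sum_right ip_scale_right) (simp add: mult_ac)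
qed

lemma bessel:
  fixes r :: nat and b :: "nat \<Rightarrow> nat \<Rightarrow> real"
  assumes "\<And>k l. k < r \<Longrightarrow> l < r \<Longrightarrow> ip p (b k) (b l) = of_bool (k = l)"
  shows "(\<Sum>k<r. (ip p (b k) u)\<^sup>2) \<le> ip p u u"
proof -
  define v where "v = (\<lambda>i. \<Sum>k<r. ip p (b k) u * b k i)"
  have vu: "ip p v u = (\<Sum>k<r. (ip p (b k) u)\<^sup>2)"
    unfolding v_def ip_sum_left ip_scale_left by (simp add: power2_eq_square)
  have vb: "ip p v (b l) = ip p (b l) u" if "l < r" for l
  proof -
    have "ip p v (b l) = (\<Sum>k<r. ip p (b k) u * of_bool (l = k))"
      unfolding v_def ip_sum_left ip_scale_left using assms[OF _ that] by (simp add: eq_commute[of _ l])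
    also have "\<dots> = ip p (b l) u" using that by (intro sum_of_bool_mult) auto
    finally show ?thesis .
  qed
  have "ip p v v = (\<Sum>k<r. ip p (b k) u * ip p v (b k))"
    by (subst (2) v_def) (simp only: ip_sum_right ip_scale_right)
  then have vv: "ip p v v = (\<Sum>k<r. (ip p (b k) u)\<^sup>2)" using vb by (simp add: power2_eq_square)
  have "0 \<le> ip p (\<lambda>i. u i - v i) (\<lambda>i. u i - v i)" by (rule ip_self_nonneg)
  then show ?thesis by (simp add: ip_diff_left ip_diff_right ip_commute[of p u v] vu vv)
qed

text \<open>
  A Davis-Kahan bound. Let P project onto the span of the b k, so that (1 - P) G = 1 - P. Applying 1 - P
  to the eigenvector equation H (w k) = \<mu> k * w k gives (\<mu> k - 1) y = (1 - P) (H - G) (w k) for the residual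
  y = (1 - P) (w k). By the minimax principle the r leading eigenvalues of H are at least
  1 + lam - \<beta> >= 1 + lam / 2, hence |y| <= 2 \<beta> / lam; and the squared Frobenius distance of two projections
  of rank r is twice the sum of the squared residuals.
\<close>

theorem eigenspace_perturbation:
  fixes b w :: "nat \<Rightarrow> nat \<Rightarrow> real" and d \<mu> :: "nat \<Rightarrow> real" and H G :: "nat \<Rightarrow> nat \<Rightarrow> real"
  assumes r: "0 < r" "r \<le> p"
    and b: "\<And>k l. k < r \<Longrightarrow> l < r \<Longrightarrow> ip p (b k) (b l) = of_bool (k = l)"
    and w: "\<And>k l. k < p \<Longrightarrow> l < p \<Longrightarrow> ip p (w k) (w l) = of_bool (k = l)"
    and w_complete: "\<And>i j. i < p \<Longrightarrow> j < p \<Longrightarrow> (\<Sum>k<p. w k i * w k j) = of_bool (i = j)"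
    and eig: "\<And>k i. k < p \<Longrightarrow> i < p \<Longrightarrow> mv p H (w k) i = \<mu> k * w k i"
    and mono: "\<And>k l. k \<le> l \<Longrightarrow> l < p \<Longrightarrow> \<mu> l \<le> \<mu> k"
    and H: "\<And>i j. i < p \<Longrightarrow> j < p \<Longrightarrow> H i j = H j i"
    and G: "\<And>i j. i < p \<Longrightarrow> j < p \<Longrightarrow> G i j = (\<Sum>l<r. d l * b l i * b l j) + of_bool (i = j)"
    and d: "\<And>l. l < r \<Longrightarrow> lam \<le> d l" and lam: "0 < lam"
    and close: "\<And>x. \<bar>ip p x (mv p (\<lambda>i j. H i j - G i j) x)\<bar> \<le> \<beta> * ip p x x"
    and \<beta>: "0 < \<beta>" "\<beta> \<le> lam / 2"
  shows "(\<Sum>i<p. \<Sum>j<p. ((\<Sum>k<r. w k i * w k j) - (\<Sum>k<r. b k i * b k j))\<^sup>2) \<le> 8 * real r * \<beta>\<^sup>2 / lam\<^sup>2"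
proof -
  define \<Delta> where "\<Delta> = (\<lambda>i j. H i j - G i j)"
  have \<Delta>sym: "\<Delta> i j = \<Delta> j i" if "i < p" "j < p" for i j
    using H[OF that] G[OF that] G[OF that(2,1)] by (simp add: \<Delta>_def mult_ac of_bool_def)
  have G_apply: "ip p y (mv p G x) = (\<Sum>l<r. d l * ip p y (b l) * ip p (b l) x) + ip p y x" for x y
    by (rule ip_mv_spiked[OF G])
  have H_split: "ip p y (mv p H x) = ip p y (mv p G x) + ip p y (mv p \<Delta> x)" for x y
    by (simp add: ip_mv \<Delta>_def sum.distrib[symmetric] algebra_simps)
  have expand: "x i = (\<Sum>k<p. ip p (w k) x * w k i)" if "i < p" for x i
  proof -
    have "(\<Sum>k<p. ip p (w k) x * w k i) = (\<Sum>k<p. \<Sum>j<p. x j * (w k i * w k j))"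
      unfolding ip_def sum_distrib_right by (simp add: mult_ac)
    also have "\<dots> = (\<Sum>j<p. x j * (\<Sum>k<p. w k i * w k j))"
      by (subst sum.swap) (simp add: sum_distrib_left)
    also have "\<dots> = (\<Sum>j<p. x j * of_bool (i = j))" using w_complete[OF that] by simp
    also have "\<dots> = x i" using that by (intro sum_of_bool_mult) auto
    finally show ?thesis ..
  qed
  have parseval: "ip p x x = (\<Sum>k<p. (ip p (w k) x)\<^sup>2)" for x
  proof -
    have "ip p x x = ip p (\<lambda>i. \<Sum>k<p. ip p (w k) x * w k i) x" by (intro ip_cong expand) auto
    then show ?thesis by (simp add: ip_sum_left ip_scale_left power2_eq_square)
  qed
  have quad: "ip p x (mv p H x) = (\<Sum>k<p. \<mu> k * (ip p (w k) x)\<^sup>2)" for x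
  proof -
    have "mv p H x i = (\<Sum>k<p. (ip p (w k) x * \<mu> k) * w k i)" if "i < p" for i
    proof -
      have "mv p H x i = mv p H (\<lambda>i. \<Sum>k<p. ip p (w k) x * w k i) i"
        unfolding mv_def by (intro sum.cong refl) (use expand[of _ x] in simp)
      also have "\<dots> = (\<Sum>k<p. (ip p (w k) x * \<mu> k) * w k i)"
        unfolding mv_sum mv_scale using eig that by (simp add: mult.assoc)
      finally show ?thesis .
    qed
    then have "ip p x (mv p H x) = ip p x (\<lambda>i. \<Sum>k<p. (ip p (w k) x * \<mu> k) * w k i)"
      by (intro ip_cong) auto
    then show ?thesis
      by (simp only: ip_sum_right ip_scale_right) (simp add: ip_commute[of p x] power2_eq_square mult_ac)
  qed
  have gap: "1 + lam / 2 \<le> \<mu> (r - 1)"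
  proof -
    \<comment> \<open>a vector in the span of the b j that is orthogonal to the first r - 1 eigenvectors of H\<close>
    obtain c where c: "\<exists>j\<in>{..<r}. c j \<noteq> 0"
      "\<forall>k\<in>{..<r - 1}. (\<Sum>j\<in>{..<r}. ip p (w k) (b j) * c j) = 0"
      using underdetermined_homogeneous_system[of "{..<r - 1}" "{..<r}" "\<lambda>k j. ip p (w k) (b j)"] r by auto
    define x where "x = (\<lambda>i. \<Sum>j<r. c j * b j i)"
    have bx: "ip p (b l) x = c l" if "l < r" for l
    proof -
      have "ip p (b l) x = (\<Sum>j<r. c j * of_bool (l = j))"
        unfolding x_def ip_sum_right ip_scale_right using b[OF that] by simp
      also have "\<dots> = c l" using that by (intro sum_of_bool_mult) auto
      finally show ?thesis .
    qed
    have xx: "ip p x x = (\<Sum>l<r. (c l)\<^sup>2)"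
    proof -
      have "ip p x x = (\<Sum>l<r. c l * ip p (b l) x)"
        by (subst x_def) (simp add: ip_sum_left ip_scale_left)
      then show ?thesis by (simp add: bx power2_eq_square)
    qed
    have pos: "0 < ip p x x"
    proof -
      obtain j where "j < r" "c j \<noteq> 0" using c(1) by auto
      then show ?thesis unfolding xx by (intro sum_pos2[of _ j]) auto
    qed
    have wx: "ip p (w k) x = 0" if "k < r - 1" for k
      using c(2) that unfolding x_def ip_sum_right ip_scale_right by (simp add: mult.commute)
    have "(1 + lam - \<beta>) * ip p x x \<le> ip p x (mv p H x)"
    proof -
      have "lam * ip p x x \<le> (\<Sum>l<r. d l * ip p x (b l) * ip p (b l) x)"
        unfolding xx sum_distrib_left
        by (intro sum_mono) (use d bx in \<open>simp add: ip_commute[of p x] power2_eq_square mult.assoc mult_right_mono\<close>)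
      moreover have "- (\<beta> * ip p x x) \<le> ip p x (mv p \<Delta> x)" using close[of x] by (simp add: \<Delta>_def abs_le_iff)
      ultimately show ?thesis unfolding H_split G_apply by (simp add: algebra_simps)
    qed
    also have "\<dots> \<le> (\<Sum>k<p. \<mu> (r - 1) * (ip p (w k) x)\<^sup>2)"
      unfolding quad
    proof (rule sum_mono)
      fix k assume "k \<in> {..<p}"
      then show "\<mu> k * (ip p (w k) x)\<^sup>2 \<le> \<mu> (r - 1) * (ip p (w k) x)\<^sup>2"
        using wx[of k] mono[of "r - 1" k] by (cases "k < r - 1") (auto intro: mult_right_mono)
    qed
    also have "\<dots> = \<mu> (r - 1) * ip p x x" by (simp add: parseval sum_distrib_left)
    finally have "1 + lam - \<beta> \<le> \<mu> (r - 1)" using pos by simp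
    then show ?thesis using \<beta> by linarith
  qed
  define y where "y = (\<lambda>k i. w k i - (\<Sum>l<r. ip p (b l) (w k) * b l i))"
  have yb: "ip p (y k) (b l) = 0" if "l < r" for k l
  proof -
    have "ip p (y k) (b l) = ip p (w k) (b l) - (\<Sum>j<r. ip p (b j) (w k) * of_bool (l = j))"
      unfolding y_def ip_diff_left ip_sum_left ip_scale_left
      using b that by (simp add: eq_commute[of _ l])
    also have "(\<Sum>j<r. ip p (b j) (w k) * of_bool (l = j)) = ip p (b l) (w k)"
      using that by (intro sum_of_bool_mult) auto
    finally show ?thesis by (simp add: ip_commute)
  qed
  have yw: "ip p (y k) (w k) = ip p (y k) (y k)" for k
  proof -
    have "ip p (y k) (y k) = ip p (y k) (\<lambda>i. w k i - (\<Sum>l<r. ip p (b l) (w k) * b l i))"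
      by (rule arg_cong[where f = "ip p (y k)"]) (simp add: y_def)
    then show ?thesis by (simp add: ip_diff_right ip_sum_right ip_scale_right yb)
  qed
  have yy: "ip p (y k) (y k) = 1 - (\<Sum>l<r. (ip p (b l) (w k))\<^sup>2)" if "k < r" for k
    unfolding yw[symmetric] using w[of k k] that r
    by (subst y_def) (simp add: ip_diff_left ip_sum_left ip_scale_left power2_eq_square)
  have residual: "ip p (y k) (y k) \<le> 4 * \<beta>\<^sup>2 / lam\<^sup>2" if k: "k < r" for k
  proof -
    \<comment> \<open>the optimal rescaling of the residual in the polarized bound\<close>
    define s where "s = lam / (2 * \<beta>)"
    have s: "0 < s" using lam \<beta> by (simp add: s_def)
    have "ip p (y k) (mv p H (w k)) = \<mu> k * ip p (y k) (y k)"
    proof -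
      have "ip p (y k) (mv p H (w k)) = ip p (y k) (\<lambda>i. \<mu> k * w k i)"
        using eig k r by (intro ip_cong) auto
      then show ?thesis by (simp add: ip_scale_right yw)
    qed
    moreover have "ip p (y k) (mv p G (w k)) = ip p (y k) (y k)"
      unfolding G_apply by (simp add: yb yw)
    ultimately have "(\<mu> k - 1) * ip p (y k) (y k) = ip p (y k) (mv p \<Delta> (w k))"
      using H_split[of "y k" "w k"] by (simp add: algebra_simps)
    moreover have "lam / 2 * ip p (y k) (y k) \<le> (\<mu> k - 1) * ip p (y k) (y k)"
    proof (intro mult_right_mono ip_self_nonneg)
      have "\<mu> (r - 1) \<le> \<mu> k" by (rule mono) (use k r in auto)
      then show "lam / 2 \<le> \<mu> k - 1" using gap by linarith
    qed
    ultimately have "s * (lam / 2 * ip p (y k) (y k)) \<le> s * ip p (y k) (mv p \<Delta> (w k))"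
      using s by (intro mult_left_mono) auto
    also have "\<dots> = ip p (\<lambda>i. s * y k i) (mv p \<Delta> (w k))" by (simp add: ip_scale_left)
    also have "\<dots> \<le> \<beta> * (ip p (w k) (w k) + ip p (\<lambda>i. s * y k i) (\<lambda>i. s * y k i)) / 2"
      by (rule bilinear_bound_from_quadratic[OF \<Delta>sym]) (use close in \<open>auto simp: \<Delta>_def\<close>)
    also have "\<dots> = \<beta> / 2 + \<beta> * s * s * ip p (y k) (y k) / 2"
      using w[of k k] k r by (simp add: ip_scale_left ip_scale_right algebra_simps add_divide_distrib)
    also have "\<beta> * s * s = s * (lam / 2)" using \<beta> by (simp add: s_def)
    finally have "s * (lam / 2) * ip p (y k) (y k) \<le> \<beta>" by (simp add: algebra_simps)
    then have "lam\<^sup>2 * ip p (y k) (y k) \<le> 4 * \<beta>\<^sup>2"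
      using \<beta> by (simp add: s_def power2_eq_square field_simps)
    then show ?thesis using lam by (simp add: pos_le_divide_eq mult.commute)
  qed
  have same: "(\<Sum>k<r. \<Sum>l<r. (ip p (a k) (a l))\<^sup>2) = real r"
    if "\<And>k l. k < r \<Longrightarrow> l < r \<Longrightarrow> ip p (a k) (a l) = of_bool (k = l)" for a
  proof -
    have "(\<Sum>k<r. \<Sum>l<r. (ip p (a k) (a l))\<^sup>2) = (\<Sum>k<r. \<Sum>l<r. 1 * of_bool (k = l))"
      using that by (intro sum.cong refl) (auto simp: of_bool_def)
    also have "\<dots> = (\<Sum>k<r. 1)" by (intro sum.cong refl sum_of_bool_mult) auto
    finally show ?thesis by simp
  qed
  define Pw Pb where "Pw = (\<lambda>i j. \<Sum>k<r. w k i * w k j)" and "Pb = (\<lambda>i j. \<Sum>k<r. b k i * b k j)"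
  have "(\<Sum>i<p. \<Sum>j<p. (Pw i j - Pb i j)\<^sup>2)
      = (\<Sum>i<p. \<Sum>j<p. Pw i j * Pw i j) + (\<Sum>i<p. \<Sum>j<p. Pb i j * Pb i j) - 2 * (\<Sum>i<p. \<Sum>j<p. Pw i j * Pb i j)"
    by (simp add: power2_eq_square algebra_simps sum.distrib sum_subtractf sum_distrib_left)
  also have "\<dots> = real r + real r - 2 * (\<Sum>k<r. \<Sum>l<r. (ip p (w k) (b l))\<^sup>2)"
    unfolding Pw_def Pb_def projection_inner_product
    using same[of w] same[of b] w b r by simp
  also have "\<dots> = 2 * (\<Sum>k<r. ip p (y k) (y k))"
    by (simp add: yy sum_subtractf ip_commute)
  also have "\<dots> \<le> 2 * (\<Sum>k<r. 4 * \<beta>\<^sup>2 / lam\<^sup>2)" by (intro mult_left_mono sum_mono residual) auto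
  also have "\<dots> = 8 * real r * \<beta>\<^sup>2 / lam\<^sup>2" by simp
  finally show ?thesis by (simp add: Pw_def Pb_def)
qed

section \<open>The spread of the marginal laws\<close>

text \<open>
  The left-hand side is, up to the factor 1/2, the area of a triangle inscribed in the unit circle, as
  a function of its central angles.
\<close>

lemma sin_triple_sum: "sin A + sin B - sin (A + B) = 4 * sin (A / 2) * sin (B / 2) * sin ((A + B) / 2)" for A B :: real
proof -
  define a b where "a = A / 2" and "b = B / 2"
  have A: "A = 2 * a" and B: "B = 2 * b" by (simp_all add: a_def b_def)
  have ca: "(cos a)\<^sup>2 = 1 - (sin a)\<^sup>2" and cb: "(cos b)\<^sup>2 = 1 - (sin b)\<^sup>2" by (simp_all add: cos_squared_eq)
  have "sin (2 * a) + sin (2 * b) - sin (2 * (a + b)) = 4 * sin a * sin b * sin (a + b)"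
  proof -
    have "2 * x * y + 2 * z * w - 2 * ((x * w + y * z) * (y * w - x * z))
        = 2 * x * y * (1 - w\<^sup>2 + z\<^sup>2) + 2 * z * w * (1 - y\<^sup>2 + x\<^sup>2)" for x y z w :: real
      by (simp add: algebra_simps power2_eq_square)
    from this[of "sin a" "cos a" "sin b" "cos b"]
    have "sin (2 * a) + sin (2 * b) - sin (2 * (a + b))
        = 2 * sin a * cos a * (1 - (cos b)\<^sup>2 + (sin b)\<^sup>2) + 2 * sin b * cos b * (1 - (cos a)\<^sup>2 + (sin a)\<^sup>2)"
      unfolding sin_double sin_add cos_add by (simp only: mult.assoc)
    also have "\<dots> = 4 * sin a * sin b * sin (a + b)"
      unfolding ca cb sin_add by (simp add: algebra_simps power2_eq_square)
    finally show ?thesis .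
  qed
  then show ?thesis by (simp add: A B distrib_left add_divide_distrib)
qed

text \<open>
  The expression is the determinant that decides whether three tangents of the unit circle, with normal
  directions t0, t1, t2 up to sign, meet in a point. Flipping a sign is a rotation by pi, so the claim is
  that three distinct points of the circle are not collinear.
\<close>

lemma three_tangents_no_common_point:
  fixes t0 t1 t2 s0 s1 s2 :: real
  assumes t: "0 \<le> t0" "t0 < pi" "0 \<le> t1" "t1 < pi" "0 \<le> t2" "t2 < pi"
    and s: "s0 = 1 \<or> s0 = - 1" "s1 = 1 \<or> s1 = - 1" "s2 = 1 \<or> s2 = - 1"
    and distinct: "t0 \<noteq> t1" "t1 \<noteq> t2" "t0 \<noteq> t2"
  shows "s0 * sin (t1 - t2) + s1 * sin (t2 - t0) + s2 * sin (t0 - t1) \<noteq> 0"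
proof -
  define u where "u = (\<lambda>t s :: real. t + (if s = 1 then 0 else pi))"
  have sin_u: "sin (u a s - u b r) = s * r * sin (a - b)"
    if "s = 1 \<or> s = - 1" "r = 1 \<or> r = - 1" for a b s r
  proof -
    have "sin (a - (b + pi)) = - sin (a - b)" "sin (a + pi - b) = - sin (a - b)"
      by (simp_all add: sin_diff sin_add cos_add cos_diff)
    then show ?thesis using that unfolding u_def by auto
  qed
  have half: "sin ((u a s - u b r) / 2) \<noteq> 0"
    if "0 \<le> a" "a < pi" "0 \<le> b" "b < pi" "a \<noteq> b" for a b s r
  proof -
    define x where "x = (u a s - u b r) / 2"
    have "x \<noteq> 0" "- pi < x" "x < pi" using that unfolding u_def x_def by (auto split: if_splits)
    then have "sin x \<noteq> 0"
      using sin_gt_zero[of x] sin_gt_zero[of "- x"] by (cases "0 < x") auto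
    then show ?thesis by (simp add: x_def)
  qed
  define h where "h = s0 * sin (t1 - t2) + s1 * sin (t2 - t0) + s2 * sin (t0 - t1)"
  have "sin (u t0 s0 - u t1 s1) + sin (u t1 s1 - u t2 s2) - sin (u t0 s0 - u t2 s2) \<noteq> 0"
    using sin_triple_sum[of "u t0 s0 - u t1 s1" "u t1 s1 - u t2 s2"]
      half[OF t(1-4) distinct(1), of s0 s1] half[OF t(3-6) distinct(2), of s1 s2] half[OF t(1,2,5,6) distinct(3), of s0 s2]
    by simp
  moreover have "sin (u t0 s0 - u t1 s1) + sin (u t1 s1 - u t2 s2) - sin (u t0 s0 - u t2 s2) = s0 * s1 * s2 * h"
  proof -
    have "sin (t0 - t2) = - sin (t2 - t0)" using sin_minus[of "t2 - t0"] by simp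
    then show ?thesis
      unfolding sin_u[OF s(1,2)] sin_u[OF s(2,3)] sin_u[OF s(1,3)] h_def using s by (elim disjE) simp_all
  qed
  ultimately show ?thesis unfolding h_def by auto
qed

text \<open>
  The N lines through the origin are fixed, so the determinants of the preceding lemma take finitely
  many values and their minimum is positive. If three of the projections of (x, y) were within a/2 of
  1 or -1, the linear relation between the three directions would make one of the determinants smaller
  than this minimum. The constant depends on N only.
\<close>

lemma few_tangents_near_point:
  fixes N :: nat
  shows "\<exists>a>0. a \<le> (1 :: real) \<and> (\<forall>x y :: real.
    card {j. j < N \<and> 1 < (cos (pi * real j / real N) * x + sin (pi * real j / real N) * y)\<^sup>2 \<and>
      (cos (pi * real j / real N) * x + sin (pi * real j / real N) * y)\<^sup>2 \<le> 1 + a} \<le> 2)"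
proof -
  define \<theta> where "\<theta> = (\<lambda>j :: nat. pi * real j / real N)"
  define defect where "defect = (\<lambda>(i, j, k, s1 :: real, s2 :: real, s3 :: real).
    \<bar>s1 * sin (\<theta> j - \<theta> k) + s2 * sin (\<theta> k - \<theta> i) + s3 * sin (\<theta> i - \<theta> j)\<bar>)"
  define T where "T = {(i, j, k, s1 :: real, s2 :: real, s3 :: real). (i, j, k) \<in> {..<N} \<times> {..<N} \<times> {..<N} \<and> i \<noteq> j \<and> j \<noteq> k \<and> i \<noteq> k \<and>
    (s1, s2, s3) \<in> {1, -1} \<times> {1, -1} \<times> {1, -1}}"
  have "T \<subseteq> {..<N} \<times> {..<N} \<times> {..<N} \<times> {1, -1} \<times> {1, -1} \<times> {1, -1}" by (auto simp: T_def)
  then have "finite T" by (rule finite_subset) auto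
  \<comment> \<open>the entry 2 keeps the set nonempty and a at most 1\<close>
  define a where "a = Min (insert 2 (defect ` T)) / 2"
  have \<theta>: "0 \<le> \<theta> j \<and> \<theta> j < pi" if "j < N" for j
    using that by (auto simp: \<theta>_def field_simps)
  have \<theta>_inj: "\<theta> i \<noteq> \<theta> j" if "i < N" "j < N" "i \<noteq> j" for i j
    using that by (auto simp: \<theta>_def field_simps)
  have pos: "0 < defect z" if "z \<in> T" for z
  proof -
    obtain i j k s1 s2 s3 where z: "z = (i, j, k, s1, s2, s3)" by (cases z) auto
    have h: "i < N" "j < N" "k < N" "i \<noteq> j" "j \<noteq> k" "i \<noteq> k" "s1 = 1 \<or> s1 = -1" "s2 = 1 \<or> s2 = -1" "s3 = 1 \<or> s3 = -1"
      using that unfolding z T_def by auto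
    show ?thesis
      using three_tangents_no_common_point[OF _ _ _ _ _ _ h(7-9)
          \<theta>_inj[OF h(1,2,4)] \<theta>_inj[OF h(2,3,5)] \<theta>_inj[OF h(1,3,6)]] \<theta>[OF h(1)] \<theta>[OF h(2)] \<theta>[OF h(3)]
      unfolding z defect_def prod.case zero_less_abs_iff by blast
  qed
  have fin: "finite (insert 2 (defect ` T))" using \<open>finite T\<close> by simp
  have a: "0 < a" "a \<le> 1"
    using pos Min_in[OF fin] Min_le[OF fin, of 2] by (auto simp: a_def)
  have a_le: "2 * a \<le> defect z" if "z \<in> T" for z
    using Min_le[OF fin, of "defect z"] that by (auto simp: a_def)
  have "card {j. j < N \<and> 1 < (cos (\<theta> j) * x + sin (\<theta> j) * y)\<^sup>2 \<and> (cos (\<theta> j) * x + sin (\<theta> j) * y)\<^sup>2 \<le> 1 + a} \<le> 2"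
    (is "card ?S \<le> 2") for x y
  proof (rule ccontr)
    assume "\<not> card ?S \<le> 2"
    then have "3 \<le> card ?S" by simp
    then obtain S where S: "S \<subseteq> ?S" "card S = 3" by (meson obtain_subset_with_card_n)
    then obtain i j k where ijk: "S = {i, j, k}" "i \<noteq> j" "j \<noteq> k" "i \<noteq> k" by (auto simp: card_3_iff)
    define f where "f = (\<lambda>j. cos (\<theta> j) * x + sin (\<theta> j) * y)"
    have f: "j < N" "\<bar>f j - sgn (f j)\<bar> \<le> a / 2" "sgn (f j) \<in> {1, -1}" if "j \<in> S" for j
    proof -
      have fj: "j < N" "1 < (f j)\<^sup>2" "(f j)\<^sup>2 \<le> 1 + a" using S(1) that by (auto simp: f_def)
      then show "j < N" by simp
      have "f j \<noteq> 0" using fj(2) by auto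
      then show "sgn (f j) \<in> {1, -1}" by (auto simp: sgn_if)
      have g: "1 < \<bar>f j\<bar>" using fj(2) abs_square_le_1[of "f j"] by linarith
      have "(\<bar>f j\<bar> - 1) * 2 \<le> (\<bar>f j\<bar> - 1) * (\<bar>f j\<bar> + 1)" using g by (intro mult_left_mono) auto
      also have "\<dots> = (f j)\<^sup>2 - 1" by (simp add: algebra_simps power2_eq_square)
      finally have "\<bar>f j\<bar> - 1 \<le> a / 2" using fj(3) by simp
      moreover have "\<bar>f j - sgn (f j)\<bar> = \<bar>f j\<bar> - 1" using g by (auto simp: sgn_if abs_if)
      ultimately show "\<bar>f j - sgn (f j)\<bar> \<le> a / 2" by simp
    qed
    have "f i * sin (\<theta> j - \<theta> k) + f j * sin (\<theta> k - \<theta> i) + f k * sin (\<theta> i - \<theta> j) = 0"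
      unfolding f_def sin_diff by (simp add: algebra_simps)
    then have "sgn (f i) * sin (\<theta> j - \<theta> k) + sgn (f j) * sin (\<theta> k - \<theta> i) + sgn (f k) * sin (\<theta> i - \<theta> j)
      = - ((f i - sgn (f i)) * sin (\<theta> j - \<theta> k) + (f j - sgn (f j)) * sin (\<theta> k - \<theta> i) + (f k - sgn (f k)) * sin (\<theta> i - \<theta> j))"
      by (simp add: algebra_simps)
    then have "defect (i, j, k, sgn (f i), sgn (f j), sgn (f k))
      = \<bar>(f i - sgn (f i)) * sin (\<theta> j - \<theta> k) + (f j - sgn (f j)) * sin (\<theta> k - \<theta> i) + (f k - sgn (f k)) * sin (\<theta> i - \<theta> j)\<bar>"
      unfolding defect_def prod.case by (simp only: abs_minus_cancel)
    also have "\<dots> \<le> \<bar>(f i - sgn (f i)) * sin (\<theta> j - \<theta> k)\<bar> + \<bar>(f j - sgn (f j)) * sin (\<theta> k - \<theta> i)\<bar> + \<bar>(f k - sgn (f k)) * sin (\<theta> i - \<theta> j)\<bar>"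
      by linarith
    also have "\<dots> \<le> a / 2 * 1 + a / 2 * 1 + a / 2 * 1"
      unfolding abs_mult using f(2) ijk(1) a(1) by (intro add_mono mult_mono) auto
    finally have "defect (i, j, k, sgn (f i), sgn (f j), sgn (f k)) < 2 * a" using a(1) by linarith
    moreover have "(i, j, k, sgn (f i), sgn (f j), sgn (f k)) \<in> T"
      using f(1)[of i] f(1)[of j] f(1)[of k] f(3)[of i] f(3)[of j] f(3)[of k] ijk unfolding T_def by simp argo
    ultimately show False using a_le[of "(i, j, k, sgn (f i), sgn (f j), sgn (f k))"] by linarith
  qed
  then show ?thesis unfolding \<theta>_def by (intro exI[of _ a] conjI allI a)
qed

abbreviation entries :: "real mat \<Rightarrow> nat \<Rightarrow> nat \<Rightarrow> real" where
  "entries A \<equiv> \<lambda>i j. A $$ (i, j)"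

lemma scalar_prod_vec: "Matrix.vec p f \<bullet> Matrix.vec p g = ip p f g"
  unfolding scalar_prod_def ip_def by (simp add: atLeast0LessThan)

lemma mat_mult_vec_eq:
  assumes "A \<in> carrier_mat p p"
  shows "A *\<^sub>v Matrix.vec p x = Matrix.vec p (mv p (entries A) x)"
  using assms by (intro eq_vecI) (auto simp: scalar_prod_def mv_def atLeast0LessThan)

lemma quadratic_form_vec:
  assumes "A \<in> carrier_mat p p"
  shows "Matrix.vec p f \<bullet> (A *\<^sub>v Matrix.vec p g) = ip p f (mv p (entries A) g)"
  unfolding mat_mult_vec_eq[OF assms] scalar_prod_vec ..

lemma unit_sphere_normalize:
  assumes "0 < ip p u u"
  shows "Matrix.vec p (\<lambda>i. (1 / sqrt (ip p u u)) * u i) \<in> unit_sphere p"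
proof -
  have "Matrix.vec p (\<lambda>i. (1 / sqrt (ip p u u)) * u i) \<bullet> Matrix.vec p (\<lambda>i. (1 / sqrt (ip p u u)) * u i) = 1"
    unfolding scalar_prod_vec ip_scale_left ip_scale_right using assms by simp
  then show ?thesis unfolding unit_sphere_def by simp
qed

lemma marginal_cdf_normalize:
  assumes "\<Gamma> \<in> carrier_mat p p" "0 < ip p u u"
  shows "marginal_cdf p \<Gamma> P (Matrix.vec p (\<lambda>i. (1 / sqrt (ip p u u)) * u i)) t
    = measure P {x \<in> space P. (ip p u x)\<^sup>2 / ip p u (mv p (entries \<Gamma>) u) \<le> t}"
proof -
  have "((1 / sqrt (ip p u u)) * b)\<^sup>2 / ((1 / sqrt (ip p u u)) * ((1 / sqrt (ip p u u)) * c)) = b\<^sup>2 / c" for b c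
    using assms(2) by (simp add: power_mult_distrib power_divide)
  then show ?thesis
    unfolding marginal_cdf_def quadratic_form_vec[OF assms(1)] scalar_prod_vec mv_scale ip_scale_left ip_scale_right power2_abs
    by (simp only:)
qed

lemma ip_self_pos: "0 < ip p u u \<longleftrightarrow> (\<exists>i<p. u i \<noteq> 0)"
  using ip_self_nonneg[of p u] unfolding ip_def
  by (subst less_le) (auto simp: sum_nonneg_eq_0_iff eq_commute[of 0])

text \<open>
  The ratio in the marginal law does not change when u is rescaled, so the condition at unit vectors
  holds at all nonzero u.
\<close>

lemma marginal_conditionD:
  assumes cond: "marginal_condition p \<Gamma> P \<tau> \<alpha>\<^sub>0 \<kappa>" and \<Gamma>: "\<Gamma> \<in> carrier_mat p p" and u: "0 < ip p u u"
  defines "G \<equiv> \<lambda>t. measure P {x \<in> space P. (ip p u x)\<^sup>2 / ip p u (mv p (entries \<Gamma>) u) \<le> t}"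
  shows "\<alpha>\<^sub>0 \<le> \<bar>t\<bar> \<Longrightarrow> \<tau> \<le> \<bar>G 1 - G (1 + t)\<bar>"
    and "0 < \<bar>t\<bar> \<Longrightarrow> \<bar>t\<bar> < \<alpha>\<^sub>0 \<Longrightarrow> \<kappa> powr (- 1 / 2) * \<bar>t\<bar> \<le> \<bar>G 1 - G (1 + t)\<bar>"
proof -
  define v where "v = Matrix.vec p (\<lambda>i. (1 / sqrt (ip p u u)) * u i)"
  have v: "v \<in> unit_sphere p" unfolding v_def by (rule unit_sphere_normalize[OF u])
  have G: "marginal_cdf p \<Gamma> P v = G"
    unfolding G_def v_def by (rule ext) (rule marginal_cdf_normalize[OF \<Gamma> u])
  have c: "\<tau> \<le> (INF t\<in>{t. \<alpha>\<^sub>0 \<le> \<bar>t\<bar>}. \<bar>G 1 - G (1 + t)\<bar>)"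
    "\<kappa> powr (- 1 / 2) \<le> (INF t\<in>{t. 0 < \<bar>t\<bar> \<and> \<bar>t\<bar> < \<alpha>\<^sub>0}. \<bar>G 1 - G (1 + t)\<bar> / \<bar>t\<bar>)"
    using bspec[OF cond[unfolded marginal_condition_def] v] unfolding Let_def G by auto
  show "\<tau> \<le> \<bar>G 1 - G (1 + t)\<bar>" if "\<alpha>\<^sub>0 \<le> \<bar>t\<bar>"
    by (rule order_trans[OF c(1) cINF_lower]) (use that in \<open>auto intro!: bdd_belowI2[of _ 0]\<close>)
  show "\<kappa> powr (- 1 / 2) * \<bar>t\<bar> \<le> \<bar>G 1 - G (1 + t)\<bar>" if t: "0 < \<bar>t\<bar>" "\<bar>t\<bar> < \<alpha>\<^sub>0"
  proof -
    have "\<kappa> powr (- 1 / 2) \<le> \<bar>G 1 - G (1 + t)\<bar> / \<bar>t\<bar>"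
      by (rule order_trans[OF c(2) cINF_lower]) (use t in \<open>auto intro!: bdd_belowI2[of _ 0]\<close>)
    then show ?thesis using t(1) by (simp add: pos_le_divide_eq)
  qed
qed

text \<open>
  Gram-Schmidt for the first two coordinate vectors and the inner product given by A.
\<close>

lemma orthonormal_pair_exists:
  assumes p: "2 \<le> p" and sym: "\<And>i j. i < p \<Longrightarrow> j < p \<Longrightarrow> A i j = A j i"
    and pos: "\<And>u. 0 < ip p u u \<Longrightarrow> 0 < ip p u (mv p A u)"
  shows "\<exists>b c. ip p b (mv p A b) = 1 \<and> ip p c (mv p A c) = 1 \<and> ip p b (mv p A c) = 0"
proof -
  define e :: "nat \<Rightarrow> real" where "e = (\<lambda>i. of_bool (i = 0))"
  define f :: "nat \<Rightarrow> real" where "f = (\<lambda>i. of_bool (i = 1))"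
  define ge where "ge = ip p e (mv p A e)"
  have "0 < ip p e e" unfolding ip_self_pos e_def using p by (intro exI[of _ 0]) auto
  then have ge: "0 < ge" unfolding ge_def by (rule pos)
  define v where "v = (\<lambda>i. f i - (ip p e (mv p A f) / ge) * e i)"
  define gv where "gv = ip p v (mv p A v)"
  have "0 < ip p v v" unfolding ip_self_pos v_def e_def f_def using p by (intro exI[of _ 1]) auto
  then have gv: "0 < gv" unfolding gv_def by (rule pos)
  have ev: "ip p e (mv p A v) = 0"
    unfolding v_def mv_diff mv_scale ip_diff_right ip_scale_right using ge by (simp add: ge_def)
  define b c where "b = (\<lambda>i. (1 / sqrt ge) * e i)" and "c = (\<lambda>i. (1 / sqrt gv) * v i)"
  have "ip p b (mv p A b) = 1" unfolding b_def mv_scale ip_scale_left ip_scale_right ge_def[symmetric] using ge by simp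
  moreover have "ip p c (mv p A c) = 1" unfolding c_def mv_scale ip_scale_left ip_scale_right gv_def[symmetric] using gv by simp
  moreover have "ip p b (mv p A c) = 0" unfolding b_def c_def mv_scale ip_scale_left ip_scale_right ev by simp
  ultimately show ?thesis by blast
qed

lemma ip_measurable [measurable]: "(\<lambda>x. ip p u x) \<in> borel_measurable (Rn p)"
  unfolding ip_def by measurable

text \<open>
  The properties of a law from which lower bounds for the parameters of the marginal condition are
  derived: the condition holds in every direction of a space of dimension at least 2.
\<close>

definition spread_law ::
  "real \<Rightarrow> nat \<Rightarrow> real mat \<Rightarrow> (nat \<Rightarrow> real) measure \<Rightarrow> real \<Rightarrow> real \<Rightarrow> bool" where
  "spread_law \<tau> p \<Gamma> P \<alpha>\<^sub>0 \<kappa> \<longleftrightarrow> 2 \<le> p \<and> prob_space P \<and> sets P = sets (Rn p) \<and> \<Gamma> \<in> carrier_mat p p \<and>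
     0 < \<alpha>\<^sub>0 \<and> 0 < \<kappa> \<and> (\<forall>i<p. \<forall>j<p. \<Gamma> $$ (i, j) = \<Gamma> $$ (j, i)) \<and>
     (\<forall>u. 0 < ip p u u \<longrightarrow> 0 < ip p u (mv p (entries \<Gamma>) u)) \<and> marginal_condition p \<Gamma> P \<tau> \<alpha>\<^sub>0 \<kappa>"

text \<open>
  Choose N > 2/\<tau> directions in a plane that are unit vectors for \<Gamma>. In each of them the squared
  projection lies in (1, 1 + alpha0] with probability at least \<tau>, so that on average N \<tau> > 2 of the directions
  have this property; for alpha0 < a at most two of them can have it at the same point.
\<close>

lemma marginal_radius_lower_bound:
  fixes \<tau> :: real
  assumes "0 < \<tau>"
  shows "\<exists>a>0. \<forall>p \<Gamma> P \<alpha>\<^sub>0 \<kappa>. spread_law \<tau> p \<Gamma> P \<alpha>\<^sub>0 \<kappa> \<longrightarrow> a \<le> \<alpha>\<^sub>0"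
proof -
  \<comment> \<open>N * \<tau> has to exceed 2\<close>
  define N where "N = nat \<lceil>3 / \<tau>\<rceil>"
  have N: "3 \<le> real N * \<tau>"
  proof -
    have "3 / \<tau> \<le> real N" unfolding N_def by (rule real_nat_ceiling_ge)
    then show ?thesis using assms by (simp add: pos_divide_le_eq)
  qed
  obtain a where a: "0 < a" and few: "\<And>x y :: real.
    card {j. j < N \<and> 1 < (cos (pi * real j / real N) * x + sin (pi * real j / real N) * y)\<^sup>2 \<and>
      (cos (pi * real j / real N) * x + sin (pi * real j / real N) * y)\<^sup>2 \<le> 1 + a} \<le> 2"
    using few_tangents_near_point[of N] by auto
  have "a \<le> \<alpha>\<^sub>0" if law: "spread_law \<tau> p \<Gamma> P \<alpha>\<^sub>0 \<kappa>" for p \<Gamma> P \<alpha>\<^sub>0 \<kappa>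
  proof (rule ccontr)
    have p: "2 \<le> p" and P: "prob_space P" "sets P = sets (Rn p)" and \<Gamma>: "\<Gamma> \<in> carrier_mat p p"
      and \<alpha>\<^sub>0: "0 < \<alpha>\<^sub>0" and sym: "\<forall>i<p. \<forall>j<p. \<Gamma> $$ (i, j) = \<Gamma> $$ (j, i)"
      and pos: "\<forall>u. 0 < ip p u u \<longrightarrow> 0 < ip p u (mv p (entries \<Gamma>) u)"
      and cond: "marginal_condition p \<Gamma> P \<tau> \<alpha>\<^sub>0 \<kappa>"
      using law unfolding spread_law_def by blast+
    assume "\<not> a \<le> \<alpha>\<^sub>0"
    interpret P: prob_space P by (rule P(1))
    note P(2)[measurable_cong]
    define A where "A = (entries \<Gamma>)"
    obtain b c where bc: "ip p b (mv p A b) = 1" "ip p c (mv p A c) = 1" "ip p b (mv p A c) = 0"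
      using orthonormal_pair_exists[OF p, of A] sym pos unfolding A_def by blast
    have cb: "ip p c (mv p A b) = 0"
      using ip_mv_symmetric[of p A c b] sym bc(3) unfolding A_def by simp
    define \<theta> where "\<theta> = (\<lambda>j. pi * real j / real N)"
    define u where "u = (\<lambda>j i. cos (\<theta> j) * b i + sin (\<theta> j) * c i)"
    have Au: "ip p (u j) (mv p A (u j)) = 1" for j
      unfolding u_def mv_add mv_scale ip_add_left ip_add_right ip_scale_left ip_scale_right
      using bc cb sin_cos_squared_add[of "\<theta> j"] by (simp add: power2_eq_square add.commute)
    have u_pos: "0 < ip p (u j) (u j)" for j
    proof (rule ccontr)
      assume "\<not> 0 < ip p (u j) (u j)"
      then have "\<forall>i<p. u j i = 0" unfolding ip_self_pos by auto
      then have "ip p (u j) (mv p A (u j)) = 0" by (simp add: ip_def)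
      then show False using Au[of j] by simp
    qed
    define S where "S = (\<lambda>j. {x \<in> space P. 1 < (ip p (u j) x)\<^sup>2 \<and> (ip p (u j) x)\<^sup>2 \<le> 1 + \<alpha>\<^sub>0})"
    have S [measurable]: "S j \<in> sets P" for j unfolding S_def by measurable
    have mass: "\<tau> \<le> P.prob (S j)" for j
    proof -
      define B where "B = (\<lambda>t. {x \<in> space P. (ip p (u j) x)\<^sup>2 \<le> t})"
      have B [measurable]: "B t \<in> sets P" for t unfolding B_def by measurable
      have "\<tau> \<le> \<bar>P.prob (B 1) - P.prob (B (1 + \<alpha>\<^sub>0))\<bar>"
        using marginal_conditionD(1)[OF cond \<Gamma> u_pos[of j], of \<alpha>\<^sub>0] \<alpha>\<^sub>0 unfolding A_def[symmetric] Au B_def by simp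
      also have "\<dots> = P.prob (B (1 + \<alpha>\<^sub>0)) - P.prob (B 1)"
      proof -
        have "P.prob (B 1) \<le> P.prob (B (1 + \<alpha>\<^sub>0))"
          by (rule P.finite_measure_mono[OF _ B]) (use \<alpha>\<^sub>0 in \<open>auto simp: B_def\<close>)
        then show ?thesis by simp
      qed
      also have "\<dots> = P.prob (B (1 + \<alpha>\<^sub>0) - B 1)"
        by (rule P.finite_measure_Diff[symmetric]) (use \<alpha>\<^sub>0 in \<open>auto simp: B_def\<close>)
      also have "B (1 + \<alpha>\<^sub>0) - B 1 = S j" by (auto simp: B_def S_def)
      finally show ?thesis .
    qed
    have "real N * \<tau> \<le> (\<Sum>j<N. P.prob (S j))"
      using sum_mono[of "{..<N}" "\<lambda>_. \<tau>" "\<lambda>j. P.prob (S j)"] mass by simp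
    also have "\<dots> = (\<Sum>j<N. P.expectation (indicat_real (S j)))" by simp
    also have "\<dots> = P.expectation (\<lambda>x. \<Sum>j<N. indicat_real (S j) x)"
      by (rule Bochner_Integration.integral_sum[symmetric]) (auto simp: P.emeasure_eq_measure)
    also have "\<dots> \<le> P.expectation (\<lambda>x. 2)"
    proof (rule integral_mono)
      fix x assume "x \<in> space P"
      have "(\<Sum>j<N. indicat_real (S j) x) = real (card {j. j < N \<and> x \<in> S j})"
        by (simp add: indicator_def sum.If_cases Int_def lessThan_def)
      moreover have "card {j. j < N \<and> x \<in> S j} \<le> card {j. j < N \<and> 1 < (cos (\<theta> j) * ip p b x + sin (\<theta> j) * ip p c x)\<^sup>2 \<and>
          (cos (\<theta> j) * ip p b x + sin (\<theta> j) * ip p c x)\<^sup>2 \<le> 1 + a}"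
      proof (rule card_mono)
        have "ip p (u j) x = cos (\<theta> j) * ip p b x + sin (\<theta> j) * ip p c x" for j
          unfolding u_def ip_add_left ip_scale_left ..
        then show "{j. j < N \<and> x \<in> S j} \<subseteq> {j. j < N \<and> 1 < (cos (\<theta> j) * ip p b x + sin (\<theta> j) * ip p c x)\<^sup>2 \<and>
          (cos (\<theta> j) * ip p b x + sin (\<theta> j) * ip p c x)\<^sup>2 \<le> 1 + a}"
          using \<open>\<not> a \<le> \<alpha>\<^sub>0\<close> by (auto simp: S_def)
      qed simp
      moreover have "\<dots> \<le> 2" using few[of "ip p b x" "ip p c x"] unfolding \<theta>_def .
      ultimately show "(\<Sum>j<N. indicat_real (S j) x) \<le> 2" by linarith
    qed (auto simp: P.emeasure_eq_measure)
    also have "\<dots> = 2" by (simp add: P.prob_space)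
    finally show False using N by simp
  qed
  then show ?thesis using a by blast
qed

text \<open>
  The slope bound applies to t = a/2 < alpha0, where a is the constant of the preceding lemma, and the
  increment of a distribution function is at most 1.
\<close>

lemma marginal_slope_lower_bound:
  fixes \<tau> :: real
  assumes "0 < \<tau>"
  shows "\<exists>k>0. \<forall>p \<Gamma> P \<alpha>\<^sub>0 \<kappa>. spread_law \<tau> p \<Gamma> P \<alpha>\<^sub>0 \<kappa> \<longrightarrow> k \<le> \<kappa>"
proof -
  obtain a where a: "0 < a" and radius: "\<And>p \<Gamma> P \<alpha>\<^sub>0 \<kappa>. spread_law \<tau> p \<Gamma> P \<alpha>\<^sub>0 \<kappa> \<Longrightarrow> a \<le> \<alpha>\<^sub>0"
    using marginal_radius_lower_bound[OF assms] by blast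
  have "a\<^sup>2 / 4 \<le> \<kappa>" if law: "spread_law \<tau> p \<Gamma> P \<alpha>\<^sub>0 \<kappa>" for p \<Gamma> P \<alpha>\<^sub>0 \<kappa>
  proof -
    have p: "2 \<le> p" and P: "prob_space P" and \<Gamma>: "\<Gamma> \<in> carrier_mat p p" and \<kappa>: "0 < \<kappa>"
      and cond: "marginal_condition p \<Gamma> P \<tau> \<alpha>\<^sub>0 \<kappa>"
      using law unfolding spread_law_def by blast+
    interpret P: prob_space P by (rule P)
    have prob_diff: "\<bar>P.prob A - P.prob B\<bar> \<le> 1" for A B
      using P.prob_le_1[of A] P.prob_le_1[of B] measure_nonneg[of P A] measure_nonneg[of P B] by linarith
    have "a \<le> \<alpha>\<^sub>0" by (rule radius[OF law])
    have u: "0 < ip p (\<lambda>_. 1) (\<lambda>_. 1)" unfolding ip_self_pos using p by (intro exI[of _ 0]) auto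
    have "\<bar>a / 2\<bar> < \<alpha>\<^sub>0" "0 < \<bar>a / 2\<bar>" using a \<open>a \<le> \<alpha>\<^sub>0\<close> by auto
    from marginal_conditionD(2)[OF cond \<Gamma> u this(2,1)]
    have "\<kappa> powr (- 1 / 2) * \<bar>a / 2\<bar> \<le> 1"
      by (rule order_trans[OF _ prob_diff])
    then have "a / 2 \<le> sqrt \<kappa>" using a \<kappa> by (simp add: powr_minus powr_half_sqrt field_simps)
    then have "(a / 2)\<^sup>2 \<le> (sqrt \<kappa>)\<^sup>2" using a by (intro power_mono) auto
    then show ?thesis using \<kappa> by (simp add: power_divide)
  qed
  then show ?thesis using a by (intro exI[of _ "a\<^sup>2 / 4"]) auto
qed

section \<open>Spiked and sparse covariance matrices\<close>

lemma orthonormal_colsD: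
  assumes "V \<in> orthonormal_cols p r" "k < r" "l < r"
  shows "ip p (\<lambda>i. V $$ (i, k)) (\<lambda>i. V $$ (i, l)) = of_bool (k = l)"
proof -
  have V: "V \<in> carrier_mat p r" "transpose_mat V * V = 1\<^sub>m r" using assms(1) by (auto simp: orthonormal_cols_def)
  have "ip p (\<lambda>i. V $$ (i, k)) (\<lambda>i. V $$ (i, l)) = (transpose_mat V * V) $$ (k, l)"
    using V(1) assms(2,3) by (simp add: ip_def scalar_prod_def atLeast0LessThan)
  then show ?thesis using V(2) assms(2,3) by (simp add: of_bool_def)
qed

lemma orthonormal_cols_complete:
  assumes "W \<in> orthonormal_cols p p" "i < p" "j < p"
  shows "(\<Sum>k<p. W $$ (i, k) * W $$ (j, k)) = of_bool (i = j)"
proof -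
  have W: "W \<in> carrier_mat p p" "transpose_mat W * W = 1\<^sub>m p" using assms(1) by (auto simp: orthonormal_cols_def)
  then have WT: "W * transpose_mat W = 1\<^sub>m p" by (intro mat_mult_left_right_inverse[of "transpose_mat W" p W]) auto
  have "(\<Sum>k<p. W $$ (i, k) * W $$ (j, k)) = (W * transpose_mat W) $$ (i, j)"
    using W(1) assms(2,3) by (simp add: scalar_prod_def atLeast0LessThan)
  then show ?thesis using WT assms(2,3) by (simp add: of_bool_def)
qed

lemma spiked_cov_entries:
  assumes "spiked_cov p s lam M r V l \<Gamma>"
  shows "\<Gamma> \<in> carrier_mat p p"
    and "i < p \<Longrightarrow> j < p \<Longrightarrow> \<Gamma> $$ (i, j) = (\<Sum>k<r. l k * V $$ (i, k) * V $$ (j, k)) + of_bool (i = j)"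
proof -
  have V: "V \<in> carrier_mat p r" and \<Gamma>: "\<Gamma> = V * mat_diag r l * transpose_mat V + 1\<^sub>m p"
    using assms by (auto simp: spiked_cov_def orthonormal_cols_def)
  have VD: "V * mat_diag r l = Matrix.mat p r (\<lambda>(i, j). V $$ (i, j) * l j)"
    by (rule mat_diag_mult_right[OF V])
  show "\<Gamma> \<in> carrier_mat p p" unfolding \<Gamma> by simp
  show "\<Gamma> $$ (i, j) = (\<Sum>k<r. l k * V $$ (i, k) * V $$ (j, k)) + of_bool (i = j)" if "i < p" "j < p"
    unfolding \<Gamma> VD using that V
    by (simp add: scalar_prod_def atLeast0LessThan of_bool_def mult_ac)
qed

lemma spiked_cov_symmetric:
  assumes "spiked_cov p s lam M r V l \<Gamma>" "i < p" "j < p"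
  shows "\<Gamma> $$ (i, j) = \<Gamma> $$ (j, i)"
  using spiked_cov_entries(2)[OF assms(1)] assms(2,3) by (simp add: mult_ac of_bool_def)

lemma spiked_cov_quadratic_bounds:
  assumes \<Gamma>: "spiked_cov p s lam M r V l \<Gamma>" and lam: "0 < lam" "lam \<le> M"
  shows "ip p u u \<le> ip p u (mv p (entries \<Gamma>) u)"
    and "ip p u (mv p (entries \<Gamma>) u) \<le> (1 + M) * ip p u u"
proof -
  define b where "b = (\<lambda>k i. V $$ (i, k))"
  have V: "V \<in> orthonormal_cols p r" using \<Gamma> by (simp add: spiked_cov_def)
  have l: "lam \<le> l k" "l k \<le> M" if "k < r" for k using \<Gamma> that by (simp_all add: spiked_cov_def)
  have "ip p u (mv p (entries \<Gamma>) u) = (\<Sum>k<r. l k * ip p u (b k) * ip p (b k) u) + ip p u u"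
    by (rule ip_mv_spiked) (simp add: b_def spiked_cov_entries(2)[OF \<Gamma>])
  also have "(\<Sum>k<r. l k * ip p u (b k) * ip p (b k) u) = (\<Sum>k<r. l k * (ip p (b k) u)\<^sup>2)"
    by (intro sum.cong refl) (simp add: ip_commute[of p u] power2_eq_square)
  finally have eq: "ip p u (mv p (entries \<Gamma>) u) = (\<Sum>k<r. l k * (ip p (b k) u)\<^sup>2) + ip p u u" .
  have "0 \<le> l k * (ip p (b k) u)\<^sup>2 \<and> l k * (ip p (b k) u)\<^sup>2 \<le> M * (ip p (b k) u)\<^sup>2" if "k < r" for k
    using l[OF that] lam by (intro conjI mult_nonneg_nonneg mult_right_mono) auto
  then have "0 \<le> (\<Sum>k<r. l k * (ip p (b k) u)\<^sup>2)"
    and upper: "(\<Sum>k<r. l k * (ip p (b k) u)\<^sup>2) \<le> (\<Sum>k<r. M * (ip p (b k) u)\<^sup>2)"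
    by (auto intro!: sum_nonneg sum_mono)
  then show "ip p u u \<le> ip p u (mv p (entries \<Gamma>) u)" unfolding eq by linarith
  have "(\<Sum>k<r. (ip p (b k) u)\<^sup>2) \<le> ip p u u"
    unfolding b_def by (rule bessel) (rule orthonormal_colsD[OF V])
  then have "M * (\<Sum>k<r. (ip p (b k) u)\<^sup>2) \<le> M * ip p u u"
    using lam by (intro mult_left_mono) linarith+
  with upper show "ip p u (mv p (entries \<Gamma>) u) \<le> (1 + M) * ip p u u"
    unfolding eq distrib_right sum_distrib_left[symmetric] by linarith
qed

lemma sparse_covD:
  assumes "H \<in> sparse_cov p s"
  obtains S where "S \<subseteq> {..<p}" "card S \<le> s" "H \<in> carrier_mat p p"
    "\<And>i j. i < p \<Longrightarrow> j < p \<Longrightarrow> H $$ (i, j) = H $$ (j, i)"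
    "\<And>i j. i < p \<Longrightarrow> j < p \<Longrightarrow> i \<noteq> j \<Longrightarrow> i \<notin> S \<or> j \<notin> S \<Longrightarrow> H $$ (i, j) = 0"
proof -
  have H: "H \<in> carrier_mat p p" "transpose_mat H = H" using assms by (auto simp: sparse_cov_def psd_def)
  obtain S where S: "S \<subseteq> {..<p}" "card S \<le> s" "H - mat_diag p (\<lambda>i. H $$ (i, i)) \<in> supported_on p S"
    using assms by (auto simp: sparse_cov_def sparse_mats_def)
  have sym: "H $$ (i, j) = H $$ (j, i)" if "i < p" "j < p" for i j
    using H that by (metis carrier_matD index_transpose_mat(1))
  have off: "H $$ (i, j) = 0" if "i < p" "j < p" "i \<noteq> j" "i \<notin> S \<or> j \<notin> S" for i j
  proof -
    have "(H - mat_diag p (\<lambda>i. H $$ (i, i))) $$ (i, j) = 0"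
      using S(3) that unfolding supported_on_def by blast
    then show ?thesis using H(1) that by (simp add: mat_diag_def)
  qed
  show thesis using that[OF S(1,2) H(1) sym off] .
qed

lemma spiked_cov_in_sparse_cov:
  assumes \<Gamma>: "spiked_cov p s lam M r V l \<Gamma>" and lam: "0 < lam" "lam \<le> M"
  shows "\<Gamma> \<in> sparse_cov p s"
proof -
  note C = spiked_cov_entries(1)[OF \<Gamma>]
  have V: "V \<in> carrier_mat p r" and card: "card (row_support V) \<le> s"
    using \<Gamma> by (auto simp: spiked_cov_def orthonormal_cols_def)
  have sub: "row_support V \<subseteq> {..<p}" using V by (auto simp: row_support_def)
  have zero: "V $$ (i, k) = 0" if "i < p" "i \<notin> row_support V" "k < r" for i k
  proof -
    have "row V i = 0\<^sub>v r" using that V by (auto simp: row_support_def)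
    then have "row V i $ k = 0" using that(3) by simp
    then show ?thesis using that V by simp
  qed
  have "psd p \<Gamma>"
    unfolding psd_def
  proof (intro conjI ballI)
    show "transpose_mat \<Gamma> = \<Gamma>"
      using C spiked_cov_symmetric[OF \<Gamma>] by (intro eq_matI) auto
    fix v :: "real vec" assume v: "v \<in> carrier_vec p"
    have vv: "v = Matrix.vec p (\<lambda>i. v $ i)" using v by (intro eq_vecI) auto
    have "0 \<le> ip p (\<lambda>i. v $ i) (\<lambda>i. v $ i)" by (rule ip_self_nonneg)
    also have "\<dots> \<le> ip p (\<lambda>i. v $ i) (mv p (entries \<Gamma>) (\<lambda>i. v $ i))"
      by (rule spiked_cov_quadratic_bounds(1)[OF \<Gamma> lam])
    also have "\<dots> = v \<bullet> (\<Gamma> *\<^sub>v v)" using quadratic_form_vec[OF C, of "\<lambda>i. v $ i" "\<lambda>i. v $ i"] vv by simp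
    finally show "0 \<le> v \<bullet> (\<Gamma> *\<^sub>v v)" .
  qed (rule C)
  moreover have "\<Gamma> - mat_diag p (\<lambda>i. \<Gamma> $$ (i, i)) \<in> supported_on p (row_support V)"
    unfolding supported_on_def
  proof (intro CollectI conjI allI impI)
    show "\<Gamma> - mat_diag p (\<lambda>i. \<Gamma> $$ (i, i)) \<in> carrier_mat p p" by (rule minus_carrier_mat) (rule mat_diag_dim)
    fix i j assume ij: "i < p" "j < p" "i \<notin> row_support V \<or> j \<notin> row_support V"
    show "(\<Gamma> - mat_diag p (\<lambda>i. \<Gamma> $$ (i, i))) $$ (i, j) = 0"
    proof (cases "i = j")
      case False
      have "(\<Sum>k<r. l k * V $$ (i, k) * V $$ (j, k)) = 0" using ij zero by (intro sum.neutral) auto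
      then show ?thesis using ij C False spiked_cov_entries(2)[OF \<Gamma> ij(1,2)] by (simp add: mat_diag_def)
    qed (use ij C in \<open>simp add: mat_diag_def\<close>)
  qed
  ultimately show ?thesis unfolding sparse_cov_def sparse_mats_def using sub card by blast
qed

text \<open>
  Off a set T of k coordinates A is diagonal, so the quadratic form of x is that of its restriction to
  T plus a diagonal part. Each diagonal entry is the value of the form at a coordinate vector, which is
  itself k-sparse.
\<close>

lemma sparse_quadratic_bound_extends:
  fixes A :: "nat \<Rightarrow> nat \<Rightarrow> real"
  assumes S: "S \<subseteq> {..<p}" "card S \<le> k" and k: "0 < k" "k \<le> p"
    and off: "\<And>i j. i < p \<Longrightarrow> j < p \<Longrightarrow> i \<noteq> j \<Longrightarrow> i \<notin> S \<or> j \<notin> S \<Longrightarrow> A i j = 0"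
    and bound: "\<And>T u. T \<subseteq> {..<p} \<Longrightarrow> card T = k \<Longrightarrow> (\<And>i. i \<notin> T \<Longrightarrow> u i = 0) \<Longrightarrow> \<bar>ip p u (mv p A u)\<bar> \<le> b * ip p u u"
  shows "\<bar>ip p x (mv p A x)\<bar> \<le> b * ip p x x"
proof -
  have extend: "\<exists>T. S' \<subseteq> T \<and> T \<subseteq> {..<p} \<and> card T = k" if S': "S' \<subseteq> {..<p}" "card S' \<le> k" for S'
    using exists_subset_between[of S' k "{..<p}"] S' k by auto
  obtain T where T: "S \<subseteq> T" "T \<subseteq> {..<p}" "card T = k" using extend[OF S] by blast
  define y where "y = (\<lambda>i. if i \<in> T then x i else 0)"
  have diag: "\<bar>A i i\<bar> \<le> b" if i: "i < p" for i
  proof -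
    obtain T' where T': "{i} \<subseteq> T'" "T' \<subseteq> {..<p}" "card T' = k" using extend[of "{i}"] i k by auto
    define u :: "nat \<Rightarrow> real" where "u = (\<lambda>j. of_bool (i = j))"
    have Au: "mv p A u j = A j i" for j
      unfolding mv_def u_def using i by (intro sum_of_bool_mult) auto
    have ip_u: "ip p u f = f i" for f
    proof -
      have "ip p f u = f i" unfolding ip_def u_def using i by (intro sum_of_bool_mult) auto
      then show ?thesis by (simp add: ip_commute)
    qed
    show ?thesis using bound[OF T'(2,3), of u] T'(1) unfolding ip_u Au by (auto simp: u_def)
  qed
  have row: "(\<Sum>j<p. x i * A i j * x j) = (\<Sum>j<p. y i * A i j * y j) + (if i \<in> T then 0 else A i i * (x i)\<^sup>2)"
    if i: "i < p" for i
  proof (cases "i \<in> T")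
    case True
    have "x i * A i j * x j = y i * A i j * y j" if "j < p" for j
      using True off[OF i that] T(1) by (cases "j \<in> T") (auto simp: y_def)
    then have "(\<Sum>j<p. x i * A i j * x j) = (\<Sum>j<p. y i * A i j * y j)" by (intro sum.cong) auto
    then show ?thesis using True by simp
  next
    case False
    have "x i * A i j * x j = (A i j * (x i * x j)) * of_bool (i = j)" if "j < p" for j
      using off[OF i that] T(1) False by (cases "i = j") auto
    then have "(\<Sum>j<p. x i * A i j * x j) = (\<Sum>j<p. (A i j * (x i * x j)) * of_bool (i = j))" by (intro sum.cong) auto
    also have "\<dots> = A i i * (x i * x i)" using i by (intro sum_of_bool_mult) auto
    finally show ?thesis using False by (simp add: y_def power2_eq_square)
  qed
  have "ip p x (mv p A x) = ip p y (mv p A y) + (\<Sum>i<p. if i \<in> T then 0 else A i i * (x i)\<^sup>2)"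
    unfolding ip_mv sum.distrib[symmetric] by (intro sum.cong refl row) auto
  moreover have "\<bar>ip p y (mv p A y)\<bar> \<le> b * ip p y y" by (rule bound[OF T(2,3)]) (simp add: y_def)
  moreover have "\<bar>\<Sum>i<p. if i \<in> T then 0 else A i i * (x i)\<^sup>2\<bar> \<le> (\<Sum>i<p. if i \<in> T then 0 else b * (x i)\<^sup>2)"
    by (rule order_trans[OF sum_abs sum_mono]) (use diag in \<open>auto simp: abs_mult intro: mult_right_mono\<close>)
  moreover have "b * ip p y y + (\<Sum>i<p. if i \<in> T then 0 else b * (x i)\<^sup>2) = b * ip p x x"
    unfolding ip_def sum_distrib_left sum.distrib[symmetric]
    by (intro sum.cong refl) (auto simp: y_def power2_eq_square)
  ultimately show ?thesis by linarith
qed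

section \<open>Contaminated elliptical laws\<close>

text \<open>
  The mixture is a measure generated by its values, so countable additivity has to be checked before
  these values may be used.
\<close>

lemma contamination_properties:
  assumes P: "prob_space P" and Q: "prob_space Q" "sets Q = sets P" and e: "0 \<le> \<epsilon>" "\<epsilon> \<le> 1"
  shows "sets (contamination \<epsilon> P Q) = sets P" and "prob_space (contamination \<epsilon> P Q)"
    and "B \<in> sets P \<Longrightarrow> measure (contamination \<epsilon> P Q) B = (1 - \<epsilon>) * measure P B + \<epsilon> * measure Q B"
proof -
  interpret P: prob_space P by (rule P)
  interpret Q: prob_space Q by (rule Q(1))
  define f where "f = (\<lambda>B. ennreal (1 - \<epsilon>) * emeasure P B + ennreal \<epsilon> * emeasure Q B)"
  have def: "contamination \<epsilon> P Q = measure_of (space P) (sets P) f" by (simp add: contamination_def f_def)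
  show sets: "sets (contamination \<epsilon> P Q) = sets P"
    unfolding def by (simp add: sets.space_closed sets.sigma_sets_eq)
  have space: "space (contamination \<epsilon> P Q) = space P" by (rule sets_eq_imp_space_eq[OF sets])
  have em: "emeasure (contamination \<epsilon> P Q) B = f B" if "B \<in> sets P" for B
  proof (rule emeasure_measure_of[OF def sets.space_closed])
    show "B \<in> sets (contamination \<epsilon> P Q)" using that sets by simp
    show "positive (sets (contamination \<epsilon> P Q)) f" by (simp add: positive_def f_def)
    show "countably_additive (sets (contamination \<epsilon> P Q)) f"
      unfolding sets countably_additive_def
    proof (intro allI impI)
      fix A :: "nat \<Rightarrow> (nat \<Rightarrow> real) set"
      assume A: "range A \<subseteq> sets P" "disjoint_family A" "\<Union> (range A) \<in> sets P"
      have AQ: "range A \<subseteq> sets Q" using A(1) Q(2) by simp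
      have "(\<Sum>i. f (A i)) = (\<Sum>i. ennreal (1 - \<epsilon>) * emeasure P (A i)) + (\<Sum>i. ennreal \<epsilon> * emeasure Q (A i))"
        unfolding f_def by (rule suminf_add[symmetric]) auto
      also have "\<dots> = f (\<Union> (range A))"
        unfolding f_def ennreal_suminf_cmult suminf_emeasure[OF A(1,2)] suminf_emeasure[OF AQ A(2)] ..
      finally show "(\<Sum>i. f (A i)) = f (\<Union> (range A))" .
    qed
  qed
  have em': "emeasure (contamination \<epsilon> P Q) B = ennreal ((1 - \<epsilon>) * measure P B + \<epsilon> * measure Q B)" if "B \<in> sets P" for B
    unfolding em[OF that] f_def P.emeasure_eq_measure Q.emeasure_eq_measure using e by (simp add: ennreal_mult)
  show "prob_space (contamination \<epsilon> P Q)"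
  proof
    have "measure Q (space P) = 1" using Q.prob_space sets_eq_imp_space_eq[OF Q(2)] by simp
    then show "emeasure (contamination \<epsilon> P Q) (space (contamination \<epsilon> P Q)) = 1"
      unfolding space em'[OF sets.top] by (simp add: P.prob_space)
  qed
  show "measure (contamination \<epsilon> P Q) B = (1 - \<epsilon>) * measure P B + \<epsilon> * measure Q B" if "B \<in> sets P"
  proof -
    have "measure (contamination \<epsilon> P Q) B = enn2real (emeasure (contamination \<epsilon> P Q) B)" by (rule measure_def)
    also have "\<dots> = (1 - \<epsilon>) * measure P B + \<epsilon> * measure Q B"
      unfolding em'[OF that] using e by (intro enn2real_ennreal) auto
    finally show ?thesis .
  qed
qed

text \<open>
  The unit ball has positive finite volume because it lies between two cubes.
\<close>

lemma uniform_sphere_prob_space: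
  assumes d: "0 < d"
  shows "prob_space (uniform_sphere d)"
proof -
  define L where "L = (\<Pi>\<^sub>M i\<in>{..<d}. lborel :: real measure)"
  interpret product_sigma_finite "\<lambda>_ :: nat. lborel :: real measure" by standard
  define B where "B = {x \<in> space L. (\<Sum>i<d. (x i)\<^sup>2) \<le> 1}"
  have [measurable]: "(\<lambda>x. x i) \<in> borel_measurable L" if "i \<in> {..<d}" for i
  proof -
    have "(\<lambda>x. x i) \<in> measurable L lborel" unfolding L_def using that by (rule measurable_component_singleton)
    then show ?thesis by simp
  qed
  have B: "B \<in> sets L" unfolding B_def by measurable
  have box: "emeasure L (PiE {..<d} (\<lambda>_. {- c..c})) = ennreal ((2 * c) ^ d)" if "0 \<le> c" for c :: real
  proof -
    have "emeasure L (PiE {..<d} (\<lambda>_. {- c..c})) = (\<Prod>i<d. emeasure lborel {- c..c})"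
      unfolding L_def by (rule emeasure_PiM) auto
    also have "\<dots> = (\<Prod>i<d. ennreal (2 * c))" using that by simp
    also have "\<dots> = ennreal ((2 * c) ^ d)" using that by (simp add: ennreal_power)
    finally show ?thesis .
  qed
  have box_sets: "PiE {..<d} (\<lambda>_. {- c..c}) \<in> sets L" for c :: real unfolding L_def by (intro sets_PiM_I_finite) auto
  have "emeasure L (PiE {..<d} (\<lambda>_. {- (1 / real d)..1 / real d})) \<le> emeasure L B"
  proof (rule emeasure_mono[OF _ B], rule subsetI)
    fix x assume x: "x \<in> PiE {..<d} (\<lambda>_. {- (1 / real d)..1 / real d})"
    have "(x i)\<^sup>2 \<le> 1 / real d" if "i < d" for i
    proof -
      have "- (1 / real d) \<le> x i" "x i \<le> 1 / real d" using x that by (auto simp: PiE_iff)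
      then have "\<bar>x i\<bar> \<le> 1 / real d" by linarith
      then have "\<bar>x i\<bar>\<^sup>2 \<le> (1 / real d)\<^sup>2" by (intro power_mono) auto
      also have "\<dots> \<le> 1 / real d" using d by (simp add: power2_eq_square divide_simps)
      finally show ?thesis by simp
    qed
    then have "(\<Sum>i<d. (x i)\<^sup>2) \<le> (\<Sum>i<d. 1 / real d)" by (intro sum_mono) auto
    then show "x \<in> B" using x d by (auto simp: B_def L_def space_PiM PiE_iff)
  qed
  moreover have "0 < (2 * (1 / real d)) ^ d" using d by simp
  ultimately have pos: "emeasure L B \<noteq> 0" using box[of "1 / real d"] by (auto simp: zero_less_iff_neq_zero[symmetric] dest: order_less_le_trans)
  have "emeasure L B \<le> emeasure L (PiE {..<d} (\<lambda>_. {- 1..1}))"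
  proof (rule emeasure_mono[OF _ box_sets], rule subsetI)
    fix x assume x: "x \<in> B"
    have "\<bar>x i\<bar> \<le> 1" if "i < d" for i
    proof -
      have "(x i)\<^sup>2 \<le> (\<Sum>i<d. (x i)\<^sup>2)" using that by (intro member_le_sum) auto
      also have "\<dots> \<le> 1" using x by (simp add: B_def)
      finally show ?thesis by (simp add: abs_square_le_1)
    qed
    then show "x \<in> PiE {..<d} (\<lambda>_. {- 1..1})" using x by (auto simp: B_def L_def space_PiM PiE_iff abs_le_iff)
  qed
  then have fin: "emeasure L B \<noteq> \<infinity>" unfolding box[OF zero_le_one[where ?'a = real]] by (auto simp: top_unique)
  have "prob_space (uniform_measure L B)" by (rule prob_space_uniform_measure[OF pos fin])
  moreover have "(\<lambda>x. \<lambda>i\<in>{..<d}. x i / sqrt (\<Sum>j<d. (x j)\<^sup>2)) \<in> measurable (uniform_measure L B) (Rn d)"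
    unfolding measurable_cong_sets[OF sets_uniform_measure refl] by (intro measurable_restrict) measurable
  ultimately show ?thesis
    unfolding uniform_sphere_def L_def[symmetric] B_def[symmetric] by (rule prob_space.prob_space_distr)
qed

lemma elliptical_prob_space:
  assumes "elliptical p \<Sigma> \<nu> P"
  shows "prob_space P" and "sets P = sets (Rn p)"
proof -
  obtain d A where \<nu>: "prob_space \<nu>" "sets \<nu> = sets borel" and d: "0 < d" "A \<in> carrier_mat p d"
    and P: "P = distr (\<nu> \<Otimes>\<^sub>M uniform_sphere d) (Rn p) (\<lambda>(\<xi>, w). \<lambda>i\<in>{..<p}. \<xi> * (A *\<^sub>v Matrix.vec d w) $ i)"
    using assms unfolding elliptical_def by blast
  show "sets P = sets (Rn p)" by (simp add: P)
  interpret N: prob_space \<nu> by (rule \<nu>(1))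
  interpret U: prob_space "uniform_sphere d" by (rule uniform_sphere_prob_space[OF d(1)])
  interpret NU: pair_prob_space \<nu> "uniform_sphere d" ..
  have U_sets [measurable_cong]: "sets (uniform_sphere d) = sets (Rn d)" by (simp add: uniform_sphere_def)
  note \<nu>(2)[measurable_cong]
  have "(\<lambda>(\<xi>, w). \<lambda>i\<in>{..<p}. \<xi> * (\<Sum>j<d. A $$ (i, j) * w j)) \<in> measurable (\<nu> \<Otimes>\<^sub>M uniform_sphere d) (Rn p)"
    unfolding case_prod_beta by (intro measurable_restrict) measurable
  also have "(\<lambda>(\<xi>, w). \<lambda>i\<in>{..<p}. \<xi> * (\<Sum>j<d. A $$ (i, j) * w j))
      = (\<lambda>(\<xi>, w). \<lambda>i\<in>{..<p}. \<xi> * (A *\<^sub>v Matrix.vec d w) $ i)"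
    using d(2) by (auto intro!: ext simp: restrict_def scalar_prod_def atLeast0LessThan)
  finally show "prob_space P" unfolding P by (rule NU.prob_space_distr)
qed

section \<open>Slabs in sparse rational directions\<close>

text \<open>
  The weighted count of subsets with x = k/p.
\<close>

lemma ln_binomial_le:
  assumes "0 < k" "k \<le> p"
  shows "ln (real (p choose k)) \<le> real k * ln (exp 1 * real p / real k)"
proof -
  define x where "x = real k / real p"
  have x: "0 < x" "x \<le> 1" using assms by (auto simp: x_def)
  have b: "0 < p choose k" using assms(2) by (rule zero_less_binomial)
  have "p choose k \<le> card {B. B \<subseteq> {..<p} \<and> card B \<le> k}"
  proof -
    have "p choose k = card {B. B \<subseteq> {..<p} \<and> card B = k}" using n_subsets[of "{..<p}" k] by simp
    also have "\<dots> \<le> card {B. B \<subseteq> {..<p} \<and> card B \<le> k}" by (intro card_mono) auto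
    finally show ?thesis .
  qed
  then have "real (p choose k) * x ^ k \<le> real (card {B. B \<subseteq> {..<p} \<and> card B \<le> k}) * x ^ k"
    using x by (intro mult_right_mono) auto
  also have "\<dots> \<le> exp (x * real (card {..<p}))" by (rule weighted_card_subsets_le) (use x in auto)
  also have "x * real (card {..<p}) = real k" using assms by (simp add: x_def)
  finally have "ln (real (p choose k) * x ^ k) \<le> ln (exp (real k))"
    using b x by (subst ln_le_cancel_iff) auto
  then have "ln (real (p choose k)) \<le> real k - real k * ln x"
    using b x by (simp add: ln_mult ln_realpow)
  also have "\<dots> = real k * (1 - ln x)" by (simp add: algebra_simps)
  also have "1 - ln x = ln (exp 1 * real p / real k)"
    using assms by (simp add: x_def ln_mult ln_div)
  finally show ?thesis .
qed

lemma deviation_level_le: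
  fixes \<delta> :: real
  assumes "0 < s" "2 * s \<le> p" "0 < \<delta>" "\<delta> < 1"
  shows "real (2 * s + 1) + ln (real (p choose (2 * s)) / \<delta>) \<le> 5 * (real s * ln (exp 1 * real p / real s) + ln (1 / \<delta>))"
proof -
  define L where "L = ln (exp 1 * real p / real s)"
  have ps: "0 < real s" "real s \<le> real p" "0 < real p" using assms(1,2) by auto
  have L: "1 \<le> L" using ps by (simp add: L_def ln_mult ln_div)
  have "exp 1 * real p / real (2 * s) \<le> exp 1 * real p / real s"
    using ps by (intro divide_left_mono) auto
  then have "ln (exp 1 * real p / real (2 * s)) \<le> L"
    unfolding L_def using ps by (subst ln_le_cancel_iff) auto
  then have "real (2 * s) * ln (exp 1 * real p / real (2 * s)) \<le> real (2 * s) * L"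
    by (intro mult_left_mono) auto
  then have b: "ln (real (p choose (2 * s))) \<le> 2 * (real s * L)"
    using order_trans[OF ln_binomial_le[of "2 * s" p]] assms(1,2) by simp
  have pos: "0 < real (p choose (2 * s))" using zero_less_binomial[OF assms(2)] by simp
  have "real s * 1 \<le> real s * L" using L by (intro mult_left_mono) auto
  moreover have "real (2 * s + 1) \<le> 3 * real s" using assms(1) by simp
  moreover have "ln (real (p choose (2 * s)) / \<delta>) = ln (real (p choose (2 * s))) + ln (1 / \<delta>)"
    using pos assms(3) by (simp add: ln_div)
  moreover have "0 \<le> ln (1 / \<delta>)" using assms(3,4) by simp
  moreover have "a + c \<le> 5 * (e + d)" if "s' * 1 \<le> e" "a \<le> 3 * s'" "c = f + d" "0 \<le> d" "f \<le> 2 * e" for a c d e f s' :: real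
    using that by simp
  ultimately show ?thesis unfolding L_def[symmetric] using b by blast
qed

text \<open>
  Directions with rational coordinates supported in T: a countable family, so that the event that all
  its slabs have accurate frequencies is measurable, and dense enough to control all directions.
\<close>

definition rat_dirs :: "nat set \<Rightarrow> (nat \<Rightarrow> real) set" where
  "rat_dirs T = {u. (\<forall>i. i \<notin> T \<longrightarrow> u i = 0) \<and> (\<forall>i. u i \<in> \<rat>)}"

lemma countable_rat_dirs:
  assumes "finite T"
  shows "countable (rat_dirs T)"
proof (rule countable_subset)
  show "rat_dirs T \<subseteq> (\<lambda>f i. if i \<in> T then f i else 0) ` (PiE T (\<lambda>_. \<rat>))"
  proof
    fix u assume u: "u \<in> rat_dirs T"
    then have "u = (\<lambda>i. if i \<in> T then restrict u T i else 0)" by (auto simp: rat_dirs_def)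
    moreover have "restrict u T \<in> PiE T (\<lambda>_. \<rat>)" using u by (auto simp: rat_dirs_def)
    ultimately show "u \<in> (\<lambda>f i. if i \<in> T then f i else 0) ` (PiE T (\<lambda>_. \<rat>))" by blast
  qed
  show "countable ((\<lambda>f i. if i \<in> T then f i else 0 :: real) ` (PiE T (\<lambda>_. \<rat>)))"
    by (intro countable_image countable_PiE assms countable_rat)
qed

lemma rat_dirs_dense:
  assumes "\<And>i. i \<notin> T \<Longrightarrow> u i = 0"
  obtains v where "\<And>m. v m \<in> rat_dirs T" "\<And>i. (\<lambda>m. v m i) \<longlonglongrightarrow> u i"
proof -
  have "\<exists>q\<in>\<rat>. u i < q \<and> q < u i + 1 / real (Suc m)" for i m
    by (rule Rats_dense_in_real) simp
  then obtain q where q: "\<And>i m. q i m \<in> \<rat>" "\<And>i m. u i < q i m" "\<And>i m. q i m < u i + 1 / real (Suc m)"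
    by metis
  define v where "v = (\<lambda>m i. if i \<in> T then q i m else 0)"
  have "v m \<in> rat_dirs T" for m using q(1) by (auto simp: v_def rat_dirs_def)
  moreover have "(\<lambda>m. v m i) \<longlonglongrightarrow> u i" for i
  proof (cases "i \<in> T")
    case True
    have up: "(\<lambda>m. u i + 1 / real (Suc m)) \<longlonglongrightarrow> u i + 0"
      by (intro tendsto_add tendsto_const LIMSEQ_Suc[OF lim_1_over_n])
    have "(\<lambda>m. q i m) \<longlonglongrightarrow> u i"
    proof (rule tendsto_sandwich)
      show "\<forall>\<^sub>F m in sequentially. u i \<le> q i m" using q(2) by (intro always_eventually allI less_imp_le)
      show "\<forall>\<^sub>F m in sequentially. q i m \<le> u i + 1 / real (Suc m)" using q(3) by (intro always_eventually allI less_imp_le)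
      show "(\<lambda>m. u i + 1 / real (Suc m)) \<longlonglongrightarrow> u i" using up by simp
    qed (rule tendsto_const)
    then show ?thesis using True by (simp add: v_def)
  qed (simp add: v_def assms)
  ultimately show thesis by (rule that)
qed

lemma tendsto_ip:
  assumes "\<And>i. (\<lambda>m. v m i) \<longlonglongrightarrow> u i" "\<And>i. (\<lambda>m. w m i) \<longlonglongrightarrow> y i"
  shows "(\<lambda>m. ip p (v m) (w m)) \<longlonglongrightarrow> ip p u y"
  unfolding ip_def by (intro tendsto_sum tendsto_mult assms)

lemma tendsto_mv:
  assumes "\<And>i. (\<lambda>m. v m i) \<longlonglongrightarrow> u i"
  shows "(\<lambda>m. mv p A (v m) i) \<longlonglongrightarrow> mv p A u i"
  unfolding mv_def by (intro tendsto_sum tendsto_mult tendsto_const assms)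

text \<open>
  The level a is relative to the value of the quadratic form of A at u, which makes the slab invariant
  under rescaling of u.
\<close>

definition ellipsoid_slab :: "nat \<Rightarrow> (nat \<Rightarrow> nat \<Rightarrow> real) \<Rightarrow> real \<Rightarrow> (nat \<Rightarrow> real) \<Rightarrow> (nat \<Rightarrow> real) set" where
  "ellipsoid_slab p A a u = {y \<in> space (Rn p). (ip p u y)\<^sup>2 \<le> a * ip p u (mv p A u)}"

lemma ellipsoid_slab_sets [measurable]: "ellipsoid_slab p A a u \<in> sets (Rn p)"
  unfolding ellipsoid_slab_def by measurable

lemma vc_growth_ellipsoid_slabs:
  assumes T: "T \<subseteq> {..<p}"
  shows "vc_growth (card T + 1) {ellipsoid_slab p A a u | a u. a \<in> As \<and> u \<in> rat_dirs T}"
proof (rule vc_growth_slabs[of T _ "space (Rn p)"])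
  show "finite T" using T finite_subset by blast
  show "{ellipsoid_slab p A a u | a u. a \<in> As \<and> u \<in> rat_dirs T} \<subseteq> {slab T q c \<inter> space (Rn p) | q c. True}"
  proof
    fix B assume "B \<in> {ellipsoid_slab p A a u | a u. a \<in> As \<and> u \<in> rat_dirs T}"
    then obtain a u where B: "B = ellipsoid_slab p A a u" and u: "u \<in> rat_dirs T" by blast
    have ip: "ip p u y = (\<Sum>i\<in>T. u i * y i)" for y
      unfolding ip_def using T u by (intro sum.mono_neutral_right) (auto simp: rat_dirs_def)
    define Q where "Q = a * ip p u (mv p A u)"
    \<comment> \<open>a negative level gives the empty slab, here written with width -1\<close>
    have "w\<^sup>2 \<le> Q \<longleftrightarrow> \<bar>w\<bar> \<le> (if 0 \<le> Q then sqrt Q else - 1)" for w :: real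
    proof (cases "0 \<le> Q")
      case True
      have "\<bar>w\<bar> \<le> sqrt Q \<longleftrightarrow> sqrt (w\<^sup>2) \<le> sqrt Q" by simp
      then show ?thesis using True by (simp only: real_sqrt_le_iff if_True)
    next
      case False
      then have "\<not> w\<^sup>2 \<le> Q" using zero_le_power2[of w] by linarith
      then show ?thesis using False by simp
    qed
    then have "ellipsoid_slab p A a u = {y \<in> space (Rn p). \<bar>ip p u y\<bar> \<le> (if 0 \<le> Q then sqrt Q else - 1)}"
      unfolding ellipsoid_slab_def Q_def[symmetric] by simp
    then have "B = slab T u (if 0 \<le> Q then sqrt Q else - 1) \<inter> space (Rn p)"
      unfolding B ip slab_def by (simp only: Collect_conj_eq Collect_mem_eq Int_commute)
    then show "B \<in> {slab T q c \<inter> space (Rn p) | q c. True}" by blast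
  qed
qed

text \<open>
  The Vapnik-Chervonenkis inequality for each support T at confidence \<delta> / (p choose k), followed by a
  union bound.
\<close>

lemma uniform_slab_deviation:
  fixes R :: "(nat \<Rightarrow> real) measure" and \<delta> :: real
  assumes R: "prob_space R" "sets R = sets (Rn p)" and n: "1 \<le> n" and k: "k \<le> p" and As: "finite As"
    and \<delta>: "0 < \<delta>" "\<delta> < 1"
  defines "PP \<equiv> PiM {..<n} (\<lambda>_. R)"
    and "dev \<equiv> 200 * sqrt (real n * (real (k + 1) + ln (real (p choose k) / \<delta>)))"
  shows "\<exists>E\<in>sets PP. 1 - \<delta> \<le> measure PP E \<and> (\<forall>x\<in>E. \<forall>T a u. T \<subseteq> {..<p} \<longrightarrow> card T = k \<longrightarrow> a \<in> As \<longrightarrow> u \<in> rat_dirs T \<longrightarrow>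
    \<bar>(\<Sum>i<n. indicat_real (ellipsoid_slab p A a u) (x i)) - real n * measure R (ellipsoid_slab p A a u)\<bar> \<le> dev)"
proof -
  interpret PP: prob_space PP unfolding PP_def by (intro prob_space_PiM R)
  define C where "C = (\<lambda>T. {ellipsoid_slab p A a u | a u. a \<in> As \<and> u \<in> rat_dirs T})"
  define bad where "bad = (\<lambda>T. {x \<in> space PP. \<exists>B\<in>C T. dev < \<bar>(\<Sum>i<n. indicat_real B (x i)) - real n * measure R B\<bar>})"
  define TT where "TT = {T. T \<subseteq> {..<p} \<and> card T = k}"
  have TT: "finite TT" "card TT = p choose k"
    unfolding TT_def using n_subsets[of "{..<p}" k] by simp_all
  have "0 < p choose k" using k by (rule zero_less_binomial)
  then have N: "1 \<le> real (p choose k)" and N0: "0 < real (p choose k)" by linarith+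
  have cancel: "c * (\<delta> / c) = \<delta>" if "0 < c" for c using that by simp
  have C_sets: "C T \<subseteq> sets R" for T
  proof
    fix B assume "B \<in> C T"
    then obtain a u where "B = ellipsoid_slab p A a u" unfolding C_def by blast
    then show "B \<in> sets R" unfolding R(2) by (simp only: ellipsoid_slab_sets)
  qed
  have C_countable: "countable (C T)" if "T \<in> TT" for T
  proof -
    have "finite T" using that finite_subset unfolding TT_def by blast
    then have "countable (As \<times> rat_dirs T)"
      by (intro countable_SIGMA countable_finite[OF As] countable_rat_dirs)
    moreover have "C T \<subseteq> (\<lambda>(a, u). ellipsoid_slab p A a u) ` (As \<times> rat_dirs T)" unfolding C_def by fast
    ultimately show ?thesis by (meson countable_image countable_subset)
  qed
  have bad_sets: "bad T \<in> sets PP" if "T \<in> TT" for T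
    unfolding bad_def
  proof (rule sets_Collect_countable_Bex_in[OF C_countable[OF that]])
    fix B assume "B \<in> C T"
    then have [measurable]: "B \<in> sets R" using C_sets by blast
    have [measurable]: "(\<lambda>x. x i) \<in> measurable PP R" if "i \<in> {..<n}" for i unfolding PP_def using that by simp
    show "{x \<in> space PP. dev < \<bar>(\<Sum>i<n. indicat_real B (x i)) - real n * measure R B\<bar>} \<in> sets PP" by measurable
  qed
  have bad_prob: "measure PP (bad T) \<le> \<delta> / real (p choose k)" if T: "T \<in> TT" for T
  proof -
    have "vc_growth (k + 1) (C T)"
      using vc_growth_ellipsoid_slabs[of T p A As] T unfolding TT_def C_def by simp
    moreover have "0 < \<delta> / real (p choose k)" by (rule divide_pos_pos[OF \<delta>(1) N0])
    moreover have "\<delta> / real (p choose k) < 1"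
      unfolding divide_less_eq_1_pos[OF N0] using \<delta>(2) N by linarith
    moreover have "ln (1 / (\<delta> / real (p choose k))) = ln (real (p choose k) / \<delta>)" by simp
    ultimately show ?thesis
      using vc_inequality[OF R(1) C_countable[OF T] C_sets, of "k + 1" n "\<delta> / real (p choose k)"] n
      unfolding bad_def PP_def dev_def by simp
  qed
  define E where "E = space PP - (\<Union>T\<in>TT. bad T)"
  have Un: "(\<Union>T\<in>TT. bad T) \<in> sets PP" using TT(1) bad_sets by auto
  have "measure PP (\<Union>T\<in>TT. bad T) \<le> (\<Sum>T\<in>TT. measure PP (bad T))"
    by (rule PP.finite_measure_subadditive_finite) (use TT(1) bad_sets in auto)
  moreover have "(\<Sum>T\<in>TT. measure PP (bad T)) \<le> (\<Sum>T\<in>TT. \<delta> / real (p choose k))"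
    by (rule sum_mono[OF bad_prob])
  moreover have "(\<Sum>T\<in>TT. \<delta> / real (p choose k)) = \<delta>"
    unfolding sum_constant TT(2) by (rule cancel[OF N0])
  ultimately have "measure PP (\<Union>T\<in>TT. bad T) \<le> \<delta>" by linarith
  then have "1 - \<delta> \<le> measure PP E" unfolding E_def using PP.prob_compl[OF Un] by simp
  moreover have "E \<in> sets PP" unfolding E_def using Un by simp
  moreover have "\<bar>(\<Sum>i<n. indicat_real (ellipsoid_slab p A a u) (x i)) - real n * measure R (ellipsoid_slab p A a u)\<bar> \<le> dev"
    if "x \<in> E" "T \<subseteq> {..<p}" "card T = k" "a \<in> As" "u \<in> rat_dirs T" for x T a u
  proof (rule ccontr)
    assume "\<not> ?thesis"
    then have large: "dev < \<bar>(\<Sum>i<n. indicat_real (ellipsoid_slab p A a u) (x i)) - real n * measure R (ellipsoid_slab p A a u)\<bar>"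
      by (simp only: not_le)
    have "ellipsoid_slab p A a u \<in> C T" unfolding C_def using that(4,5) by blast
    then have "x \<in> bad T" unfolding bad_def using large that(1) unfolding E_def by blast
    moreover have "T \<in> TT" using that(2,3) by (simp add: TT_def)
    ultimately show False using that(1) unfolding E_def by blast
  qed
  ultimately show ?thesis by blast
qed

section \<open>Maximizers of the matrix depth\<close>

lemma matrix_depth_le:
  fixes x :: "nat \<Rightarrow> nat \<Rightarrow> real" and n p s :: nat
  assumes A: "A \<in> carrier_mat p p" and T: "T \<subseteq> {..<p}" "card T = 2 * s"
    and u: "\<And>i. i \<notin> T \<Longrightarrow> u i = 0" "0 < ip p u u"
  defines "D \<equiv> matrix_depth (sparse_dirs p s) n (\<lambda>i. Matrix.vec p (x i)) A"
    and "Q \<equiv> ip p u (mv p (entries A) u)"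
  shows "D \<le> 1 / real n * real (card {i. i < n \<and> (ip p u (x i))\<^sup>2 \<le> Q})"
    and "D \<le> 1 / real n * real (card {i. i < n \<and> Q \<le> (ip p u (x i))\<^sup>2})"
proof -
  define c where "c = 1 / sqrt (ip p u u)"
  have c: "0 < c" using u(2) by (simp add: c_def)
  define v where "v = Matrix.vec p (\<lambda>i. c * u i)"
  have "v \<in> dirs_on p T"
    unfolding dirs_on_def v_def c_def using unit_sphere_normalize[OF u(2)] u(1) by simp
  then have v: "v \<in> sparse_dirs p s" unfolding sparse_dirs_def using T by blast
  have Qv: "v \<bullet> (A *\<^sub>v v) = c\<^sup>2 * Q"
    unfolding v_def quadratic_form_vec[OF A] mv_scale ip_scale_left ip_scale_right Q_def by (simp add: power2_eq_square)
  have xv: "\<bar>v \<bullet> Matrix.vec p (x i)\<bar>\<^sup>2 = c\<^sup>2 * (ip p u (x i))\<^sup>2" for i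
    unfolding v_def scalar_prod_vec ip_scale_left by (simp add: power_mult_distrib)
  have "D \<le> min (1 / real n * real (card {i. i < n \<and> \<bar>v \<bullet> Matrix.vec p (x i)\<bar>\<^sup>2 \<le> v \<bullet> (A *\<^sub>v v)}))
     (1 / real n * real (card {i. i < n \<and> \<bar>v \<bullet> Matrix.vec p (x i)\<bar>\<^sup>2 \<ge> v \<bullet> (A *\<^sub>v v)}))"
    unfolding D_def matrix_depth_def by (rule cINF_lower[OF _ v]) (auto intro!: bdd_belowI2[of _ 0])
  then show "D \<le> 1 / real n * real (card {i. i < n \<and> (ip p u (x i))\<^sup>2 \<le> Q})"
    and "D \<le> 1 / real n * real (card {i. i < n \<and> Q \<le> (ip p u (x i))\<^sup>2})"
    unfolding Qv xv using c by (simp_all add: mult_le_cancel_left_pos)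
qed

lemma le_matrix_depth:
  fixes x :: "nat \<Rightarrow> nat \<Rightarrow> real"
  assumes A: "A \<in> carrier_mat p p" and s: "2 * s \<le> p" "0 < s"
    and bound: "\<And>T u. T \<subseteq> {..<p} \<Longrightarrow> card T = 2 * s \<Longrightarrow> (\<And>i. i \<notin> T \<Longrightarrow> u i = 0) \<Longrightarrow> 0 < ip p u u \<Longrightarrow>
      c \<le> 1 / real n * real (card {i. i < n \<and> (ip p u (x i))\<^sup>2 \<le> ip p u (mv p (entries A) u)}) \<and>
      c \<le> 1 / real n * real (card {i. i < n \<and> ip p u (mv p (entries A) u) \<le> (ip p u (x i))\<^sup>2})"
  shows "c \<le> matrix_depth (sparse_dirs p s) n (\<lambda>i. Matrix.vec p (x i)) A"
  unfolding matrix_depth_def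
proof (rule cINF_greatest)
  have "Matrix.unit_vec p 0 \<in> dirs_on p {..<2 * s}"
    using s by (auto simp: dirs_on_def unit_sphere_def)
  moreover have "{..<2 * s} \<subseteq> {..<p}" "card {..<2 * s} = 2 * s" using s by auto
  ultimately show "sparse_dirs p s \<noteq> {}" unfolding sparse_dirs_def by blast
next
  fix v assume "v \<in> sparse_dirs p s"
  then obtain T where T: "T \<subseteq> {..<p}" "card T = 2 * s" and v: "v \<in> carrier_vec p" "sqrt (v \<bullet> v) = 1" "\<And>i. i < p \<Longrightarrow> i \<notin> T \<Longrightarrow> v $ i = 0"
    unfolding sparse_dirs_def dirs_on_def unit_sphere_def by blast
  define u where "u = (\<lambda>i. if i < p then v $ i else 0)"
  have vu: "v = Matrix.vec p u" using v(1) by (intro eq_vecI) (auto simp: u_def)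
  have "u i = 0" if "i \<notin> T" for i using v(3)[of i] that by (simp add: u_def)
  moreover have "0 < ip p u u" using v(2) unfolding vu scalar_prod_vec by simp
  ultimately show "c \<le> min (1 / real n * real (card {i. i < n \<and> \<bar>v \<bullet> Matrix.vec p (x i)\<bar>\<^sup>2 \<le> v \<bullet> (A *\<^sub>v v)}))
     (1 / real n * real (card {i. i < n \<and> \<bar>v \<bullet> Matrix.vec p (x i)\<bar>\<^sup>2 \<ge> v \<bullet> (A *\<^sub>v v)}))"
    using bound[OF T, of u] unfolding vu quadratic_form_vec[OF A] scalar_prod_vec power2_abs by simp
qed

text \<open>
  The strict inequalities at the finitely many sample points persist in nearby directions; this is why
  the empirical depth, an infimum over uncountably many directions, is controlled by rational ones. No
  claim is made for points on the boundary of the slab, which count on both sides of the depth.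
\<close>

lemma nearby_rational_direction:
  fixes x :: "nat \<Rightarrow> nat \<Rightarrow> real"
  assumes u: "\<And>i. i \<notin> T \<Longrightarrow> u i = 0" "0 < ip p u u"
  obtains v where "v \<in> rat_dirs T" "0 < ip p v v"
    "\<And>i. i < n \<Longrightarrow> ip p u (mv p A u) < (ip p u (x i))\<^sup>2 \<Longrightarrow> ip p v (mv p A v) < (ip p v (x i))\<^sup>2"
    "\<And>i. i < n \<Longrightarrow> (ip p u (x i))\<^sup>2 < ip p u (mv p A u) \<Longrightarrow> (ip p v (x i))\<^sup>2 < ip p v (mv p A v)"
proof -
  obtain v where v: "\<And>m. v m \<in> rat_dirs T" "\<And>i. (\<lambda>m. v m i) \<longlonglongrightarrow> u i"
    using rat_dirs_dense[of T u] u(1) by blast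
  have lim_ip: "(\<lambda>m. ip p (v m) (v m)) \<longlonglongrightarrow> ip p u u" by (intro tendsto_ip v(2))
  have lim_gap: "(\<lambda>m. (ip p (v m) (x i))\<^sup>2 - ip p (v m) (mv p A (v m)))
      \<longlonglongrightarrow> (ip p u (x i))\<^sup>2 - ip p u (mv p A u)" for i
    by (intro tendsto_diff tendsto_power tendsto_ip tendsto_mv v(2) tendsto_const)
  define good where "good = (\<lambda>m i.
    (ip p u (mv p A u) < (ip p u (x i))\<^sup>2 \<longrightarrow> ip p (v m) (mv p A (v m)) < (ip p (v m) (x i))\<^sup>2) \<and>
    ((ip p u (x i))\<^sup>2 < ip p u (mv p A u) \<longrightarrow> (ip p (v m) (x i))\<^sup>2 < ip p (v m) (mv p A (v m))))"
  have "\<forall>\<^sub>F m in sequentially. good m i" for i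
  proof -
    consider "ip p u (mv p A u) < (ip p u (x i))\<^sup>2" | "(ip p u (x i))\<^sup>2 < ip p u (mv p A u)" | "(ip p u (x i))\<^sup>2 = ip p u (mv p A u)"
      by linarith
    then show ?thesis
    proof cases
      case 1
      then have "0 < (ip p u (x i))\<^sup>2 - ip p u (mv p A u)" by simp
      from order_tendstoD(1)[OF lim_gap this] show ?thesis by eventually_elim (use 1 in \<open>simp add: good_def\<close>)
    next
      case 2
      then have "(ip p u (x i))\<^sup>2 - ip p u (mv p A u) < 0" by simp
      from order_tendstoD(2)[OF lim_gap this] show ?thesis by eventually_elim (use 2 in \<open>simp add: good_def\<close>)
    qed (simp add: good_def)
  qed
  then have "\<forall>\<^sub>F m in sequentially. \<forall>i\<in>{..<n}. good m i" by (intro eventually_ball_finite) auto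
  with order_tendstoD(1)[OF lim_ip u(2)] have "\<forall>\<^sub>F m in sequentially. 0 < ip p (v m) (v m) \<and> (\<forall>i\<in>{..<n}. good m i)"
    by (rule eventually_conj)
  then obtain m where m: "0 < ip p (v m) (v m)" "\<forall>i\<in>{..<n}. good m i"
    using eventually_happens'[OF sequentially_bot] by blast
  show thesis by (rule that[of "v m"]) (use v(1) m in \<open>auto simp: good_def\<close>)
qed

lemma sum_indicator_eq_card:
  fixes n :: nat and x :: "nat \<Rightarrow> 'a"
  shows "(\<Sum>i<n. indicat_real B (x i)) = real (card {i. i < n \<and> x i \<in> B})"
proof -
  have "(\<Sum>i<n. indicat_real B (x i)) = (\<Sum>i\<in>{i. i < n \<and> x i \<in> B}. 1)"
    by (rule sum.mono_neutral_cong_right) auto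
  then show ?thesis by simp
qed

text \<open>
  The comparison of depths: \<Gamma> has depth at least (1 - \<epsilon>)/2 - \<eta>, hence so does H. If the quadratic form
  of H left the interval from (1 - t) to (1 + t) times that of \<Gamma> in some rational direction, one of the
  two counts in the depth of H would be at most the frequency of a slab (or of its complement) whose mass
  is smaller than 1/2 by the amount in the steepness hypothesis. Real directions follow by continuity.
\<close>

lemma depth_maximizer_quadratic_bound:
  fixes x :: "nat \<Rightarrow> nat \<Rightarrow> real" and P R :: "(nat \<Rightarrow> real) measure"
  assumes n: "1 \<le> n" and s: "2 * s \<le> p" "0 < s" and e: "0 \<le> \<epsilon>" "\<epsilon> \<le> 1"
    and P: "prob_space P" "sets P = sets (Rn p)" and R: "prob_space R" "sets R = sets (Rn p)"
    and mix: "\<And>B. B \<in> sets (Rn p) \<Longrightarrow> (1 - \<epsilon>) * measure P B \<le> measure R B \<and> measure R B \<le> (1 - \<epsilon>) * measure P B + \<epsilon>"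
    and \<Gamma>: "\<Gamma> \<in> carrier_mat p p" and H: "H \<in> carrier_mat p p"
    and x: "\<And>i. i < n \<Longrightarrow> x i \<in> space (Rn p)"
    and pos: "\<And>u. 0 < ip p u u \<Longrightarrow> 0 < ip p u (mv p (entries \<Gamma>) u)"
    and median: "\<And>u. 0 < ip p u u \<Longrightarrow> measure P (ellipsoid_slab p (entries \<Gamma>) 1 u) = 1 / 2"
    and t: "0 < t"
    and steep: "\<And>u a. 0 < ip p u u \<Longrightarrow> a \<in> {1 - t, 1 + t} \<Longrightarrow> 2 * \<epsilon> + 3 * \<eta> \<le>
      \<bar>measure P (ellipsoid_slab p (entries \<Gamma>) 1 u) - measure P (ellipsoid_slab p (entries \<Gamma>) a u)\<bar>"
    and \<eta>: "0 < \<eta>"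
    and dev: "\<And>T a u. T \<subseteq> {..<p} \<Longrightarrow> card T = 2 * s \<Longrightarrow> a \<in> {1, 1 - t, 1 + t} \<Longrightarrow> u \<in> rat_dirs T \<Longrightarrow>
      \<bar>(\<Sum>i<n. indicat_real (ellipsoid_slab p (entries \<Gamma>) a u) (x i))
        - real n * measure R (ellipsoid_slab p (entries \<Gamma>) a u)\<bar> \<le> real n * \<eta>"
    and opt: "matrix_depth (sparse_dirs p s) n (\<lambda>i. Matrix.vec p (x i)) \<Gamma>
      \<le> matrix_depth (sparse_dirs p s) n (\<lambda>i. Matrix.vec p (x i)) H"
    and T: "T \<subseteq> {..<p}" "card T = 2 * s" and u: "\<And>i. i \<notin> T \<Longrightarrow> u i = 0"
  shows "\<bar>ip p u (mv p (\<lambda>i j. H $$ (i, j) - \<Gamma> $$ (i, j)) u)\<bar> \<le> t * ip p u (mv p (entries \<Gamma>) u)"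
proof -
  interpret P: prob_space P by (rule P(1))
  define G where "G = (entries \<Gamma>)"
  define K where "K = (entries H)"
  define S where "S = ellipsoid_slab p G"
  define freq where "freq = (\<lambda>\<phi> :: (nat \<Rightarrow> real) \<Rightarrow> bool. 1 / real n * real (card {i. i < n \<and> \<phi> (x i)}))"
  have S_sets: "S a u \<in> sets (Rn p)" for a u unfolding S_def by (rule ellipsoid_slab_sets)
  have freq_mono: "freq \<phi> \<le> freq \<psi>" if "\<And>i. i < n \<Longrightarrow> \<phi> (x i) \<Longrightarrow> \<psi> (x i)" for \<phi> \<psi>
  proof -
    have "card {i. i < n \<and> \<phi> (x i)} \<le> card {i. i < n \<and> \<psi> (x i)}" using that by (intro card_mono) auto
    then show ?thesis unfolding freq_def by (intro mult_left_mono) auto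
  qed
  have freq_not: "freq (\<lambda>y. \<not> \<phi> y) = 1 - freq \<phi>" for \<phi>
  proof -
    have "{i. i < n \<and> \<not> \<phi> (x i)} = {..<n} - {i. i < n \<and> \<phi> (x i)}" by auto
    moreover have "card ({..<n} - {i. i < n \<and> \<phi> (x i)}) = n - card {i. i < n \<and> \<phi> (x i)}"
      by (subst card_Diff_subset) auto
    moreover have "card {i. i < n \<and> \<phi> (x i)} \<le> n" using card_mono[of "{..<n}" "{i. i < n \<and> \<phi> (x i)}"] by auto
    ultimately show ?thesis using n unfolding freq_def by (simp add: of_nat_diff field_simps)
  qed
  have freq_slab: "\<bar>freq (\<lambda>y. y \<in> S a v) - measure R (S a v)\<bar> \<le> \<eta>"
    if "T \<subseteq> {..<p}" "card T = 2 * s" "a \<in> {1, 1 - t, 1 + t}" "v \<in> rat_dirs T" for T a v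
  proof -
    have "freq (\<lambda>y. y \<in> S a v) - measure R (S a v)
        = 1 / real n * ((\<Sum>i<n. indicat_real (S a v) (x i)) - real n * measure R (S a v))"
      unfolding freq_def sum_indicator_eq_card using n by (simp add: right_diff_distrib)
    then have "\<bar>freq (\<lambda>y. y \<in> S a v) - measure R (S a v)\<bar>
        = 1 / real n * \<bar>(\<Sum>i<n. indicat_real (S a v) (x i)) - real n * measure R (S a v)\<bar>"
      by (simp add: abs_mult)
    also have "\<dots> \<le> 1 / real n * (real n * \<eta>)"
      using dev[OF that] unfolding S_def G_def by (intro mult_left_mono) auto
    finally show ?thesis using n by simp
  qed
  have mem_S: "x i \<in> S a v \<longleftrightarrow> (ip p v (x i))\<^sup>2 \<le> a * ip p v (mv p G v)" if "i < n" for i a v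
    using x[OF that] by (simp add: S_def ellipsoid_slab_def)
  have R_center: "(1 - \<epsilon>) / 2 \<le> measure R (S 1 v)" "measure R (S 1 v) \<le> (1 - \<epsilon>) / 2 + \<epsilon>" if "0 < ip p v v" for v
    using mix[OF S_sets[of 1 v]] median[OF that] unfolding S_def G_def by auto
  have "(1 - \<epsilon>) / 2 - \<eta> \<le> matrix_depth (sparse_dirs p s) n (\<lambda>i. Matrix.vec p (x i)) \<Gamma>"
  proof (rule le_matrix_depth[OF \<Gamma> s])
    fix T u assume T: "T \<subseteq> {..<p}" "card T = 2 * s" and u: "\<And>i. i \<notin> T \<Longrightarrow> u i = 0" "0 < ip p u u"
    obtain v where v: "v \<in> rat_dirs T" "0 < ip p v v"
      "\<And>i. i < n \<Longrightarrow> ip p u (mv p G u) < (ip p u (x i))\<^sup>2 \<Longrightarrow> ip p v (mv p G v) < (ip p v (x i))\<^sup>2"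
      "\<And>i. i < n \<Longrightarrow> (ip p u (x i))\<^sup>2 < ip p u (mv p G u) \<Longrightarrow> (ip p v (x i))\<^sup>2 < ip p v (mv p G v)"
      using nearby_rational_direction[of T u p n G x] u by blast
    have near: "\<bar>freq (\<lambda>y. y \<in> S 1 v) - measure R (S 1 v)\<bar> \<le> \<eta>" using freq_slab[OF T _ v(1)] by simp
    have "freq (\<lambda>y. y \<in> S 1 v) \<le> freq (\<lambda>y. (ip p u y)\<^sup>2 \<le> ip p u (mv p G u))"
    proof (rule freq_mono)
      fix i assume i: "i < n" "x i \<in> S 1 v"
      show "(ip p u (x i))\<^sup>2 \<le> ip p u (mv p G u)" using v(3)[OF i(1)] i(2) mem_S[OF i(1)] by force
    qed
    moreover have "1 - freq (\<lambda>y. y \<in> S 1 v) \<le> freq (\<lambda>y. ip p u (mv p G u) \<le> (ip p u y)\<^sup>2)"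
      unfolding freq_not[symmetric]
    proof (rule freq_mono)
      fix i assume i: "i < n" "x i \<notin> S 1 v"
      show "ip p u (mv p G u) \<le> (ip p u (x i))\<^sup>2" using v(4)[OF i(1)] i(2) mem_S[OF i(1)] by force
    qed
    ultimately show "(1 - \<epsilon>) / 2 - \<eta> \<le> 1 / real n * real (card {i. i < n \<and> (ip p u (x i))\<^sup>2 \<le> ip p u (mv p (entries \<Gamma>) u)}) \<and>
      (1 - \<epsilon>) / 2 - \<eta> \<le> 1 / real n * real (card {i. i < n \<and> ip p u (mv p (entries \<Gamma>) u) \<le> (ip p u (x i))\<^sup>2})"
      using near R_center[OF v(2)] unfolding freq_def G_def by argo
  qed
  with opt have depth: "(1 - \<epsilon>) / 2 - \<eta> \<le> matrix_depth (sparse_dirs p s) n (\<lambda>i. Matrix.vec p (x i)) H" by linarith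
  have rational: "\<bar>ip p v (mv p K v) - ip p v (mv p G v)\<bar> \<le> t * ip p v (mv p G v)" if v: "v \<in> rat_dirs T" for v
  proof (cases "0 < ip p v v")
    case False
    then have "\<forall>i<p. v i = 0" unfolding ip_self_pos by auto
    then show ?thesis by (simp add: ip_def)
  next
    case True
    have v0: "\<And>i. i \<notin> T \<Longrightarrow> v i = 0" using v by (simp add: rat_dirs_def)
    have Gv: "0 < ip p v (mv p G v)" using pos[OF True] by (simp add: G_def)
    have half: "measure P (S 1 v) = 1 / 2" using median[OF True] by (simp add: S_def G_def)
    have S_mono: "measure P (S a v) \<le> measure P (S b v)" if "a \<le> b" for a b
    proof (rule P.finite_measure_mono)
      have "a * ip p v (mv p G v) \<le> b * ip p v (mv p G v)" using that Gv by (intro mult_right_mono) auto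
      then show "S a v \<subseteq> S b v" by (auto simp: S_def ellipsoid_slab_def)
      show "S b v \<in> sets P" using S_sets P(2) by simp
    qed
    \<comment> \<open>removes the factor 1 - \<epsilon> in front of the loss of mass g, using that g is at most 1/2\<close>
    have g_le: "(1 - \<epsilon>) * g \<le> \<epsilon> + 2 * \<eta> \<Longrightarrow> g \<le> 1 / 2 \<Longrightarrow> g < 2 * \<epsilon> + 3 * \<eta>" for g
    proof -
      assume g: "(1 - \<epsilon>) * g \<le> \<epsilon> + 2 * \<eta>" "g \<le> 1 / 2"
      have "\<epsilon> * g \<le> \<epsilon> * (1 / 2)" using g(2) e by (intro mult_left_mono) auto
      then show "g < 2 * \<epsilon> + 3 * \<eta>" using g(1) \<eta> e by (simp add: algebra_simps)
    qed
    have upper: "ip p v (mv p K v) \<le> (1 + t) * ip p v (mv p G v)"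
    proof (rule ccontr)
      assume big: "\<not> ?thesis"
      have "(1 - \<epsilon>) / 2 - \<eta> \<le> freq (\<lambda>y. ip p v (mv p K v) \<le> (ip p v y)\<^sup>2)"
        using order_trans[OF depth matrix_depth_le(2)[OF H T v0 True]] unfolding freq_def K_def .
      also have "\<dots> \<le> freq (\<lambda>y. y \<notin> S (1 + t) v)"
        by (rule freq_mono) (use big mem_S in force)
      also have "\<dots> = 1 - freq (\<lambda>y. y \<in> S (1 + t) v)" by (rule freq_not)
      also have "\<dots> \<le> 1 - measure R (S (1 + t) v) + \<eta>"
        using freq_slab[OF T _ v, of "1 + t"] by (simp add: abs_le_iff)
      also have "\<dots> \<le> 1 - (1 - \<epsilon>) * measure P (S (1 + t) v) + \<eta>" using mix[OF S_sets[of "1 + t" v]] by simp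
      finally have "(1 - \<epsilon>) * (measure P (S (1 + t) v) - 1 / 2) \<le> \<epsilon> + 2 * \<eta>" by (simp add: algebra_simps add_divide_distrib diff_divide_distrib)
      moreover have "measure P (S (1 + t) v) - 1 / 2 \<le> 1 / 2" using P.prob_le_1 by simp
      ultimately have "measure P (S (1 + t) v) - 1 / 2 < 2 * \<epsilon> + 3 * \<eta>" by (rule g_le)
      moreover have "2 * \<epsilon> + 3 * \<eta> \<le> \<bar>measure P (S 1 v) - measure P (S (1 + t) v)\<bar>"
        using steep[OF True, of "1 + t"] by (simp add: S_def G_def)
      ultimately show False using half S_mono[of 1 "1 + t"] t by simp
    qed
    have lower: "(1 - t) * ip p v (mv p G v) \<le> ip p v (mv p K v)"
    proof (rule ccontr)
      assume small: "\<not> ?thesis"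
      have "(1 - \<epsilon>) / 2 - \<eta> \<le> freq (\<lambda>y. (ip p v y)\<^sup>2 \<le> ip p v (mv p K v))"
        using order_trans[OF depth matrix_depth_le(1)[OF H T v0 True]] unfolding freq_def K_def .
      also have "\<dots> \<le> freq (\<lambda>y. y \<in> S (1 - t) v)"
        by (rule freq_mono) (use small mem_S in force)
      also have "\<dots> \<le> measure R (S (1 - t) v) + \<eta>"
        using freq_slab[OF T _ v, of "1 - t"] by (simp add: abs_le_iff)
      also have "\<dots> \<le> (1 - \<epsilon>) * measure P (S (1 - t) v) + \<epsilon> + \<eta>" using mix[OF S_sets[of "1 - t" v]] by simp
      finally have "(1 - \<epsilon>) * (1 / 2 - measure P (S (1 - t) v)) \<le> \<epsilon> + 2 * \<eta>" by (simp add: algebra_simps add_divide_distrib diff_divide_distrib)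
      moreover have "1 / 2 - measure P (S (1 - t) v) \<le> 1 / 2" by simp
      ultimately have "1 / 2 - measure P (S (1 - t) v) < 2 * \<epsilon> + 3 * \<eta>" by (rule g_le)
      moreover have "2 * \<epsilon> + 3 * \<eta> \<le> \<bar>measure P (S 1 v) - measure P (S (1 - t) v)\<bar>"
        using steep[OF True, of "1 - t"] by (simp add: S_def G_def)
      ultimately show False using half S_mono[of "1 - t" 1] t by simp
    qed
    show ?thesis using upper lower by (simp add: abs_le_iff algebra_simps)
  qed
  obtain v where v: "\<And>m. v m \<in> rat_dirs T" "\<And>i. (\<lambda>m. v m i) \<longlonglongrightarrow> u i"
    using rat_dirs_dense[of T u] u by blast
  have "\<bar>ip p u (mv p K u) - ip p u (mv p G u)\<bar> \<le> t * ip p u (mv p G u)"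
  proof (rule LIMSEQ_le)
    show "(\<lambda>m. \<bar>ip p (v m) (mv p K (v m)) - ip p (v m) (mv p G (v m))\<bar>) \<longlonglongrightarrow> \<bar>ip p u (mv p K u) - ip p u (mv p G u)\<bar>"
      by (intro tendsto_rabs tendsto_diff tendsto_ip tendsto_mv v(2))
    show "(\<lambda>m. t * ip p (v m) (mv p G (v m))) \<longlonglongrightarrow> t * ip p u (mv p G u)"
      by (intro tendsto_mult tendsto_const tendsto_ip tendsto_mv v(2))
  qed (use rational v(1) in blast)
  moreover have "ip p u (mv p (\<lambda>i j. H $$ (i, j) - \<Gamma> $$ (i, j)) u) = ip p u (mv p K u) - ip p u (mv p G u)"
    unfolding ip_mv K_def G_def sum_subtractf[symmetric] by (simp add: algebra_simps)
  ultimately show ?thesis by (simp add: G_def)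
qed

section \<open>The error of the depth estimator\<close>

lemma ellipsoid_slab_eq_ratio:
  assumes "sets P = sets (Rn p)" "0 < ip p u (mv p A u)"
  shows "{x \<in> space P. (ip p u x)\<^sup>2 / ip p u (mv p A u) \<le> a} = ellipsoid_slab p A a u"
  unfolding ellipsoid_slab_def sets_eq_imp_space_eq[OF assms(1)] using assms(2) by (simp add: pos_divide_le_eq)

lemma frobenius_norm_projection_difference:
  assumes "A \<in> carrier_mat p r" "B \<in> carrier_mat p r"
  shows "(frobenius_norm (A * transpose_mat A - B * transpose_mat B))\<^sup>2
    = (\<Sum>i<p. \<Sum>j<p. ((\<Sum>k<r. A $$ (i, k) * A $$ (j, k)) - (\<Sum>k<r. B $$ (i, k) * B $$ (j, k)))\<^sup>2)"
proof -
  have "frobenius_norm (A * transpose_mat A - B * transpose_mat B)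
      = sqrt (\<Sum>i<p. \<Sum>j<p. ((\<Sum>k<r. A $$ (i, k) * A $$ (j, k)) - (\<Sum>k<r. B $$ (i, k) * B $$ (j, k)))\<^sup>2)"
    using assms unfolding frobenius_norm_def by (simp add: scalar_prod_def atLeast0LessThan)
  then show ?thesis by (simp add: sum_nonneg)
qed

text \<open>
  Translation of the perturbation bound to the matrices of the statement: the columns of the estimator
  are the first columns of a full eigenbasis.
\<close>

lemma leading_eigenvectors_perturbation:
  assumes \<Gamma>: "spiked_cov p s lam M r V l \<Gamma>" and lam: "0 < lam" and r: "0 < r"
    and H: "H \<in> carrier_mat p p" "\<And>i j. i < p \<Longrightarrow> j < p \<Longrightarrow> H $$ (i, j) = H $$ (j, i)"
    and lead: "leading_eigenvectors p r H V'"
    and close: "\<And>x. \<bar>ip p x (mv p (\<lambda>i j. H $$ (i, j) - \<Gamma> $$ (i, j)) x)\<bar> \<le> \<beta> * ip p x x"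
    and \<beta>: "0 < \<beta>" "\<beta> \<le> lam / 2"
  shows "(frobenius_norm (V' * transpose_mat V' - V * transpose_mat V))\<^sup>2 \<le> 8 * real r * \<beta>\<^sup>2 / lam\<^sup>2"
proof -
  have V: "V \<in> orthonormal_cols p r" "V \<in> carrier_mat p r" and l: "\<And>k. k < r \<Longrightarrow> lam \<le> l k"
    using \<Gamma> unfolding spiked_cov_def orthonormal_cols_def by simp_all
  obtain W \<mu> where rp: "r \<le> p" and V': "V' \<in> carrier_mat p r" and W: "W \<in> orthonormal_cols p p"
    and eig: "\<And>i. i < p \<Longrightarrow> eigenvector H (col W i) (\<mu> i)" and mono: "\<And>i j. i \<le> j \<Longrightarrow> j < p \<Longrightarrow> \<mu> j \<le> \<mu> i"
    and cols: "\<And>k. k < r \<Longrightarrow> col V' k = col W k"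
    using lead unfolding leading_eigenvectors_def orthonormal_cols_def by blast
  have Wc: "W \<in> carrier_mat p p" using W by (simp add: orthonormal_cols_def)
  have V'W: "V' $$ (i, k) = W $$ (i, k)" if "i < p" "k < r" for i k
  proof -
    have "col V' k $ i = col W k $ i" by (simp only: cols[OF that(2)])
    then show ?thesis using that V' Wc rp by simp
  qed
  have eig_apply: "mv p (entries H) (\<lambda>i. W $$ (i, k)) i = \<mu> k * W $$ (i, k)" if "k < p" "i < p" for k i
  proof -
    have "(H *\<^sub>v col W k) $ i = (\<mu> k \<cdot>\<^sub>v col W k) $ i" using eig[OF that(1)] by (simp add: eigenvector_def)
    then show ?thesis using that H(1) Wc by (simp add: mv_def scalar_prod_def atLeast0LessThan)
  qed
  have "(\<Sum>i<p. \<Sum>j<p. ((\<Sum>k<r. W $$ (i, k) * W $$ (j, k)) - (\<Sum>k<r. V $$ (i, k) * V $$ (j, k)))\<^sup>2)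
      \<le> 8 * real r * \<beta>\<^sup>2 / lam\<^sup>2"
    by (rule eigenspace_perturbation[where b = "\<lambda>k i. V $$ (i, k)" and w = "\<lambda>k i. W $$ (i, k)" and d = l
          and H = "\<lambda>i j. H $$ (i, j)" and G = "\<lambda>i j. \<Gamma> $$ (i, j)",
          OF r rp orthonormal_colsD[OF V(1)] orthonormal_colsD[OF W] orthonormal_cols_complete[OF W] eig_apply mono H(2)
            spiked_cov_entries(2)[OF \<Gamma>] l lam close \<beta>])
  moreover have "(\<Sum>i<p. \<Sum>j<p. ((\<Sum>k<r. V' $$ (i, k) * V' $$ (j, k)) - (\<Sum>k<r. V $$ (i, k) * V $$ (j, k)))\<^sup>2)
     = (\<Sum>i<p. \<Sum>j<p. ((\<Sum>k<r. W $$ (i, k) * W $$ (j, k)) - (\<Sum>k<r. V $$ (i, k) * V $$ (j, k)))\<^sup>2)"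
    by (intro sum.cong refl) (simp add: V'W)
  ultimately show ?thesis unfolding frobenius_norm_projection_difference[OF V' V(2)] by simp
qed

text \<open>
  All constants are collected here. With \<omega> = 2 \<epsilon> + 3 \<eta> the relative error of the quadratic form is
  t = sqrt \<kappa> * \<omega>, the absolute one \<beta> = (1 + M) * t, and \<kappa> * \<omega>^2 <= c0 * EB * lam^2; here
  c0 exceeds 8 + 18 * 200000, which comes from \<omega>^2 <= 8 \<epsilon>^2 + 18 \<eta>^2 and from 200000 = 5 * 200^2. The two smallness
  conditions say that \<beta> is at most half the spectral gap and that \<omega> < \<tau>; the second one uses the lower
  bound for \<kappa>.
\<close>

lemma depth_estimator_error_bound:
  fixes M \<tau> k\<^sub>0 C\<^sub>2 lam \<alpha>\<^sub>0 \<kappa> \<epsilon> \<delta> :: real and n p s r :: nat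
    and \<Gamma>_hat V_hat :: "(nat \<Rightarrow> nat \<Rightarrow> real) \<Rightarrow> real mat"
  defines "c\<^sub>0 \<equiv> 4000000" and "EB \<equiv> error_bound n p s lam \<kappa> \<epsilon> \<delta>"
  assumes M: "0 < M" and \<tau>: "0 < \<tau>" and k0: "0 < k\<^sub>0" "k\<^sub>0 \<le> \<kappa>"
    and n: "0 < n" and s: "0 < s" "2 * s \<le> p" and r: "0 < r" "real r \<le> C\<^sub>2"
    and lam: "0 < lam" "lam \<le> M" and \<epsilon>: "0 \<le> \<epsilon>" "\<epsilon> \<le> 1" and \<delta>: "0 < \<delta>" "\<delta> < 1 / 2"
    and est: "\<And>x. x \<in> space (\<Pi>\<^sub>M i\<in>{..<n}. Rn p) \<Longrightarrow>
           is_arg_max (matrix_depth (sparse_dirs p s) n (\<lambda>i. Matrix.vec p (x i)))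
             (\<lambda>\<Gamma>. \<Gamma> \<in> sparse_cov p s) (\<Gamma>_hat x) \<and> leading_eigenvectors p r (\<Gamma>_hat x) (V_hat x)"
    and small1: "4 * (1 + M)\<^sup>2 * c\<^sub>0 * EB \<le> 1" and small2: "2 * c\<^sub>0 * M\<^sup>2 / (k\<^sub>0 * \<tau>\<^sup>2) * EB \<le> 1"
    and Q: "prob_space Q" "sets Q = sets (Rn p)"
    and \<Gamma>: "spiked_cov p s lam M r V l \<Gamma>" and P: "canonical_elliptical p \<Gamma> \<nu> P"
    and cond: "marginal_condition p \<Gamma> P \<tau> \<alpha>\<^sub>0 \<kappa>"
  defines "PP \<equiv> PiM {..<n} (\<lambda>_. contamination \<epsilon> P Q)"
  shows "\<exists>E\<in>sets PP. E \<subseteq> {x \<in> space PP.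
      (frobenius_norm (V_hat x * transpose_mat (V_hat x) - V * transpose_mat V))\<^sup>2 \<le> 8 * C\<^sub>2 * (1 + M)\<^sup>2 * c\<^sub>0 * EB} \<and>
    1 - 2 * \<delta> \<le> measure PP E"
proof -
  define R where "R = contamination \<epsilon> P Q"
  define G where "G = (entries \<Gamma>)"
  have ell: "elliptical p \<Gamma> \<nu> P" and center: "\<And>u. u \<in> unit_sphere p \<Longrightarrow> marginal_cdf p \<Gamma> P u 1 = 1 / 2"
    using P unfolding canonical_elliptical_def by blast+
  note P_prob = elliptical_prob_space[OF ell]
  interpret P: prob_space P by (rule P_prob(1))
  interpret Q: prob_space Q by (rule Q(1))
  have QP: "sets Q = sets P" using Q(2) P_prob(2) by simp
  note mixture = contamination_properties[OF P_prob(1) Q(1) QP \<epsilon>, folded R_def]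
  have R_sets: "sets R = sets (Rn p)" using mixture(1) P_prob(2) by simp
  note \<Gamma>_carrier = spiked_cov_entries(1)[OF \<Gamma>]
  have \<kappa>: "0 < \<kappa>" using k0 by linarith
  have G_lower: "ip p u u \<le> ip p u (mv p G u)" and G_upper: "ip p u (mv p G u) \<le> (1 + M) * ip p u u" for u
    using spiked_cov_quadratic_bounds[OF \<Gamma> lam, of u] unfolding G_def by blast+
  have G_pos: "0 < ip p u (mv p G u)" if "0 < ip p u u" for u using G_lower[of u] that by linarith
  define \<eta> where "\<eta> = 200 * sqrt (real n * (real (2 * s + 1) + ln (real (p choose (2 * s)) / \<delta>))) / real n"
  define \<omega> where "\<omega> = 2 * \<epsilon> + 3 * \<eta>"
  define t where "t = sqrt \<kappa> * \<omega>"
  define \<beta> where "\<beta> = (1 + M) * t"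
  define L where "L = real s * ln (exp 1 * real p / real s)"
  define l\<delta> where "l\<delta> = ln (1 / \<delta>)"
  define B where "B = real (2 * s + 1) + ln (real (p choose (2 * s)) / \<delta>)"
  have B: "1 \<le> B" "B \<le> 5 * (L + l\<delta>)"
  proof -
    have "1 \<le> real (p choose (2 * s))" using zero_less_binomial[OF s(2)] by linarith
    then have "1 \<le> real (p choose (2 * s)) / \<delta>" using \<delta> by (simp add: pos_le_divide_eq)
    then have "0 \<le> ln (real (p choose (2 * s)) / \<delta>)" by (rule ln_ge_zero)
    then show "1 \<le> B" unfolding B_def by simp
    show "B \<le> 5 * (L + l\<delta>)" unfolding B_def L_def l\<delta>_def using deviation_level_le[OF s \<delta>(1)] \<delta>(2) by simp
  qed
  have \<eta>: "0 < \<eta>" unfolding \<eta>_def B_def[symmetric] using B n by simp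
  have \<eta>2: "\<eta>\<^sup>2 = 40000 * B / real n"
    unfolding \<eta>_def B_def[symmetric] using B n by (simp add: power_divide power_mult_distrib) (simp add: power2_eq_square)
  have EB: "EB = \<kappa> * (max (L / (real n * lam\<^sup>2)) (\<epsilon>\<^sup>2 / lam\<^sup>2) + l\<delta> / (real n * lam\<^sup>2))"
    unfolding EB_def error_bound_def L_def l\<delta>_def ..
  have l\<delta>: "0 \<le> l\<delta>" unfolding l\<delta>_def using \<delta> by simp
  have \<omega>_bound: "\<kappa> * \<omega>\<^sup>2 \<le> c\<^sub>0 * EB * lam\<^sup>2"
  proof -
    have l2: "0 < lam\<^sup>2" using lam by simp
    have EB1: "\<kappa> * ((L + l\<delta>) / real n) \<le> EB * lam\<^sup>2"
    proof -
      have "(L + l\<delta>) / real n = (L / (real n * lam\<^sup>2) + l\<delta> / (real n * lam\<^sup>2)) * lam\<^sup>2"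
        using n l2 by (simp add: add_divide_distrib[symmetric])
      also have "\<dots> \<le> (max (L / (real n * lam\<^sup>2)) (\<epsilon>\<^sup>2 / lam\<^sup>2) + l\<delta> / (real n * lam\<^sup>2)) * lam\<^sup>2"
        using l2 by (intro mult_right_mono add_right_mono) auto
      finally show ?thesis unfolding EB mult.assoc using \<kappa> by (intro mult_left_mono) auto
    qed
    have EB2: "\<kappa> * \<epsilon>\<^sup>2 \<le> EB * lam\<^sup>2"
    proof -
      have "\<epsilon>\<^sup>2 = \<epsilon>\<^sup>2 / lam\<^sup>2 * lam\<^sup>2" using l2 by simp
      also have "\<dots> \<le> (max (L / (real n * lam\<^sup>2)) (\<epsilon>\<^sup>2 / lam\<^sup>2) + l\<delta> / (real n * lam\<^sup>2)) * lam\<^sup>2"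
      proof (rule mult_right_mono)
        have "0 \<le> l\<delta> / (real n * lam\<^sup>2)" using l\<delta> by simp
        then show "\<epsilon>\<^sup>2 / lam\<^sup>2 \<le> max (L / (real n * lam\<^sup>2)) (\<epsilon>\<^sup>2 / lam\<^sup>2) + l\<delta> / (real n * lam\<^sup>2)" by linarith
      qed simp
      finally show ?thesis unfolding EB mult.assoc using \<kappa> by (intro mult_left_mono) auto
    qed
    have "\<eta>\<^sup>2 \<le> 200000 * ((L + l\<delta>) / real n)"
      unfolding \<eta>2 using B(2) n by (simp add: divide_right_mono)
    then have "\<kappa> * \<eta>\<^sup>2 \<le> \<kappa> * (200000 * ((L + l\<delta>) / real n))" using \<kappa> by (intro mult_left_mono) auto
    also have "\<dots> = 200000 * (\<kappa> * ((L + l\<delta>) / real n))" by (rule mult.left_commute)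
    also have "\<dots> \<le> 200000 * (EB * lam\<^sup>2)" using EB1 by (rule mult_left_mono) simp
    finally have e: "\<kappa> * \<eta>\<^sup>2 \<le> 200000 * (EB * lam\<^sup>2)" .
    have "\<omega>\<^sup>2 \<le> 8 * \<epsilon>\<^sup>2 + 18 * \<eta>\<^sup>2"
    proof -
      have "0 \<le> (2 * \<epsilon> - 3 * \<eta>)\<^sup>2" by simp
      then show ?thesis unfolding \<omega>_def power2_eq_square by (simp add: algebra_simps)
    qed
    then have "\<kappa> * \<omega>\<^sup>2 \<le> \<kappa> * (8 * \<epsilon>\<^sup>2 + 18 * \<eta>\<^sup>2)" using \<kappa> by (intro mult_left_mono) auto
    also have "\<dots> = 8 * (\<kappa> * \<epsilon>\<^sup>2) + 18 * (\<kappa> * \<eta>\<^sup>2)" by (simp add: algebra_simps)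
    also have "\<dots> \<le> 4000000 * (EB * lam\<^sup>2)"
    proof -
      have "0 \<le> \<kappa> * \<epsilon>\<^sup>2" using \<kappa> by simp
      then show ?thesis using EB2 e by linarith
    qed
    finally show ?thesis by (simp add: c\<^sub>0_def)
  qed
  have \<omega>: "0 < \<omega>" using \<eta> \<epsilon> by (simp add: \<omega>_def)
  have t: "0 < t" using \<omega> \<kappa> by (simp add: t_def)
  have \<beta>: "0 < \<beta>" using t M by (simp add: \<beta>_def)
  have \<beta>2: "\<beta>\<^sup>2 \<le> (1 + M)\<^sup>2 * c\<^sub>0 * EB * lam\<^sup>2"
  proof -
    have "\<beta>\<^sup>2 = (1 + M)\<^sup>2 * (\<kappa> * \<omega>\<^sup>2)" using \<kappa> by (simp add: \<beta>_def t_def power_mult_distrib)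
    also have "\<dots> \<le> (1 + M)\<^sup>2 * (c\<^sub>0 * EB * lam\<^sup>2)" by (intro mult_left_mono \<omega>_bound) auto
    finally show ?thesis by (simp add: mult.assoc)
  qed
  have \<beta>_half: "\<beta> \<le> lam / 2"
  proof -
    have "4 * \<beta>\<^sup>2 \<le> (4 * (1 + M)\<^sup>2 * c\<^sub>0 * EB) * lam\<^sup>2" using \<beta>2 by simp
    also have "\<dots> \<le> 1 * lam\<^sup>2" using small1 by (intro mult_right_mono) auto
    finally have "(2 * \<beta>)\<^sup>2 \<le> lam\<^sup>2" by (simp add: power_mult_distrib)
    then have "2 * \<beta> \<le> lam" by (rule power2_le_imp_le) (use lam in simp)
    then show ?thesis by simp
  qed
  have \<omega>_\<tau>: "\<omega> < \<tau>"
  proof -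
    have EB0: "0 \<le> EB"
    proof -
      have "0 \<le> c\<^sub>0 * EB * lam\<^sup>2" using \<omega>_bound \<kappa> by (intro order_trans[OF _ \<omega>_bound]) auto
      then show ?thesis using lam by (simp add: c\<^sub>0_def zero_le_mult_iff)
    qed
    have "k\<^sub>0 * \<omega>\<^sup>2 \<le> \<kappa> * \<omega>\<^sup>2" using k0 by (intro mult_right_mono) auto
    also note \<omega>_bound
    also have "c\<^sub>0 * EB * lam\<^sup>2 \<le> c\<^sub>0 * EB * M\<^sup>2"
      using lam EB0 by (intro mult_left_mono power_mono) (auto simp: c\<^sub>0_def)
    finally have le: "k\<^sub>0 * \<omega>\<^sup>2 \<le> c\<^sub>0 * EB * M\<^sup>2" .
    have "2 * (c\<^sub>0 * EB * M\<^sup>2) \<le> k\<^sub>0 * \<tau>\<^sup>2"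
      using small2 k0(1) \<tau> by (simp add: pos_divide_le_eq mult_ac)
    with le have "k\<^sub>0 * (2 * \<omega>\<^sup>2) \<le> k\<^sub>0 * \<tau>\<^sup>2" by simp
    then have "2 * \<omega>\<^sup>2 \<le> \<tau>\<^sup>2" using k0(1) by simp
    moreover have "0 < \<omega>\<^sup>2" using \<omega> by simp
    ultimately have "\<omega>\<^sup>2 < \<tau>\<^sup>2" by linarith
    then show ?thesis by (rule power2_less_imp_less) (use \<tau> in simp)
  qed
  have ratio: "{x \<in> space P. (ip p u x)\<^sup>2 / ip p u (mv p G u) \<le> a} = ellipsoid_slab p G a u" if "0 < ip p u u" for u a
    by (rule ellipsoid_slab_eq_ratio[OF P_prob(2) G_pos[OF that]])
  have median: "measure P (ellipsoid_slab p G 1 u) = 1 / 2" if "0 < ip p u u" for u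
  proof -
    have "marginal_cdf p \<Gamma> P (Matrix.vec p (\<lambda>i. (1 / sqrt (ip p u u)) * u i)) 1 = 1 / 2"
      by (rule center[OF unit_sphere_normalize[OF that]])
    then show ?thesis unfolding marginal_cdf_normalize[OF \<Gamma>_carrier that] G_def[symmetric] ratio[OF that] .
  qed
  have steep: "\<omega> \<le> \<bar>measure P (ellipsoid_slab p G 1 u) - measure P (ellipsoid_slab p G a u)\<bar>"
    if u: "0 < ip p u u" and a: "a \<in> {1 - t, 1 + t}" for u a
  proof -
    obtain h where h: "a = 1 + h" "\<bar>h\<bar> = t" using a t by (auto intro: that[of t] that[of "- t"])
    note D = marginal_conditionD[OF cond \<Gamma>_carrier u, of h, folded G_def, unfolded ratio[OF u]]
    show ?thesis
    proof (cases "\<alpha>\<^sub>0 \<le> \<bar>h\<bar>")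
      case True
      from D(1)[OF this] show ?thesis using \<omega>_\<tau> h(1) by simp
    next
      case False
      have "\<kappa> powr (- 1 / 2) * \<bar>h\<bar> = \<omega>"
        using \<kappa> unfolding h(2) t_def by (simp add: powr_minus powr_half_sqrt)
      then show ?thesis using D(2) False h t by simp
    qed
  qed
  have n_\<eta>: "real n * \<eta> = 200 * sqrt (real n * (real (2 * s + 1) + ln (real (p choose (2 * s)) / \<delta>)))"
    using n by (simp add: \<eta>_def)
  have "\<exists>E\<in>sets (PiM {..<n} (\<lambda>_. R)). 1 - \<delta> \<le> measure (PiM {..<n} (\<lambda>_. R)) E \<and> (\<forall>x\<in>E. \<forall>T a u. T \<subseteq> {..<p} \<longrightarrow> card T = 2 * s \<longrightarrow> a \<in> {1, 1 - t, 1 + t} \<longrightarrow> u \<in> rat_dirs T \<longrightarrow>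
    \<bar>(\<Sum>i<n. indicat_real (ellipsoid_slab p G a u) (x i)) - real n * measure R (ellipsoid_slab p G a u)\<bar>
      \<le> 200 * sqrt (real n * (real (2 * s + 1) + ln (real (p choose (2 * s)) / \<delta>))))"
    by (rule uniform_slab_deviation[OF mixture(2) R_sets]) (use n s \<delta> in auto)
  then obtain E where E: "E \<in> sets PP" "1 - \<delta> \<le> measure PP E"
    and dev: "\<And>x T a u. x \<in> E \<Longrightarrow> T \<subseteq> {..<p} \<Longrightarrow> card T = 2 * s \<Longrightarrow> a \<in> {1, 1 - t, 1 + t} \<Longrightarrow> u \<in> rat_dirs T \<Longrightarrow>
    \<bar>(\<Sum>i<n. indicat_real (ellipsoid_slab p G a u) (x i)) - real n * measure R (ellipsoid_slab p G a u)\<bar> \<le> real n * \<eta>"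
    unfolding PP_def R_def[symmetric] n_\<eta> by metis
  have "(frobenius_norm (V_hat x * transpose_mat (V_hat x) - V * transpose_mat V))\<^sup>2 \<le> 8 * C\<^sub>2 * (1 + M)\<^sup>2 * c\<^sub>0 * EB"
    if x: "x \<in> E" for x
  proof -
    define H where "H = \<Gamma>_hat x"
    have "x \<in> space PP" using E(1) x sets.sets_into_space by blast
    moreover have "sets PP = sets (\<Pi>\<^sub>M i\<in>{..<n}. Rn p)"
      unfolding PP_def R_def[symmetric] by (rule sets_PiM_cong) (use R_sets in auto)
    ultimately have x_space: "x \<in> space (\<Pi>\<^sub>M i\<in>{..<n}. Rn p)" using sets_eq_imp_space_eq by blast
    have xi: "x i \<in> space (Rn p)" if "i < n" for i
      using x_space that by (auto simp: space_PiM PiE_iff)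
    have H_sparse: "H \<in> sparse_cov p s" and lead: "leading_eigenvectors p r H (V_hat x)"
      and opt: "matrix_depth (sparse_dirs p s) n (\<lambda>i. Matrix.vec p (x i)) \<Gamma>
        \<le> matrix_depth (sparse_dirs p s) n (\<lambda>i. Matrix.vec p (x i)) H"
      using est[OF x_space] spiked_cov_in_sparse_cov[OF \<Gamma> lam] unfolding H_def is_arg_max_def by (auto simp: not_less)
    obtain S1 where S1: "S1 \<subseteq> {..<p}" "card S1 \<le> s" and H_carrier: "H \<in> carrier_mat p p"
      and H_sym: "\<And>i j. i < p \<Longrightarrow> j < p \<Longrightarrow> H $$ (i, j) = H $$ (j, i)"
      and H_off: "\<And>i j. i < p \<Longrightarrow> j < p \<Longrightarrow> i \<noteq> j \<Longrightarrow> i \<notin> S1 \<or> j \<notin> S1 \<Longrightarrow> H $$ (i, j) = 0"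
      using sparse_covD[OF H_sparse] by metis
    obtain S2 where S2: "S2 \<subseteq> {..<p}" "card S2 \<le> s"
      and \<Gamma>_off: "\<And>i j. i < p \<Longrightarrow> j < p \<Longrightarrow> i \<noteq> j \<Longrightarrow> i \<notin> S2 \<or> j \<notin> S2 \<Longrightarrow> \<Gamma> $$ (i, j) = 0"
      using sparse_covD[OF spiked_cov_in_sparse_cov[OF \<Gamma> lam]] by metis
    have mix: "(1 - \<epsilon>) * measure P B \<le> measure R B \<and> measure R B \<le> (1 - \<epsilon>) * measure P B + \<epsilon>"
      if "B \<in> sets (Rn p)" for B
    proof -
      have "measure R B = (1 - \<epsilon>) * measure P B + \<epsilon> * measure Q B" using mixture(3) that P_prob(2) by simp
      moreover have "\<epsilon> * measure Q B \<le> \<epsilon> * 1" using \<epsilon> Q.prob_le_1 by (intro mult_left_mono) auto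
      moreover have "0 \<le> \<epsilon> * measure Q B" using \<epsilon> by simp
      ultimately show ?thesis by linarith
    qed
    have sparse_close: "\<bar>ip p u (mv p (\<lambda>i j. H $$ (i, j) - \<Gamma> $$ (i, j)) u)\<bar> \<le> \<beta> * ip p u u"
      if T: "T \<subseteq> {..<p}" "card T = 2 * s" and u: "\<And>i. i \<notin> T \<Longrightarrow> u i = 0" for T u
    proof -
      have "\<bar>ip p u (mv p (\<lambda>i j. H $$ (i, j) - \<Gamma> $$ (i, j)) u)\<bar> \<le> t * ip p u (mv p (entries \<Gamma>) u)"
      proof (rule depth_maximizer_quadratic_bound[OF _ s(2,1) \<epsilon> P_prob mixture(2) R_sets mix \<Gamma>_carrier H_carrier xi _ _ t _ \<eta> _ opt T u])
        show "1 \<le> n" using n by simp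
        show "0 < ip p u (mv p (entries \<Gamma>) u)" if "0 < ip p u u" for u
          using G_pos[OF that] by (simp add: G_def)
        show "measure P (ellipsoid_slab p (entries \<Gamma>) 1 u) = 1 / 2" if "0 < ip p u u" for u
          using median[OF that] by (simp add: G_def)
        show "2 * \<epsilon> + 3 * \<eta> \<le> \<bar>measure P (ellipsoid_slab p (entries \<Gamma>) 1 u) - measure P (ellipsoid_slab p (entries \<Gamma>) a u)\<bar>"
          if "0 < ip p u u" "a \<in> {1 - t, 1 + t}" for u a
          using steep[OF that] by (simp add: G_def \<omega>_def)
        show "\<bar>(\<Sum>i<n. indicat_real (ellipsoid_slab p (entries \<Gamma>) a u) (x i))
            - real n * measure R (ellipsoid_slab p (entries \<Gamma>) a u)\<bar> \<le> real n * \<eta>"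
          if "T \<subseteq> {..<p}" "card T = 2 * s" "a \<in> {1, 1 - t, 1 + t}" "u \<in> rat_dirs T" for T a u
          using dev[OF x that] by (simp add: G_def)
      qed
      also have "\<dots> \<le> t * ((1 + M) * ip p u u)" using t G_upper[of u] unfolding G_def by (intro mult_left_mono) auto
      also have "\<dots> = \<beta> * ip p u u" by (simp add: \<beta>_def)
      finally show ?thesis .
    qed
    have S: "S1 \<union> S2 \<subseteq> {..<p}" "card (S1 \<union> S2) \<le> 2 * s"
      using S1 S2 card_Un_le[of S1 S2] by auto
    have "0 < 2 * s" using s(1) by simp
    have close: "\<bar>ip p y (mv p (\<lambda>i j. H $$ (i, j) - \<Gamma> $$ (i, j)) y)\<bar> \<le> \<beta> * ip p y y" for y
    proof (rule sparse_quadratic_bound_extends[OF S \<open>0 < 2 * s\<close> s(2) _ sparse_close])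
      fix i j assume "i < p" "j < p" "i \<noteq> j" "i \<notin> S1 \<union> S2 \<or> j \<notin> S1 \<union> S2"
      then show "H $$ (i, j) - \<Gamma> $$ (i, j) = 0" using H_off[of i j] \<Gamma>_off[of i j] by auto
    qed
    have "(frobenius_norm (V_hat x * transpose_mat (V_hat x) - V * transpose_mat V))\<^sup>2 \<le> 8 * real r * \<beta>\<^sup>2 / lam\<^sup>2"
      by (rule leading_eigenvectors_perturbation[OF \<Gamma> lam(1) r(1) H_carrier H_sym lead close \<beta> \<beta>_half])
    also have "\<dots> \<le> 8 * C\<^sub>2 * ((1 + M)\<^sup>2 * c\<^sub>0 * EB)"
    proof -
      have "\<beta>\<^sup>2 / lam\<^sup>2 \<le> (1 + M)\<^sup>2 * c\<^sub>0 * EB" using \<beta>2 lam by (simp add: pos_divide_le_eq)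
      then have "8 * real r * (\<beta>\<^sup>2 / lam\<^sup>2) \<le> 8 * C\<^sub>2 * ((1 + M)\<^sup>2 * c\<^sub>0 * EB)"
        using r by (intro mult_mono) auto
      then show ?thesis by simp
    qed
    finally show ?thesis by (simp add: mult.assoc)
  qed
  moreover have "1 - 2 * \<delta> \<le> measure PP E" using E(2) \<delta>(1) by linarith
  moreover have "E \<subseteq> space PP" using E(1) by (rule sets.sets_into_space)
  ultimately show ?thesis using E(1) by blast
qed

theorem theorem4p5:
  fixes M \<tau> :: real
  assumes "M > 0" and "0 < \<tau>" and "\<tau> < 1 / 2"
  shows "\<forall>C\<^sub>2>0. \<exists>C>0. \<exists>C\<^sub>1>0.
    \<forall>n p s r :: nat. \<forall>lam \<alpha>\<^sub>0 \<kappa> \<epsilon> :: real.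
      0 < n \<and> 0 < p \<and> 0 < s \<and> 0 < r \<and> 2 * s \<le> p \<and> real r \<le> C\<^sub>2 \<and>
      0 < lam \<and> lam \<le> M \<and> 0 < \<alpha>\<^sub>0 \<and> 0 < \<kappa> \<and> 0 \<le> \<epsilon> \<and> \<epsilon> \<le> 1 \<longrightarrow>
      (\<forall>\<Gamma>_hat V_hat :: (nat \<Rightarrow> nat \<Rightarrow> real) \<Rightarrow> real mat.
        (\<forall>x \<in> space (\<Pi>\<^sub>M i\<in>{..<n}. Rn p).
           is_arg_max (matrix_depth (sparse_dirs p s) n (\<lambda>i. Matrix.vec p (x i)))
             (\<lambda>\<Gamma>. \<Gamma> \<in> sparse_cov p s) (\<Gamma>_hat x) \<and>
           leading_eigenvectors p r (\<Gamma>_hat x) (V_hat x)) \<longrightarrow>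
        (\<forall>\<delta>. 0 < \<delta> \<and> \<delta> < 1 / 2 \<and> C\<^sub>1 * error_bound n p s lam \<kappa> \<epsilon> \<delta> \<le> 1 \<longrightarrow>
          (\<forall>Q V l \<Gamma> \<nu> P.
            prob_space Q \<and> sets Q = sets (Rn p) \<and>
            spiked_cov p s lam M r V l \<Gamma> \<and>
            canonical_elliptical p \<Gamma> \<nu> P \<and> marginal_condition p \<Gamma> P \<tau> \<alpha>\<^sub>0 \<kappa> \<longrightarrow>
            (let PP = \<Pi>\<^sub>M i\<in>{..<n}. contamination \<epsilon> P Q in
              \<exists>E \<in> sets PP.
                E \<subseteq> {x \<in> space PP.
                   (frobenius_norm (V_hat x * transpose_mat (V_hat x) - V * transpose_mat V))\<^sup>2
                     \<le> C * error_bound n p s lam \<kappa> \<epsilon> \<delta>} \<and>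
                measure PP E \<ge> 1 - 2 * \<delta>))))"
proof (intro allI impI)
  fix C\<^sub>2 :: real
  assume C2: "0 < C\<^sub>2"
  obtain k where k: "0 < k" and slope: "\<And>p \<Gamma> P \<alpha>\<^sub>0 \<kappa>. spread_law \<tau> p \<Gamma> P \<alpha>\<^sub>0 \<kappa> \<Longrightarrow> k \<le> \<kappa>"
    using marginal_slope_lower_bound[OF assms(2)] by blast
  define C where "C = 8 * C\<^sub>2 * (1 + M)\<^sup>2 * 4000000"
  \<comment> \<open>c1 makes the error at most half the spectral gap, c2 makes it smaller than \<tau>\<close>
  define c1 c2 where "c1 = 4 * (1 + M)\<^sup>2 * 4000000" and "c2 = 2 * 4000000 * M\<^sup>2 / (k * \<tau>\<^sup>2)"
  have c: "0 < c1" "0 < c2" "0 < C" using assms(1,2) k C2 by (simp_all add: c1_def c2_def C_def)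
  have main: "\<exists>E\<in>sets (PiM {..<n} (\<lambda>_. contamination \<epsilon> P Q)). E \<subseteq> {x \<in> space (PiM {..<n} (\<lambda>_. contamination \<epsilon> P Q)).
      (frobenius_norm (V_hat x * transpose_mat (V_hat x) - V * transpose_mat V))\<^sup>2 \<le> C * error_bound n p s lam \<kappa> \<epsilon> \<delta>} \<and>
    1 - 2 * \<delta> \<le> measure (PiM {..<n} (\<lambda>_. contamination \<epsilon> P Q)) E"
    if par: "0 < n" "0 < p" "0 < s" "0 < r" "2 * s \<le> p" "real r \<le> C\<^sub>2" "0 < lam" "lam \<le> M" "0 < \<alpha>\<^sub>0" "0 < \<kappa>" "0 \<le> \<epsilon>" "\<epsilon> \<le> 1"
      and est: "\<forall>x \<in> space (\<Pi>\<^sub>M i\<in>{..<n}. Rn p).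
           is_arg_max (matrix_depth (sparse_dirs p s) n (\<lambda>i. Matrix.vec p (x i)))
             (\<lambda>\<Gamma>. \<Gamma> \<in> sparse_cov p s) (\<Gamma>_hat x) \<and> leading_eigenvectors p r (\<Gamma>_hat x) (V_hat x)"
      and \<delta>: "0 < \<delta>" "\<delta> < 1 / 2" "(c1 + c2) * error_bound n p s lam \<kappa> \<epsilon> \<delta> \<le> 1"
      and model: "prob_space Q" "sets Q = sets (Rn p)" "spiked_cov p s lam M r V l \<Gamma>"
        "canonical_elliptical p \<Gamma> \<nu> P" "marginal_condition p \<Gamma> P \<tau> \<alpha>\<^sub>0 \<kappa>"
    for n p s r :: nat and lam \<alpha>\<^sub>0 \<kappa> \<epsilon> :: real and \<Gamma>_hat V_hat :: "(nat \<Rightarrow> nat \<Rightarrow> real) \<Rightarrow> real mat"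
      and \<delta> :: real and Q V l \<Gamma> \<nu> P
  proof -
    define EB where "EB = error_bound n p s lam \<kappa> \<epsilon> \<delta>"
    have "0 \<le> ln (1 / \<delta>) / (real n * lam\<^sup>2)" using \<delta>(1,2) by (intro divide_nonneg_nonneg ln_ge_zero) auto
    moreover have "0 \<le> max (real s * ln (exp 1 * real p / real s) / (real n * lam\<^sup>2)) (\<epsilon>\<^sup>2 / lam\<^sup>2)"
      by (rule max.coboundedI2) simp
    ultimately have EB: "0 \<le> EB" unfolding EB_def error_bound_def using par(10) by (intro mult_nonneg_nonneg add_nonneg_nonneg) auto
    have split: "c1 * EB \<le> 1" "c2 * EB \<le> 1"
    proof -
      have "0 \<le> c1 * EB" "0 \<le> c2 * EB" using c EB by simp_all
      moreover have "c1 * EB + c2 * EB \<le> 1" using \<delta>(3) unfolding EB_def[symmetric] distrib_right .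
      ultimately show "c1 * EB \<le> 1" "c2 * EB \<le> 1" by linarith+
    qed
    have ell: "elliptical p \<Gamma> \<nu> P" using model(4) by (simp add: canonical_elliptical_def)
    have "0 < ip p u (mv p (entries \<Gamma>) u)" if "0 < ip p u u" for u
      using spiked_cov_quadratic_bounds(1)[OF model(3) par(7,8), of u] that by linarith
    moreover have "2 \<le> p" using par(3,5) by linarith
    ultimately have "k \<le> \<kappa>"
      using slope[of p \<Gamma> P \<alpha>\<^sub>0 \<kappa>] elliptical_prob_space[OF ell] spiked_cov_entries(1)[OF model(3)]
        spiked_cov_symmetric[OF model(3)] par(9,10) model(5) unfolding spread_law_def by blast
    then show ?thesis
      using depth_estimator_error_bound[OF assms(1,2) k _ par(1,3,5,4,6,7,8,11,12) \<delta>(1,2) est[rule_format] _ _ model]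
        split unfolding c1_def c2_def C_def EB_def by blast
  qed
  show "\<exists>C>0. \<exists>C\<^sub>1>0.
    \<forall>n p s r :: nat. \<forall>lam \<alpha>\<^sub>0 \<kappa> \<epsilon> :: real.
      0 < n \<and> 0 < p \<and> 0 < s \<and> 0 < r \<and> 2 * s \<le> p \<and> real r \<le> C\<^sub>2 \<and>
      0 < lam \<and> lam \<le> M \<and> 0 < \<alpha>\<^sub>0 \<and> 0 < \<kappa> \<and> 0 \<le> \<epsilon> \<and> \<epsilon> \<le> 1 \<longrightarrow>
      (\<forall>\<Gamma>_hat V_hat :: (nat \<Rightarrow> nat \<Rightarrow> real) \<Rightarrow> real mat.
        (\<forall>x \<in> space (\<Pi>\<^sub>M i\<in>{..<n}. Rn p).
           is_arg_max (matrix_depth (sparse_dirs p s) n (\<lambda>i. Matrix.vec p (x i)))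
             (\<lambda>\<Gamma>. \<Gamma> \<in> sparse_cov p s) (\<Gamma>_hat x) \<and>
           leading_eigenvectors p r (\<Gamma>_hat x) (V_hat x)) \<longrightarrow>
        (\<forall>\<delta>. 0 < \<delta> \<and> \<delta> < 1 / 2 \<and> C\<^sub>1 * error_bound n p s lam \<kappa> \<epsilon> \<delta> \<le> 1 \<longrightarrow>
          (\<forall>Q V l \<Gamma> \<nu> P.
            prob_space Q \<and> sets Q = sets (Rn p) \<and>
            spiked_cov p s lam M r V l \<Gamma> \<and>
            canonical_elliptical p \<Gamma> \<nu> P \<and> marginal_condition p \<Gamma> P \<tau> \<alpha>\<^sub>0 \<kappa> \<longrightarrow>
            (let PP = \<Pi>\<^sub>M i\<in>{..<n}. contamination \<epsilon> P Q in
              \<exists>E \<in> sets PP.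
                E \<subseteq> {x \<in> space PP.
                   (frobenius_norm (V_hat x * transpose_mat (V_hat x) - V * transpose_mat V))\<^sup>2
                     \<le> C * error_bound n p s lam \<kappa> \<epsilon> \<delta>} \<and>
                measure PP E \<ge> 1 - 2 * \<delta>))))"
  proof (intro exI conjI)
    show "0 < C" "0 < c1 + c2" using c by auto
  qed (unfold Let_def, intro allI impI, elim conjE, rule main, assumption+)
qed

end
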